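(* Let $T$ be a bicentroidal tree with centroidal edge $ab$, and let $G$ and $H$ be the two components of $T-ab$, with $a\in V(G)$ and $b\in V(H)$. Suppose that $\deg(a)=\deg(b)=2$ (degrees in $T$) and that neither $G$ nor $H$ is a pseudopath. Then $\mathrm{ern}(T)=2$.
   Context: All graphs are finite, simple and undirected. An edge-card of a graph $G$ is an edge-deleted subgraph $G-e$ (all vertices are kept), considered up to isomorphism. For distinct edges $e_1,\dots,e_k$ of $G$, the edge-cards $G-e_1,\dots,G-e_k$ are said to reconstruct $G$ if every graph $H$ having distinct edges $f_1,\dots,f_k$ with $H-f_i\simeq G-e_i$ for all $i$ is isomorphic to $G$ ($H$ ranges over all graphs, not only trees). The edge-reconstruction number $\mathrm{ern}(G)$ is the least $k$ for which some $k$ edge-cards of $G$ reconstruct $G$. The weight of a vertex $v$ of a tree $T$ is the number of vertices in a largest component of $T-v$. The centroid of $T$ is the set of vertices of minimum weight; it consists of one vertex or of two adjacent vertices. $T$ is bicentroidal if its centroid has two vertices $a,b$; then $ab$ is the centroidal edge, and the two components of $T-ab$ (the centroidal components) each have $|V(T)|/2$ vertices. $S_{p,q,r}$ denotes the tree consisting of three paths with $p$, $q$ and $r$ edges, respectively, emanating from a common vertex and otherwise disjoint. A pseudopath is a tree isomorphic to a path $P_k$ on $k$ vertices (for some $k$), to $S_1=S_{1,1,2}$, or to $S_2=S_{1,2,3}$. *)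

theory Defs
  imports "HOL-Library.Extended_Nat"
begin

text \<open>
  Graphs are carried by an explicit vertex set and a set of two-element vertex sets.
  The digraph library of the AFP is not used: there a symmetric digraph with at least one edge
  has a directed cycle of length two, so its notion of tree does not apply to undirected graphs.
\<close>

datatype 'a graph = Graph (verts: "'a set") (edges: "'a set set")

definition sgraph :: "'a graph \<Rightarrow> bool" where
  "sgraph G \<longleftrightarrow> finite (verts G) \<and> (\<forall>e\<in>edges G. e \<subseteq> verts G \<and> card e = 2)"

definition iso :: "'a graph \<Rightarrow> 'b graph \<Rightarrow> bool"  (infix \<open>\<simeq>\<close> 50) where
  "G \<simeq> H \<longleftrightarrow> (\<exists>f. bij_betw f (verts G) (verts H) \<and>
     (\<forall>u\<in>verts G. \<forall>v\<in>verts G. {u, v} \<in> edges G \<longleftrightarrow> {f u, f v} \<in> edges H))"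

definition degree :: "'a graph \<Rightarrow> 'a \<Rightarrow> nat" where
  "degree G v = card {e \<in> edges G. v \<in> e}"

definition del_edge :: "'a graph \<Rightarrow> 'a set \<Rightarrow> 'a graph" where
  "del_edge G e = Graph (verts G) (edges G - {e})"

definition induced :: "'a graph \<Rightarrow> 'a set \<Rightarrow> 'a graph" where
  "induced G A = Graph (verts G \<inter> A) {e \<in> edges G. e \<subseteq> A}"

definition del_vert :: "'a graph \<Rightarrow> 'a \<Rightarrow> 'a graph" where
  "del_vert G v = induced G (verts G - {v})"

definition reachable :: "'a graph \<Rightarrow> 'a \<Rightarrow> 'a \<Rightarrow> bool" where
  "reachable G u v \<longleftrightarrow> (u, v) \<in> {(x, y). {x, y} \<in> edges G}\<^sup>*"

definition connected :: "'a graph \<Rightarrow> bool" where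
  "connected G \<longleftrightarrow> verts G \<noteq> {} \<and> (\<forall>u\<in>verts G. \<forall>v\<in>verts G. reachable G u v)"

definition components :: "'a graph \<Rightarrow> 'a graph set" where
  "components G = {induced G {u \<in> verts G. reachable G v u} | v. v \<in> verts G}"

definition is_cycle :: "'a graph \<Rightarrow> 'a list \<Rightarrow> bool" where
  "is_cycle G c \<longleftrightarrow> 3 \<le> length c \<and> distinct c \<and>
     successively (\<lambda>x y. {x, y} \<in> edges G) c \<and> {last c, hd c} \<in> edges G"

definition tree :: "'a graph \<Rightarrow> bool" where
  "tree G \<longleftrightarrow> sgraph G \<and> connected G \<and> (\<nexists>c. is_cycle G c)"

text \<open>
  In the one-vertex tree the maximum below is taken over the empty set and is unspecified; the
  centroid is nevertheless the single vertex.
\<close>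

definition weight :: "'a graph \<Rightarrow> 'a \<Rightarrow> nat" where
  "weight T v = Max ((\<lambda>C. card (verts C)) ` components (del_vert T v))"

definition centroid :: "'a graph \<Rightarrow> 'a set" where
  "centroid T = {v \<in> verts T. \<forall>u\<in>verts T. weight T v \<le> weight T u}"

definition bicentroidal :: "'a graph \<Rightarrow> bool" where
  "bicentroidal T \<longleftrightarrow> tree T \<and> card (centroid T) = 2"

definition path_graph :: "nat \<Rightarrow> nat graph" where
  "path_graph k = Graph {0..<k} {{i, Suc i} | i. Suc i < k}"

text \<open>The \<open>j\<close>-th vertex on the \<open>i\<close>-th leg of a spider; the legs share their \<open>0\<close>-th vertex.\<close>

definition leg :: "nat \<Rightarrow> nat \<Rightarrow> nat \<times> nat" where
  "leg i j = (if j = 0 then (0, 0) else (i, j))"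

definition spider :: "nat \<Rightarrow> nat \<Rightarrow> nat \<Rightarrow> (nat \<times> nat) graph" where
  "spider p q r = Graph
     {leg i j | i j. i < 3 \<and> j \<le> [p, q, r] ! i}
     {{leg i j, leg i (Suc j)} | i j. i < 3 \<and> j < [p, q, r] ! i}"

definition pseudopath :: "'a graph \<Rightarrow> bool" where
  "pseudopath G \<longleftrightarrow> tree G \<and>
     ((\<exists>k. G \<simeq> path_graph k) \<or> G \<simeq> spider 1 1 2 \<or> G \<simeq> spider 1 2 3)"

text \<open>
  A choice of \<open>k\<close> distinct edges is a distinct list of length \<open>k\<close>. Every finite graph is
  isomorphic to one with vertices in \<open>nat\<close>, so letting \<open>H\<close> range over those covers all graphs.
\<close>

definition reconstructs :: "'a graph \<Rightarrow> 'a set list \<Rightarrow> bool" where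
  "reconstructs G es \<longleftrightarrow> (\<forall>(H :: nat graph) fs.
     sgraph H \<and> distinct fs \<and> set fs \<subseteq> edges H \<and> length fs = length es \<and>
     (\<forall>i<length es. del_edge H (fs ! i) \<simeq> del_edge G (es ! i)) \<longrightarrow> H \<simeq> G)"

text \<open>The value is \<open>\<infinity>\<close> if no choice of edge-cards reconstructs \<open>G\<close>.\<close>

definition ern :: "'a graph \<Rightarrow> enat" where
  "ern G = Inf {enat k | k. \<exists>es. distinct es \<and> set es \<subseteq> edges G \<and> length es = k \<and>
     reconstructs G es}"

end

theory Submission
  imports Defs "HOL-Library.Multiset"
begin

text \<open>
  Let \<open>A\<close> and \<open>B\<close> be the halves of \<open>T - ab\<close>, rooted at \<open>a\<close> and \<open>b\<close>, and let \<open>A\<^sub>1\<close>, \<open>B\<^sub>1\<close> be what is left of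
  them without their roots. One of the two edge-cards is always \<open>T - ab\<close>; the other one is
  \<open>T - aa\<^sub>1\<close>, \<open>T - bb\<^sub>1\<close> or \<open>T - e\<close> with a leaf edge \<open>e\<close>. It contains a component that is larger than \<open>A\<close>,
  so a reconstruction consists of trees isomorphic to \<open>A\<close> and \<open>B\<close> that are joined by an edge, and only
  the ends \<open>x\<close>, \<open>y\<close> of this edge remain to be determined.

  Since removal-similar leaves of a tree are similar, \<open>T - aa\<^sub>1\<close> succeeds unless \<open>A\<close> and \<open>B\<close> are not
  isomorphic, \<open>B\<close> arises from \<open>A\<^sub>1\<close> by adding a leaf and \<open>B\<close> with a leaf at \<open>b\<close> arises from \<open>A\<close> by adding
  a leaf. If \<open>T - bb\<^sub>1\<close> fails as well, then \<open>A\<close> and \<open>B\<close> have the same diameter. If the centres of \<open>A\<close> and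
  \<open>B\<close> do not notice further leaves attached at \<open>a\<close> and \<open>b\<close>, then \<open>A\<close> and \<open>B\<close> are isomorphic. Otherwise,
  say, \<open>a\<close> is a deepest leaf of \<open>A\<close>, seen from the centre, and comparing centres describes \<open>B\<close> in terms
  of \<open>A\<close>: two opposite limbs exchange a deepest leaf. Then some leaf edge of \<open>A\<close> can be used,
  or else the number of branching vertices or, if these agree, the sum of their distances to
  the centre is smaller for \<open>B\<close> than for \<open>A\<close>, which cannot also happen with \<open>A\<close> and \<open>B\<close> exchanged.
\<close>

section \<open>Rooted trees\<close>

text \<open>Inclusions of unrooted trees are hard to combine, since each brings its own embedding.
  If neither \<open>T - aa1\<close> nor \<open>T - bb1\<close> works, the halves have been
  exchanged, and the isomorphism types interlace: writing A+ for A with a leaf at its root, one leaf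
  leads from A1 to B, from B to A+, from B1 to A and from A to B+. Seen from the centre, which
  isomorphisms preserve, an inclusion becomes one of rooted trees, as long as the new leaf lengthens
  no longest path. This is why everything turns on whether the root is a deepest leaf. One calculus
  of balanced points serves twice: measuring limbs by height gives the centre, by which A and B are
  compared, and measuring them by size gives the centroid, which locates \<open>b\<close> in the
  large component of \<open>T - e\<close> and the edge \<open>ab\<close> in \<open>T\<close>. The
  combinatorics is done on terms for isomorphism types of rooted trees; graphs enter through the
  relation \<open>shp\<close>.\<close>

lemma add_mset_neqE:
  assumes "add_mset a A = add_mset b B" "a \<noteq> b"
  obtains K where "A = add_mset b K" "B = add_mset a K"
  using assms that by (metis add_eq_conv_ex)

text \<open>Children form a multiset, so equality of terms is isomorphism of rooted trees.\<close>

datatype rt = Nd (ch: "rt multiset")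

abbreviation Lf :: rt where "Lf \<equiv> Nd {#}"

primrec sz :: "rt \<Rightarrow> nat" where
  "sz (Nd M) = Suc (\<Sum>\<^sub># (image_mset sz M))"

text \<open>Heights count vertices, so a leaf has height 1; the extra 0 makes the maximum defined
  there.\<close>

primrec ht :: "rt \<Rightarrow> nat" where
  "ht (Nd M) = Suc (Max_mset (add_mset 0 (image_mset ht M)))"

lemma sz_pos [simp]: "0 < sz R" "sz R \<noteq> 0"
  by (cases R; simp)+

lemma ht_pos [simp]: "0 < ht R" "ht R \<noteq> 0"
  by (cases R; simp)+

lemma ht_Lf [simp]: "ht Lf = 1"
  by simp

lemma ht_add: "ht (Nd (add_mset X M)) = max (Suc (ht X)) (ht (Nd M))"
proof -
  have "insert 0 (insert (ht X) (ht ` set_mset M)) = insert (ht X) (insert 0 (ht ` set_mset M))"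
    by blast
  then show ?thesis by (simp add: max_def)
qed

declare ht.simps [simp del]

lemma ht_ge1 [simp]: "Suc 0 \<le> ht R"
  by (simp add: Suc_le_eq)

lemma ht_empty [simp]: "ht (Nd {#}) = 1"
  by (simp add: ht.simps)

lemma ht_mem: "Z \<in># M \<Longrightarrow> ht Z < ht (Nd M)"
  by (metis ht_add insert_DiffM less_max_iff_disj lessI)

lemma ht_mem_ch: "Z \<in># ch X \<Longrightarrow> ht Z < ht X"
  by (cases X) (simp add: ht_mem)

lemma ht_ex: "M \<noteq> {#} \<Longrightarrow> \<exists>Z\<in>#M. ht (Nd M) = Suc (ht Z)"
proof (induction M)
  case (add X M)
  show ?case
  proof (cases "M = {#}")
    case True
    then show ?thesis using add by (auto simp: ht_add max_def)
  next
    case False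
    then obtain Z where "Z \<in># M" "ht (Nd M) = Suc (ht Z)" using add by blast
    then show ?thesis by (auto simp: ht_add max_def)
  qed
qed simp

lemma sz_mem: "Z \<in># M \<Longrightarrow> sz Z < sz (Nd M)"
  by (metis insert_DiffM image_mset_add_mset sum_mset.insert sz.simps less_Suc_eq_le le_add1)

lemma sz_eq_1: "sz R = 1 \<longleftrightarrow> R = Lf"
proof (cases R)
  case (Nd M)
  then show ?thesis by (cases M) auto
qed

text \<open>
  The root moves along an edge, so that \<open>\<approx>\<close> below is isomorphism of unrooted trees.
\<close>

inductive rstep :: "rt \<Rightarrow> rt \<Rightarrow> bool" where
  rstep: "rstep (Nd (add_mset Y M)) (Nd (add_mset (Nd M) (ch Y)))"

lemma rstep_sym: "rstep R S \<Longrightarrow> rstep S R"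
  by (induction rule: rstep.induct) (metis rstep.intros rt.exhaust_sel rt.sel)

abbreviation ueq :: "rt \<Rightarrow> rt \<Rightarrow> bool" (infix \<open>\<approx>\<close> 50) where
  "R \<approx> S \<equiv> rstep\<^sup>*\<^sup>* R S"

lemma ueq_sym: "R \<approx> S \<Longrightarrow> S \<approx> R"
  by (induction rule: rtranclp_induct) (auto intro: converse_rtranclp_into_rtranclp rstep_sym)

lemma ueq_trans: "R \<approx> S \<Longrightarrow> S \<approx> T \<Longrightarrow> R \<approx> T"
  by (rule rtranclp_trans)

lemma rstep_sz: "rstep R S \<Longrightarrow> sz R = sz S"
  by (induction rule: rstep.induct) (metis (no_types, lifting) add.commute add_Suc_right image_mset_add_mset rt.exhaust_sel sum_mset.insert sz.simps group_cancel.add1)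

lemma ueq_sz: "R \<approx> S \<Longrightarrow> sz R = sz S"
  by (induction rule: rtranclp_induct) (auto dest: rstep_sz)

text \<open>
  A list \<open>[O\<^sub>0, \<dots>, O\<^sub>k]\<close> describes a tree with a path from a root to a marked vertex: \<open>O\<^sub>i\<close> are the
  limbs hanging off the \<open>i\<close>-th vertex of the path. \<open>cf\<close> gives the limbs at the root, \<open>up f\<close> the tree
  rooted at the marked vertex. If \<open>f\<close> is false, the root is not a vertex but the midpoint of an edge,
  and \<open>O\<^sub>0\<close> consists of the far half of the tree.
\<close>

fun cf :: "rt multiset list \<Rightarrow> rt multiset" where
  "cf [] = {#}"
| "cf [Q] = Q"
| "cf (Q # P # \<pi>) = add_mset (Nd (cf (P # \<pi>))) Q"

fun upa :: "rt multiset \<Rightarrow> rt multiset list \<Rightarrow> rt" where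
  "upa U [] = Lf"
| "upa U [Q] = Nd (Q + U)"
| "upa U (Q # P # \<pi>) = upa {#Nd (Q + U)#} (P # \<pi>)"

definition up :: "bool \<Rightarrow> rt multiset list \<Rightarrow> rt" where
  "up f \<pi> = (if f then upa {#} \<pi> else upa (hd \<pi>) (tl \<pi>))"

text \<open>With \<open>f\<close> false, the first entry holds nothing but the far half, so the
  marked vertex needs a later entry.\<close>

definition ctx :: "bool \<Rightarrow> rt multiset list \<Rightarrow> bool" where
  "ctx f \<pi> \<longleftrightarrow> \<pi> \<noteq> [] \<and> (f \<or> 2 \<le> length \<pi> \<and> size (hd \<pi>) = 1)"

lemma cf_Cons: "\<pi> \<noteq> [] \<Longrightarrow> cf (Q # \<pi>) = add_mset (Nd (cf \<pi>)) Q"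
  by (cases \<pi>) auto

text \<open>If the path is shortened, its last vertex becomes an ordinary limb of the one
  before.\<close>

lemma cf_snoc: "\<pi> \<noteq> [] \<Longrightarrow> cf (\<pi> @ [Q]) = cf (butlast \<pi> @ [add_mset (Nd Q) (last \<pi>)])"
  by (induction \<pi> rule: cf.induct) (auto simp: cf_Cons)

lemma upa_snoc: "\<pi> \<noteq> [] \<Longrightarrow> upa U (\<pi> @ [Q]) = Nd (add_mset (upa U \<pi>) Q)"
  by (induction U \<pi> rule: upa.induct) (auto simp: neq_Nil_conv)

lemma up_snoc: "ctx f \<pi> \<Longrightarrow> up f (\<pi> @ [Q]) = Nd (add_mset (up f \<pi>) Q)"
proof -
  assume "ctx f \<pi>"
  then obtain Q \<rho> where "\<pi> = Q # \<rho>" "f \<or> \<rho> \<noteq> []" by (cases \<pi>) (fastforce simp: ctx_def)+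
  then show ?thesis using upa_snoc[of "Q # \<rho>" "{#}"] upa_snoc[of \<rho> Q] by (auto simp: up_def)
qed

lemma up_True_single [simp]: "up True [Q] = Nd Q"
  by (simp add: up_def)

lemma up_False_double [simp]: "up False [{#X#}, Q] = Nd (add_mset X Q)"
  by (simp add: up_def)

lemma pair_mset_eq: "{#a, b#} = {#c, d#} \<longleftrightarrow> a = c \<and> b = d \<or> a = d \<and> b = c"
  by (auto simp: add_eq_conv_ex)

text \<open>\<open>up\<close> unfolds at the marked end of the list, which is why the last entry is
  split off and not the first.\<close>

lemma ctx_cases:
  assumes "ctx f \<pi>"
  obtains (vertex) Q where "f" "\<pi> = [Q]"
  | (edge) X Q where "\<not> f" "\<pi> = [{#X#}, Q]"
  | (snoc) \<rho> Q where "ctx f \<rho>" "\<pi> = \<rho> @ [Q]"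
proof (cases "butlast \<pi> = []")
  case True
  then have "length \<pi> \<le> 1" by (metis One_nat_def diff_is_0_eq length_butlast list.size(3))
  then show ?thesis using assms vertex by (cases \<pi>) (auto simp: ctx_def)
next
  case False
  then have p: "\<pi> = butlast \<pi> @ [last \<pi>]" by (metis append_butlast_last_id butlast.simps(1))
  show ?thesis
  proof (cases "ctx f (butlast \<pi>)")
    case True
    then show ?thesis using p snoc by blast
  next
    case False2: False
    have "hd (butlast \<pi>) = hd \<pi>" using False p by (metis hd_append2)
    then have f: "\<not> f" "length (butlast \<pi>) < 2" "size (hd \<pi>) = 1" using False2 False assms by (auto simp: ctx_def)
    then obtain X where X: "hd \<pi> = {#X#}" using size_1_singleton_mset by fastforce
    obtain Q where "butlast \<pi> = [Q]" using False f(2) by (cases "butlast \<pi>") (auto simp: length_Suc_conv less_Suc_eq numeral_2_eq_2)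
    then show ?thesis using edge[OF f(1), of X "last \<pi>"] p X by (metis append_Cons append_Nil list.sel(1))
  qed
qed

lemma up_pull:
  assumes "ctx f \<rho>"
  shows "ctx f (butlast \<rho> @ [add_mset (Nd Q) (last \<rho>)])"
    and "up f (butlast \<rho> @ [add_mset (Nd Q) (last \<rho>)]) = Nd (add_mset (Nd Q) (ch (up f \<rho>)))"
    and "cf (butlast \<rho> @ [add_mset (Nd Q) (last \<rho>)]) = cf (\<rho> @ [Q])"
proof -
  let ?p = "butlast \<rho> @ [add_mset (Nd Q) (last \<rho>)]"
  have r: "\<rho> = butlast \<rho> @ [last \<rho>]" using assms by (simp add: ctx_def)
  show "ctx f ?p"
  proof (cases "butlast \<rho> = []")
    case True
    then have "length \<rho> < 2" by (metis length_butlast list.size(3) diff_is_0_eq One_nat_def numeral_2_eq_2 less_Suc_eq_le)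
    then show ?thesis using assms by (auto simp: ctx_def)
  next
    case False
    then have "hd ?p = hd \<rho>" using r by (metis hd_append2)
    then show ?thesis using assms by (auto simp: ctx_def)
  qed
  show "up f ?p = Nd (add_mset (Nd Q) (ch (up f \<rho>)))"
    using assms by (cases rule: ctx_cases) (auto simp: up_snoc up_True_single up_False_double)
  show "cf ?p = cf (\<rho> @ [Q])" using assms by (simp add: ctx_def cf_snoc)
qed

text \<open>A step of the marked vertex goes down into a limb, which lengthens the path, or back,
  which shortens it. Neither changes the tree as seen from the other end.\<close>

lemma up_closed:
  assumes "ctx f \<pi>" "rstep (up f \<pi>) S"
  shows "\<exists>\<pi>'. ctx f \<pi>' \<and> S = up f \<pi>' \<and> cf \<pi>' = cf \<pi>"
proof -
  have down: "\<exists>\<pi>'. ctx f \<pi>' \<and> Nd (add_mset (Nd M) (ch Y)) = up f \<pi>' \<and> cf \<pi>' = cf \<pi>"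
    if \<pi>: "\<pi> = \<rho> @ [add_mset Y Q]" and M: "up f (\<rho> @ [Q]) = Nd M" for \<rho> Q Y M
  proof -
    have c: "ctx f (\<rho> @ [Q])" using assms(1) \<pi> by (auto simp: ctx_def hd_append split: if_splits)
    have c': "ctx f (\<rho> @ [Q, ch Y])" using c by (auto simp: ctx_def hd_append split: if_splits)
    have "up f (\<rho> @ [Q, ch Y]) = Nd (add_mset (Nd M) (ch Y))"
      using up_snoc[OF c, of "ch Y"] M by simp
    moreover have "cf (\<rho> @ [Q, ch Y]) = cf \<pi>"
      using cf_snoc[of "\<rho> @ [Q]" "ch Y"] \<pi> by simp
    ultimately show ?thesis using c' by metis
  qed
  obtain Y M where R: "up f \<pi> = Nd (add_mset Y M)" and S: "S = Nd (add_mset (Nd M) (ch Y))"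
    using assms(2) by (auto elim: rstep.cases)
  from assms(1) show ?thesis
  proof (cases rule: ctx_cases)
    case (vertex Q)
    then have "Q = add_mset Y M" using R by (simp add: up_def)
    then show ?thesis unfolding S using vertex by (intro down[of "[]" Y M M]) (auto simp: up_def)
  next
    case (edge X Q)
    then have e: "add_mset X Q = add_mset Y M" using R by (simp add: up_def)
    show ?thesis
    proof (cases "Y = X")
      case True
      then have "M = Q" using e by simp
      \<comment> \<open>The marked vertex crosses the midpoint, and the two halves exchange their
        roles.\<close>
      then have "S = up f [{#Nd Q#}, ch X]" "cf [{#Nd Q#}, ch X] = cf \<pi>" "ctx f [{#Nd Q#}, ch X]"
        using S True edge by (auto simp: up_def ctx_def add_mset_commute)
      then show ?thesis by blast
    next
      case False
      then obtain Q' where "Q = add_mset Y Q'" "M = add_mset X Q'" using e by (metis add_eq_conv_ex)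
      then show ?thesis unfolding S using edge by (intro down[of "[{#X#}]" Y Q']) (auto simp: up_def)
    qed
  next
    case (snoc \<rho> Q)
    have e: "add_mset (up f \<rho>) Q = add_mset Y M" using R snoc by (simp add: up_snoc)
    show ?thesis
    proof (cases "Y = up f \<rho>")
      case True
      then have MQ: "M = Q" using e by simp
      show ?thesis unfolding S using up_pull[OF snoc(1), of Q] snoc(2) True MQ by metis
    next
      case False
      then obtain Q' where "Q = add_mset Y Q'" "M = add_mset (up f \<rho>) Q'" using e by (metis add_eq_conv_ex)
      then show ?thesis unfolding S using snoc by (intro down[of \<rho> Y Q']) (auto simp: up_snoc)
    qed
  qed
qed

lemma up_closed':
  assumes "ctx f \<pi>" "up f \<pi> \<approx> S"
  shows "\<exists>\<pi>'. ctx f \<pi>' \<and> S = up f \<pi>' \<and> cf \<pi>' = cf \<pi>"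
  using assms(2)
proof (induction rule: rtranclp_induct)
  case base
  then show ?case using assms(1) by blast
next
  case (step T S)
  then show ?case using up_closed by metis
qed

section \<open>Centres\<close>

text \<open>
  With \<open>M\<close> the limbs at a vertex (\<open>f\<close>) or at the midpoint of an edge (\<open>\<not> f\<close>), this is the centre of the
  tree for \<open>\<mu> = ht\<close> and its centroid for \<open>\<mu> = sz\<close>.
\<close>

definition ctr :: "(rt \<Rightarrow> nat) \<Rightarrow> bool \<Rightarrow> rt multiset \<Rightarrow> bool" where
  "ctr \<mu> f M \<longleftrightarrow> (if f then \<forall>Z\<in>#M. \<mu> Z < \<mu> (Nd (M - {#Z#})) else \<exists>X Y. M = {#X, Y#} \<and> \<mu> X = \<mu> Y)"

lemma ctr_TrueD: "ctr \<mu> True (add_mset Z M) \<Longrightarrow> \<mu> Z < \<mu> (Nd M)"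
  by (auto simp: ctr_def)

lemma ctr_D: "ctr \<mu> f (add_mset Z M) \<Longrightarrow> f \<Longrightarrow> \<mu> Z < \<mu> (Nd M)"
  by (auto simp: ctr_def)

lemma ctr_False_iff: "ctr \<mu> False {#X, Y#} \<longleftrightarrow> \<mu> X = \<mu> Y"
proof
  assume "ctr \<mu> False {#X, Y#}"
  then obtain X' Y' where "{#X, Y#} = {#X', Y'#}" "\<mu> X' = \<mu> Y'" unfolding ctr_def if_False by blast
  then show "\<mu> X = \<mu> Y" unfolding pair_mset_eq by auto
next
  assume "\<mu> X = \<mu> Y"
  then show "ctr \<mu> False {#X, Y#}" unfolding ctr_def if_False by blast
qed

lemma not_ctr_TrueE:
  assumes "\<not> ctr \<mu> True M"
  obtains Z Q where "M = add_mset Z Q" "\<mu> (Nd Q) \<le> \<mu> Z"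
proof -
  obtain Z where Z: "Z \<in># M" "\<not> \<mu> Z < \<mu> (Nd (M - {#Z#}))" using assms by (auto simp: ctr_def)
  show ?thesis by (rule that[of Z "M - {#Z#}"]) (use Z in auto)
qed

text \<open>Forgets the marked vertex: only the limbs at the distinguished vertex or midpoint
  remain, and these do not depend on where \<open>R\<close> is rooted.\<close>

definition cen :: "bool \<Rightarrow> rt multiset \<Rightarrow> rt \<Rightarrow> bool" where
  "cen f M R \<longleftrightarrow> (\<exists>\<pi>. ctx f \<pi> \<and> R = up f \<pi> \<and> cf \<pi> = M)"

lemma cen_ueq: "cen f M R \<Longrightarrow> R \<approx> S \<Longrightarrow> cen f M S"
  unfolding cen_def using up_closed' by metis

lemma cen_True: "cen True M (Nd M)"
  unfolding cen_def by (rule exI[of _ "[M]"]) (simp add: ctx_def)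

lemma cen_False: "cen False {#X, Nd M#} (Nd (add_mset X M))"
  unfolding cen_def by (rule exI[of _ "[{#X#}, M]"]) (simp add: ctx_def)

lemma up_ueq_root:
  assumes "ctx f \<pi>"
  shows "\<exists>S. up f \<pi> \<approx> S \<and> (if f then S = Nd (cf \<pi>) else \<exists>X M. cf \<pi> = {#X, Nd M#} \<and> S = Nd (add_mset X M))"
  using assms
proof (induction "length \<pi>" arbitrary: \<pi> rule: less_induct)
  case less
  from less.prems show ?case
  proof (cases rule: ctx_cases)
    case (vertex Q)
    then show ?thesis by (auto simp: up_def)
  next
    case (edge X Q)
    then show ?thesis by (intro exI[of _ "Nd (add_mset X Q)"]) (auto simp: add_mset_commute)
  next
    case (snoc \<rho> Q)
    let ?p = "butlast \<rho> @ [add_mset (Nd Q) (last \<rho>)]"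
    note p = up_pull[OF snoc(1), of Q]
    have "rstep (up f \<pi>) (up f ?p)" using rstep.intros[of "up f \<rho>" Q] p(2) snoc by (simp add: up_snoc)
    moreover have "length ?p < length \<pi>" using snoc by (cases \<rho>) (auto simp: ctx_def)
    ultimately show ?thesis using less.hyps[OF _ p(1)] p(3) snoc(2)
      by (metis converse_rtranclp_into_rtranclp)
  qed
qed

text \<open>For a midpoint the two limbs carry no order; the two ways to read them differ by a
  single \<open>rstep\<close>.\<close>

lemma cen_imp_ueq:
  assumes "cen f M R" "cen f M S"
  shows "R \<approx> S"
proof -
  from assms obtain R' S' where 1: "R \<approx> R'" "S \<approx> S'"
    and 2: "if f then R' = Nd M \<and> S' = Nd M else (\<exists>X K. M = {#X, Nd K#} \<and> R' = Nd (add_mset X K)) \<and> (\<exists>X K. M = {#X, Nd K#} \<and> S' = Nd (add_mset X K))"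
    unfolding cen_def by (metis up_ueq_root)
  have "R' \<approx> S'"
  proof (cases f)
    case False
    with 2 obtain X K X' K' where e: "M = {#X, Nd K#}" "M = {#X', Nd K'#}" "R' = Nd (add_mset X K)" "S' = Nd (add_mset X' K')"
      by (smt (verit, best))
    have "X = X' \<and> K = K' \<or> X = Nd K' \<and> X' = Nd K"
      using e(1,2) pair_mset_eq[of X "Nd K" X' "Nd K'"] by auto
    then consider "X = X'" "K = K'" | "X = Nd K'" "X' = Nd K" by blast
    then show ?thesis
    proof cases
      case 2
      have "rstep (Nd (add_mset (Nd K') K)) (Nd (add_mset (Nd K) K'))" using rstep.intros[of "Nd K'" K] by simp
      then show ?thesis using e 2 by auto
    qed (use e in simp)
  qed (use 2 in simp)
  then show ?thesis using 1 by (meson ueq_sym ueq_trans)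
qed

text \<open>Existence and uniqueness of a balanced vertex or midpoint rest only on a limb measuring
  less than the tree that contains it.\<close>

locale limb_measure =
  fixes \<mu> :: "rt \<Rightarrow> nat"
  assumes mono: "Z \<in># M \<Longrightarrow> \<mu> Z < \<mu> (Nd M)"
begin

text \<open>Each step away from the balanced point enlarges the part behind and shrinks the part
  ahead, so the balance there turns into a strict inequality everywhere else.\<close>

lemma ctr_heavy:
  assumes "ctx f \<rho>" "ctr \<mu> f (cf (\<rho> @ [Q]))"
  shows "\<mu> (Nd Q) < \<mu> (up f \<rho>)"
  using assms
proof (induction "length \<rho>" arbitrary: \<rho> Q rule: less_induct)
  case less
  from less.prems(1) show ?case
  proof (cases rule: ctx_cases)
    case (vertex Q0)
    then show ?thesis using less.prems(2) ctr_TrueD by (simp add: up_def)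
  next
    case (edge X Q0)
    have "\<mu> X = \<mu> (Nd (add_mset (Nd Q) Q0))"
      using less.prems(2) edge by (simp add: ctr_False_iff)
    moreover have "\<mu> (Nd Q) < \<mu> (Nd (add_mset (Nd Q) Q0))" "\<mu> X < \<mu> (Nd (add_mset X Q0))"
      by (simp_all add: mono)
    ultimately show ?thesis using edge by (simp add: up_def)
  next
    case (snoc \<rho>' Q')
    have "cf (\<rho> @ [Q]) = cf (\<rho>' @ [add_mset (Nd Q) Q'])" using snoc cf_snoc[of \<rho> Q] by simp
    then have "\<mu> (Nd (add_mset (Nd Q) Q')) < \<mu> (up f \<rho>')" using less snoc by simp
    moreover have "\<mu> (Nd Q) < \<mu> (Nd (add_mset (Nd Q) Q'))" "\<mu> (up f \<rho>') < \<mu> (up f \<rho>)"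
      using snoc by (simp_all add: mono up_snoc)
    ultimately show ?thesis by simp
  qed
qed

text \<open>Two different heavy limbs would each lie in the complement of the other.\<close>

lemma heavy_uniq:
  assumes "add_mset X Q = add_mset Z P" "\<mu> (Nd Q) \<le> \<mu> X" "\<mu> (Nd P) \<le> \<mu> Z"
  shows "X = Z \<and> Q = P"
proof (rule ccontr)
  assume "\<not> ?thesis"
  then have "X \<noteq> Z" using assms(1) by auto
  then have "Z \<in># Q" "X \<in># P" using assms(1) insert_noteq_member by metis+
  then show False using mono[of Z Q] mono[of X P] assms by simp
qed

text \<open>Away from the balanced point exactly one limb is heavy, and it leads back there;
  following it recovers the whole path.\<close>

lemma up_inj:
  assumes "ctx f \<pi>" "ctr \<mu> f (cf \<pi>)" "ctx f' \<pi>'" "ctr \<mu> f' (cf \<pi>')" "up f \<pi> = up f' \<pi>'"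
  shows "f = f' \<and> \<pi> = \<pi>'"
  using assms
proof (induction "length \<pi>" arbitrary: \<pi> \<pi>' rule: less_induct)
  case less
  have light: "\<not> \<mu> (Nd P) \<le> \<mu> Z" if "ctr \<mu> True (add_mset Z P)" for Z P
    using ctr_TrueD[OF that] by simp
  from less.prems(1) show ?case
  proof (cases rule: ctx_cases)
    case (vertex Q)
    from less.prems(3) show ?thesis
    proof (cases rule: ctx_cases)
      case (vertex Q')
      then show ?thesis using less.prems \<open>f\<close> \<open>\<pi> = [Q]\<close> by (simp add: up_def)
    next
      case (edge X Q')
      then show ?thesis using less.prems vertex light[of X Q'] by (simp add: ctr_False_iff)
    next
      case (snoc \<rho> Q')
      then show ?thesis using less.prems vertex light[of "up f' \<rho>" Q'] ctr_heavy[of f' \<rho> Q'] by (simp add: up_snoc up_True_single)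
    qed
  next
    case (edge X Q)
    have e: "\<mu> X = \<mu> (Nd Q)" using edge less.prems by (simp add: ctr_False_iff)
    from less.prems(3) show ?thesis
    proof (cases rule: ctx_cases)
      case (vertex Q')
      then show ?thesis using less.prems edge light[of X Q] e by (simp add: up_def)
    next
      case (edge X' Q')
      then have "\<mu> X' = \<mu> (Nd Q')" using less.prems by (simp add: ctr_False_iff)
      then show ?thesis using less.prems edge \<open>\<not> f\<close> \<open>\<pi> = [{#X#}, Q]\<close> heavy_uniq[of X Q X' Q'] e by (simp add: up_def)
    next
      case (snoc \<rho> Q')
      then have "\<mu> (Nd Q') < \<mu> (up f' \<rho>)" using ctr_heavy less.prems by simp
      then show ?thesis using less.prems edge snoc heavy_uniq[of X Q "up f' \<rho>" Q'] e by (simp add: up_snoc up_False_double)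
    qed
  next
    case (snoc \<rho> Q)
    have h: "\<mu> (Nd Q) < \<mu> (up f \<rho>)" using ctr_heavy less.prems snoc by simp
    from less.prems(3) show ?thesis
    proof (cases rule: ctx_cases)
      case (vertex Q')
      then show ?thesis using less.prems snoc light[of "up f \<rho>" Q] h by (simp add: up_snoc up_True_single)
    next
      case (edge X' Q')
      then have "\<mu> X' = \<mu> (Nd Q')" using less.prems by (simp add: ctr_False_iff)
      then show ?thesis using less.prems edge snoc heavy_uniq[of "up f \<rho>" Q X' Q'] h by (simp add: up_snoc up_False_double)
    next
      case (snoc \<rho>' Q')
      note s = \<open>ctx f \<rho>\<close> \<open>\<pi> = \<rho> @ [Q]\<close>
      have h': "\<mu> (Nd Q') < \<mu> (up f' \<rho>')" using ctr_heavy less.prems snoc by simp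
      then have e: "up f \<rho> = up f' \<rho>'" "Q = Q'"
        using less.prems snoc s heavy_uniq[of "up f \<rho>" Q "up f' \<rho>'" Q'] h by (simp_all add: up_snoc)
      let ?p = "butlast \<rho> @ [add_mset (Nd Q) (last \<rho>)]" and ?p' = "butlast \<rho>' @ [add_mset (Nd Q') (last \<rho>')]"
      have "length ?p < length \<pi>" using s by (cases \<rho>) (auto simp: ctx_def)
      then have "f = f' \<and> ?p = ?p'"
        using less.hyps[of ?p ?p'] up_pull[OF s(1), of Q] up_pull[OF snoc(1), of Q'] e s snoc less.prems by metis
      then have "f = f'" "butlast \<rho> = butlast \<rho>'" "last \<rho> = last \<rho>'" using e by auto
      then show ?thesis using s snoc e by (metis ctx_def append_butlast_last_id)
    qed
  qed
qed

text \<open>The root walks into the heavy limb until balance is reached; the measure of the heavy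
  limb decreases on the way.\<close>

lemma up_ex_heavy:
  assumes "\<mu> (Nd Q) \<le> \<mu> Z"
  shows "\<exists>f \<pi>. ctx f \<pi> \<and> Nd (add_mset Z Q) = up f \<pi> \<and> ctr \<mu> f (cf \<pi>)"
  using assms
proof (induction "\<mu> Z" arbitrary: Z Q rule: less_induct)
  case less
  show ?case
  proof (cases "\<mu> (Nd Q) = \<mu> Z")
    case True
    then show ?thesis
      by (intro exI[of _ False] exI[of _ "[{#Z#}, Q]"]) (simp add: ctx_def ctr_False_iff)
  next
    case False
    let ?S = "Nd (add_mset (Nd Q) (ch Z))"
    have S: "rstep ?S (Nd (add_mset Z Q))" by (rule rstep_sym) (rule rstep.intros)
    have "\<exists>f \<pi>. ctx f \<pi> \<and> ?S = up f \<pi> \<and> ctr \<mu> f (cf \<pi>)"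
    proof (cases "ctr \<mu> True (ch ?S)")
      case True
      then show ?thesis by (intro exI[of _ True] exI[of _ "[ch ?S]"]) (auto simp: ctx_def up_def)
    next
      case nc: False
      then obtain W P where W: "ch ?S = add_mset W P" "\<mu> (Nd P) \<le> \<mu> W"
        by (rule not_ctr_TrueE)
      \<comment> \<open>The walk does not turn back: the part just left is strictly lighter than
        \<open>Z\<close>.\<close>
      have "W \<noteq> Nd Q" using W False less.prems by auto
      then have "W \<in># ch Z" using W insert_noteq_member by (metis rt.sel)
      then have "\<mu> W < \<mu> Z" using mono by (metis rt.collapse)
      then show ?thesis using less.hyps W by (metis rt.sel)
    qed
    then show ?thesis using S up_closed by metis
  qed
qed

lemma up_ex: "\<exists>f \<pi>. ctx f \<pi> \<and> R = up f \<pi> \<and> ctr \<mu> f (cf \<pi>)"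
proof (cases "ctr \<mu> True (ch R)")
  case True
  then show ?thesis by (intro exI[of _ True] exI[of _ "[ch R]"]) (auto simp: ctx_def up_def)
next
  case False
  then obtain Z Q where "ch R = add_mset Z Q" "\<mu> (Nd Q) \<le> \<mu> Z"
    by (rule not_ctr_TrueE)
  then show ?thesis using up_ex_heavy by (metis rt.collapse)
qed

lemma cen_ex: "\<exists>f M. cen f M R \<and> ctr \<mu> f M"
  using up_ex[of R] by (auto simp: cen_def)

lemma cen_uniq:
  assumes "cen f M R" "ctr \<mu> f M" "cen f' M' S" "ctr \<mu> f' M'" "R \<approx> S"
  shows "f = f' \<and> M = M'"
  using cen_ueq[OF assms(1,5)] assms(2-4) up_inj unfolding cen_def by metis

end

interpretation ht: limb_measure ht
  by unfold_locales (rule ht_mem)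

interpretation sz: limb_measure sz
  by unfold_locales (rule sz_mem)

section \<open>Adding a leaf\<close>

inductive ins :: "rt \<Rightarrow> rt \<Rightarrow> bool" where
  root: "ins (Nd M) (Nd (add_mset Lf M))"
| sub: "ins X X' \<Longrightarrow> ins (Nd (add_mset X M)) (Nd (add_mset X' M))"

lemma ins_sz: "ins R R' \<Longrightarrow> sz R' = Suc (sz R)"
  by (induction rule: ins.induct) auto

lemma ins_ht: "ins R R' \<Longrightarrow> ht R \<le> ht R' \<and> ht R' \<le> Suc (ht R)"
  by (induction rule: ins.induct) (auto simp: ht_add)

lemma ins_NdE:
  assumes "ins (Nd M) R'"
  obtains (root) "R' = Nd (add_mset Lf M)"
  | (sub) X X' N where "M = add_mset X N" "R' = Nd (add_mset X' N)" "ins X X'"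
  using assms by (auto elim: ins.cases)

lemma ins_add: "ins (Nd M) (Nd M') \<Longrightarrow> ins (Nd (add_mset Z M)) (Nd (add_mset Z M'))"
  by (erule ins_NdE) (auto simp: add_mset_commute[of Z] intro: ins.intros)

lemma ins_add_cases:
  assumes "ins (Nd (add_mset X Q)) R'"
  obtains (X) X' where "ins X X'" "R' = Nd (add_mset X' Q)"
  | (Q) Q' where "ins (Nd Q) (Nd Q')" "R' = Nd (add_mset X Q')"
  using assms
proof (cases rule: ins_NdE)
  case root
  then show ?thesis using Q[of "add_mset Lf Q"] by (auto simp: add_mset_commute intro: ins.intros)
next
  case (sub Y Y' N)
  show ?thesis
  proof (cases "X = Y")
    case True
    then show ?thesis using X sub by simp
  next
    case False
    then obtain K where "Q = add_mset Y K" "N = add_mset X K" using sub(1) by (metis add_eq_conv_ex)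
    then show ?thesis using Q[of "add_mset Y' K"] sub by (auto simp: add_mset_commute intro: ins.intros)
  qed
qed

text \<open>The condition on sizes prevents a midpoint from getting a third limb: a leaf that goes
  to the first entry has to enter the half stored there.\<close>

definition cins :: "bool \<Rightarrow> rt multiset list \<Rightarrow> rt multiset list \<Rightarrow> bool" where
  "cins f \<pi> \<pi>' \<longleftrightarrow> (\<exists>\<rho> Q Q' \<tau>. \<pi> = \<rho> @ Q # \<tau> \<and> \<pi>' = \<rho> @ Q' # \<tau> \<and> ins (Nd Q) (Nd Q') \<and>
     (f \<or> \<rho> \<noteq> [] \<or> size Q' = size Q))"

lemma cinsI: "ins (Nd Q) (Nd Q') \<Longrightarrow> f \<or> \<rho> \<noteq> [] \<or> size Q' = size Q \<Longrightarrow> cins f (\<rho> @ Q # \<tau>) (\<rho> @ Q' # \<tau>)"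
  unfolding cins_def by blast

lemma cins_snocI: "cins f \<rho> \<rho>' \<Longrightarrow> cins f (\<rho> @ [Q]) (\<rho>' @ [Q])"
  unfolding cins_def by (metis append_Cons append_assoc)

lemma cins_length: "cins f \<pi> \<pi>' \<Longrightarrow> length \<pi>' = length \<pi>"
  by (auto simp: cins_def)

lemma cins_ctx: "cins f \<pi> \<pi>' \<Longrightarrow> ctx f \<pi> \<Longrightarrow> ctx f \<pi>'"
  by (auto simp: cins_def ctx_def hd_append split: if_splits)

lemma ins_up:
  assumes "ctx f \<pi>" "ins (up f \<pi>) R'"
  shows "\<exists>\<pi>'. cins f \<pi> \<pi>' \<and> ctx f \<pi>' \<and> R' = up f \<pi>'"
  using assms
proof (induction "length \<pi>" arbitrary: \<pi> R' rule: less_induct)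
  case less
  have "\<exists>\<pi>'. cins f \<pi> \<pi>' \<and> R' = up f \<pi>'"
    using less.prems(1)
  proof (cases rule: ctx_cases)
    case (vertex Q)
    then show ?thesis using less.prems(2) cinsI[of Q _ f "[]" "[]"]
      by (metis (full_types) append_Nil rt.exhaust up_True_single)
  next
    case (edge X Q)
    have "ins (Nd (add_mset X Q)) R'" using less.prems(2) edge by simp
    then show ?thesis
    proof (cases rule: ins_add_cases)
      case (X X')
      have "ins (Nd {#X#}) (Nd {#X'#})" using X ins.sub[of X X' "{#}"] by simp
      then have "cins f \<pi> [{#X'#}, Q]" using edge cinsI[of "{#X#}" "{#X'#}" f "[]" "[Q]"] by simp
      then show ?thesis using edge X by (intro exI[of _ "[{#X'#}, Q]"]) simp
    next
      case (Q Q')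
      then have "cins f \<pi> [{#X#}, Q']" using edge cinsI[of Q Q' f "[{#X#}]" "[]"] by simp
      then show ?thesis using edge Q by (intro exI[of _ "[{#X#}, Q']"]) simp
    qed
  next
    case (snoc \<rho> Q)
    have "ins (Nd (add_mset (up f \<rho>) Q)) R'" using less.prems(2) snoc by (simp add: up_snoc)
    then show ?thesis
    proof (cases rule: ins_add_cases)
      case (X X')
      then obtain \<rho>' where "cins f \<rho> \<rho>'" "ctx f \<rho>'" "X' = up f \<rho>'" using less.hyps[of \<rho>] snoc by auto
      then show ?thesis using snoc X by (intro exI[of _ "\<rho>' @ [Q]"]) (simp add: cins_snocI up_snoc)
    next
      case (Q Q')
      then have "cins f \<pi> (\<rho> @ [Q'])" using snoc cinsI[of _ Q' f \<rho> "[]"] by (simp add: ctx_def)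
      then show ?thesis using snoc Q by (intro exI[of _ "\<rho> @ [Q']"]) (simp add: up_snoc)
    qed
  qed
  then show ?case using cins_ctx less.prems(1) by blast
qed

lemma cins_up:
  assumes "ctx f \<pi>" "cins f \<pi> \<pi>'"
  shows "ins (up f \<pi>) (up f \<pi>')"
  using assms
proof (induction "length \<pi>" arbitrary: \<pi> \<pi>' rule: less_induct)
  case less
  obtain \<rho> Q Q' \<tau> where p: "\<pi> = \<rho> @ Q # \<tau>" "\<pi>' = \<rho> @ Q' # \<tau>" "ins (Nd Q) (Nd Q')" "f \<or> \<rho> \<noteq> [] \<or> size Q' = size Q"
    using less.prems(2) unfolding cins_def by blast
  from less.prems(1) show ?case
  proof (cases rule: ctx_cases)
    case (vertex P)
    then show ?thesis using p by (auto simp: append_eq_Cons_conv)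
  next
    case (edge X P)
    then consider "\<rho> = []" "Q = {#X#}" "\<tau> = [P]" | "\<rho> = [{#X#}]" "Q = P" "\<tau> = []"
      using p by (auto simp: append_eq_Cons_conv Cons_eq_append_conv)
    then show ?thesis
    proof cases
      case 1
      then obtain X' where X': "Q' = {#X'#}" using p(4) edge(1) size_1_singleton_mset[of Q'] by auto
      have "ins X X'" using p(3) unfolding 1 X' by (auto elim!: ins_NdE simp: add_eq_conv_ex)
      then show ?thesis using p 1 X' edge by (simp add: ins.intros)
    next
      case 2
      then show ?thesis using p edge by (simp add: ins_add)
    qed
  next
    case (snoc \<rho>1 P)
    show ?thesis
    proof (cases \<tau> rule: rev_cases)
      case Nil
      then show ?thesis using p snoc by (simp add: up_snoc ins_add)
    next
      case (snoc \<tau>' P')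
      then have e: "\<rho>1 = \<rho> @ Q # \<tau>'" "P' = P" using p(1) \<open>\<pi> = \<rho>1 @ [P]\<close> by auto
      have c: "cins f \<rho>1 (\<rho> @ Q' # \<tau>')" unfolding e using p cinsI by blast
      then have "ins (up f \<rho>1) (up f (\<rho> @ Q' # \<tau>'))" using less.hyps \<open>ctx f \<rho>1\<close> \<open>\<pi> = \<rho>1 @ [P]\<close> by simp
      moreover have "up f \<pi>' = Nd (add_mset (up f (\<rho> @ Q' # \<tau>')) P)"
        using up_snoc[OF cins_ctx[OF c \<open>ctx f \<rho>1\<close>], of P] p snoc e by simp
      ultimately show ?thesis using \<open>ctx f \<rho>1\<close> \<open>\<pi> = \<rho>1 @ [P]\<close> by (simp add: up_snoc ins.intros)
    qed
  qed
qed

definition vins :: "bool \<Rightarrow> rt multiset \<Rightarrow> rt multiset \<Rightarrow> bool" where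
  "vins f M M' \<longleftrightarrow> ins (Nd M) (Nd M') \<and> (f \<or> size M' = size M)"

lemma cins_cf:
  assumes "ctx f \<pi>" "cins f \<pi> \<pi>'"
  shows "vins f (cf \<pi>) (cf \<pi>')"
proof -
  have i: "ins (Nd (cf (\<rho> @ Q # \<tau>))) (Nd (cf (\<rho> @ Q' # \<tau>))) \<and> (\<rho> \<noteq> [] \<longrightarrow> size (cf (\<rho> @ Q' # \<tau>)) = size (cf (\<rho> @ Q # \<tau>)))"
    if "ins (Nd Q) (Nd Q')" for \<rho> Q Q' \<tau>
    using that
  proof (induction \<rho>)
    case Nil
    then show ?case by (cases \<tau>) (auto intro: ins_add)
  next
    case (Cons P \<rho>)
    then show ?case by (auto simp: cf_Cons intro: ins.intros)
  qed
  obtain \<rho> Q Q' \<tau> where p: "\<pi> = \<rho> @ Q # \<tau>" "\<pi>' = \<rho> @ Q' # \<tau>" "ins (Nd Q) (Nd Q')" "f \<or> \<rho> \<noteq> [] \<or> size Q' = size Q"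
    using assms(2) unfolding cins_def by blast
  have "size (cf \<pi>') = size (cf \<pi>)" if "\<rho> = []" "size Q' = size Q"
    using p that by (cases \<tau>) auto
  then show ?thesis using i[OF p(3), of \<rho> \<tau>] p by (auto simp: vins_def)
qed

text \<open>Changes the point of view from the root to the distinguished vertex or midpoint, where
  the two trees can be compared limb by limb.\<close>

lemma cen_ins:
  assumes "cen f M R" "ins R R'"
  shows "\<exists>M'. vins f M M' \<and> cen f M' R'"
  using assms ins_up cins_cf unfolding cen_def by metis

section \<open>Inclusions by one leaf and the diameter\<close>

text \<open>Inclusion of isomorphism types, hence both roots may be chosen freely.\<close>

definition incl :: "rt \<Rightarrow> rt \<Rightarrow> bool" where
  "incl R S \<longleftrightarrow> (\<exists>R' S'. R' \<approx> R \<and> S' \<approx> S \<and> ins R' S')"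

lemma incl_ueq: "incl R S \<Longrightarrow> R \<approx> R' \<Longrightarrow> S \<approx> S' \<Longrightarrow> incl R' S'"
  unfolding incl_def by (meson ueq_trans)

lemma ins_incl: "ins R S \<Longrightarrow> incl R S"
  unfolding incl_def by blast

lemma leaf_ueq: "Nd (add_mset Lf (ch R)) \<approx> Nd {#R#}"
  using rstep.intros[of Lf "ch R"] by auto

lemma incl_Nd: "incl R (Nd {#R#})"
proof -
  have "ins R (Nd (add_mset Lf (ch R)))" by (metis ins.root rt.collapse)
  then show ?thesis using incl_ueq[OF ins_incl _ leaf_ueq] by blast
qed

lemma cen_incl:
  assumes "cen f M R" "incl R S"
  shows "\<exists>M'. vins f M M' \<and> cen f M' S"
  using assms unfolding incl_def by (meson cen_ins cen_ueq ueq_sym)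

abbreviation "hctr \<equiv> ctr ht"

text \<open>
  One more than the number of vertices of a longest path; the limbs at the midpoint of an edge are
  counted as if this midpoint were a vertex.
\<close>

definition dm :: "bool \<Rightarrow> rt multiset \<Rightarrow> nat" where
  "dm f M = 2 * ht (Nd M) - (if f then 0 else 1)"

text \<open>The choice is unambiguous by \<open>ht.cen_ex\<close> and
  \<open>ht.cen_uniq\<close>.\<close>

definition diam :: "rt \<Rightarrow> nat" where
  "diam R = (SOME n. \<exists>f M. cen f M R \<and> hctr f M \<and> n = dm f M)"

lemma diam_eq: "cen f M R \<Longrightarrow> hctr f M \<Longrightarrow> diam R = dm f M"
  unfolding diam_def by (rule some_equality) (use ht.cen_uniq in blast)+

lemma diam_ueq: "R \<approx> S \<Longrightarrow> diam R = diam S"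
  by (metis cen_ueq diam_eq ht.cen_ex)

text \<open>The parity of \<open>dm\<close> distinguishes central vertices from central
  edges.\<close>

lemma dm_eqD: "dm f M = dm f' M' \<Longrightarrow> f = f' \<and> ht (Nd M) = ht (Nd M')"
proof -
  obtain a b where "ht (Nd M) = Suc a" "ht (Nd M') = Suc b" using ht_pos(1) gr0_implies_Suc by metis
  then show "dm f M = dm f' M' \<Longrightarrow> ?thesis" unfolding dm_def by (simp split: if_splits; presburger)
qed

lemma ctr_vins_same:
  assumes "hctr f M" "vins f M M'" "ht (Nd M') = ht (Nd M)"
  shows "hctr f M'"
proof (cases f)
  case True
  have c: "ht Z < ht (Nd N)" if "M = add_mset Z N" for Z N
    using assms(1) that True ctr_D by simp
  have "ins (Nd M) (Nd M')" using assms(2) by (simp add: vins_def)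
  then show ?thesis
  proof (cases rule: ins_NdE)
    case root
    then have M': "M' = add_mset Lf M" by simp
    have ne: "M \<noteq> {#}" using assms(3) M' by (auto simp: ht_add)
    have 2: "1 < ht (Nd M)" using ht_ex[OF ne] by force
    have "ht Z < ht (Nd N)" if e: "add_mset Lf M = add_mset Z N" for Z N
    proof (cases "Z = Lf")
      case True
      then show ?thesis using 2 e by simp
    next
      case False
      then obtain K where "M = add_mset Z K" "N = add_mset Lf K" using e by (metis add_eq_conv_ex)
      then show ?thesis using c by (auto simp: ht_add less_max_iff_disj)
    qed
    then show ?thesis using True M' not_ctr_TrueE by (metis not_less)
  next
    case (sub X X' N)
    have M': "M' = add_mset X' N" using sub by simp
    have "ht Z < ht (Nd K)" if e: "add_mset X' N = add_mset Z K" for Z K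
    proof (cases "Z = X'")
      case True
      then show ?thesis using assms(3) c[OF sub(1)] e sub by (auto simp: ht_add max_def split: if_splits)
    next
      case False
      then obtain L where L: "N = add_mset Z L" "K = add_mset X' L" using e by (metis add_eq_conv_ex)
      then have "ht Z < ht (Nd (add_mset X L))" using c sub by (simp add: add_mset_commute)
      then show ?thesis using ins_ht[OF sub(3)] L by (auto simp: ht_add less_max_iff_disj)
    qed
    then show ?thesis using True M' not_ctr_TrueE by (metis not_less)
  qed
next
  case False
  then obtain X Y where M: "M = {#X, Y#}" "ht X = ht Y" using assms(1) unfolding ctr_def by auto
  have i: "ins (Nd M) (Nd M')" "size M' = 2" using assms(2) M False by (simp_all add: vins_def)
  from i(1) show ?thesis
  proof (cases rule: ins_NdE)
    case root
    then show ?thesis using i M by simp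
  next
    case (sub Z Z' N)
    obtain W where W: "N = {#W#}" "ht Z = ht W"
      using sub(1) M by (metis add_mset_eq_single add_eq_conv_ex pair_mset_eq size_add_mset size_1_singleton_mset add_right_cancel plus_1_eq_Suc)
    have "ht Z' = ht W" using assms(3) sub W ins_ht[OF sub(3)] by (auto simp: ht_add max_def split: if_splits)
    then show ?thesis using False sub W ctr_False_iff[of ht Z' W] by simp
  qed
qed

text \<open>A limb that outgrows the balance pulls the centre half an edge towards itself: here from
  a vertex to a midpoint, in \<open>recen_False\<close> from a midpoint to a vertex.\<close>

lemma recen_True:
  assumes "cen True (add_mset X N) S" "ht X = ht (Nd N)"
  shows "cen False {#X, Nd N#} S" "hctr False {#X, Nd N#}"
  using assms cen_imp_ueq[OF cen_True assms(1)] cen_ueq[OF cen_False] by (auto simp: ctr_False_iff)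

lemma recen_False:
  assumes "cen False {#X, Y#} S" "ht X = Suc (ht Y)"
  shows "cen True (add_mset Y (ch X)) S" "hctr True (add_mset Y (ch X))"
proof -
  have "cen False {#X, Y#} (Nd (add_mset Y (ch X)))" using cen_False[of Y "ch X"] by (simp add: add_mset_commute)
  then show "cen True (add_mset Y (ch X)) S" using cen_imp_ueq[OF _ assms(1)] cen_ueq[OF cen_True] by blast
  have "ht Z < ht (Nd N)" if e: "add_mset Y (ch X) = add_mset Z N" for Z N
  proof (cases "Z = Y")
    case True
    then have "N = ch X" using e by simp
    then have "ht (Nd N) = ht X" by simp
    then show ?thesis using True assms(2) by simp
  next
    case False
    then obtain K where "ch X = add_mset Z K" "N = add_mset Y K" using e by (metis add_eq_conv_ex)
    moreover then have "ht Z < ht X" using ht_mem_ch by simp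
    ultimately show ?thesis using assms(2) by (auto simp: ht_add less_max_iff_disj)
  qed
  then show "hctr True (add_mset Y (ch X))" using not_ctr_TrueE by (metis not_less)
qed

text \<open>A gain in height at the centre can only come from a limb that already had maximal
  height. The single vertex is set apart, since there the leaf forms a new limb.\<close>

lemma ctr_vins_deep:
  assumes "hctr f M" "vins f M M'" "ht (Nd M') \<noteq> ht (Nd M)" "M \<noteq> {#}"
  obtains X X' N where "M = add_mset X N" "M' = add_mset X' N" "ins X X'" "ht X < ht X'"
    "ht X' = ht (Nd M)" "if f then ht (Nd N) = ht (Nd M) else \<exists>Y. N = {#Y#} \<and> ht X = ht Y"
proof -
  have i: "ins (Nd M) (Nd M')" using assms(2) by (simp add: vins_def)
  then show ?thesis
  proof (cases rule: ins_NdE)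
    case root
    then have "ht (Nd M') = ht (Nd M)" using ht_ex[OF assms(4)] by (auto simp: ht_add max_def Suc_le_eq)
    then show ?thesis using assms(3) by simp
  next
    case (sub X X' N)
    have h: "ht (Nd M') = max (Suc (ht X')) (ht (Nd N))" "ht (Nd M) = max (Suc (ht X)) (ht (Nd N))"
      using sub by (simp_all add: ht_add)
    have "ht X' \<noteq> ht X" using h assms(3) by auto
    then have X': "ht X' = Suc (ht X)" using ins_ht[OF sub(3)] by simp
    show ?thesis
    proof (cases f)
      case True
      have "ht X < ht (Nd N)" using assms(1) sub ctr_D True by simp
      have 1: "ht (Nd N) = ht (Nd M)" using h(2) \<open>ht X < ht (Nd N)\<close> by simp
      have 2: "ht X' = ht (Nd M)" using h(1) assms(3) X' 1 \<open>ht X < ht (Nd N)\<close> by (simp add: max_def split: if_splits)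
      show ?thesis by (rule that[of X N X']) (use sub X' 1 2 True in simp_all)
    next
      case False
      then obtain A B where "M = {#A, B#}" "ht A = ht B" using assms(1) unfolding ctr_def by auto
      then obtain Y where Y: "N = {#Y#}" "ht X = ht Y"
        using sub(1) by (metis add_mset_eq_single add_eq_conv_ex pair_mset_eq size_add_mset size_1_singleton_mset add_right_cancel plus_1_eq_Suc)
      have "ht X' = ht (Nd M)" using Y X' h(2) by (simp add: ht_add)
      then show ?thesis by (intro that[of X N X']) (use sub X' Y False in simp_all)
    qed
  qed
qed

text \<open>Either the centre stays, or the height grows and the centre shifts by half an edge; the
  formula for \<open>dm\<close> then changes its case, and the diameter grows by exactly
  one.\<close>

lemma diam_vins:
  assumes "cen f M R" "hctr f M" "vins f M M'" "cen f M' S"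
  shows "ht (Nd M') = ht (Nd M) \<and> hctr f M' \<and> diam S = diam R
    \<or> ht (Nd M') = Suc (ht (Nd M)) \<and> diam S = Suc (diam R)"
proof (cases "ht (Nd M') = ht (Nd M)")
  case True
  then show ?thesis using assms ctr_vins_same diam_eq by (metis dm_def)
next
  case False
  have h: "ht (Nd M') = Suc (ht (Nd M))" using False assms(3) ins_ht vins_def by (metis le_SucE le_antisym)
  have "diam S = Suc (diam R)"
  proof (cases "M = {#}")
    case True
    have f using assms(2) True by (auto simp: ctr_def split: if_splits)
    moreover have "M' = {#Lf#}" using assms(3) True by (auto simp: vins_def elim: ins_NdE)
    ultimately show ?thesis using recen_True[of Lf "{#}" S] assms(1,2,4) True diam_eq
      by (auto simp: dm_def ht_add)
  next
    case ne: False
    obtain X X' N where X: "M = add_mset X N" "M' = add_mset X' N" "ins X X'" "ht X < ht X'"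
      "ht X' = ht (Nd M)" "if f then ht (Nd N) = ht (Nd M) else \<exists>Y. N = {#Y#} \<and> ht X = ht Y"
      by (rule ctr_vins_deep[OF assms(2,3) False ne])
    show ?thesis
    proof (cases f)
      case True
      have N: "ht (Nd N) = ht (Nd M)" using X(6) True by simp
      have "cen True (add_mset X' N) S" using assms(4) X(2) True by simp
      note r = recen_True[OF this]
      have "ht X' = ht (Nd N)" using X(5) N by (rule trans[OF _ sym])
      from diam_eq[OF r(1,2)[OF this]] have "diam S = 2 * ht (Nd {#X', Nd N#}) - 1" by (simp add: dm_def)
      moreover have "ht (Nd {#X', Nd N#}) = Suc (ht (Nd M))" unfolding ht_add X(5) N by simp
      ultimately show ?thesis using diam_eq[OF assms(1,2)] True by (simp add: dm_def)
    next
      case False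
      then obtain Y where Y: "N = {#Y#}" "ht X = ht Y" using X(6) by auto
      have X': "ht X' = Suc (ht Y)" using X(4) Y ins_ht[OF X(3)] by simp
      have "cen False {#X', Y#} S" using assms(4) X(2) Y False by simp
      note r = recen_False[OF this X']
      have "ht (Nd (add_mset Y (ch X'))) = ht X'" using X' by (simp add: ht_add)
      then have "diam S = 2 * ht X'" using diam_eq[OF r] by (simp add: dm_def)
      moreover have "0 < ht (Nd M)" by (rule ht_pos(1))
      ultimately show ?thesis using diam_eq[OF assms(1,2)] False X(5) by (simp add: dm_def)
    qed
  qed
  then show ?thesis using h by blast
qed

lemma diam_incl: "incl R S \<Longrightarrow> diam S = diam R \<or> diam S = Suc (diam R)"
  by (metis cen_incl diam_vins ht.cen_ex)

text \<open>The main use of diameters: if they agree, the centre has not moved, and an inclusion of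
  unrooted trees becomes one of the limbs at the centres.\<close>

lemma incl_cenD:
  assumes "cen f M R" "hctr f M" "incl R S" "diam S = diam R" "cen f' M' S" "hctr f' M'"
  shows "f' = f \<and> vins f M M'"
proof -
  obtain M1 where M1: "vins f M M1" "cen f M1 S" using cen_incl assms(1,3) by blast
  then have "hctr f M1" using diam_vins[OF assms(1,2) M1] assms(4) by auto
  then show ?thesis using ht.cen_uniq[OF M1(2) _ assms(5,6)] M1 by blast
qed

section \<open>Removal-similar leaves\<close>

text \<open>An appended entry \<open>{#}\<close> is a new leaf at the marked vertex, and the mark
  moves to this leaf.\<close>

lemma ins_cf_leaf: "\<rho> \<noteq> [] \<Longrightarrow> ins (Nd (cf \<rho>)) (Nd (cf (\<rho> @ [{#}])))"
proof (induction \<rho> rule: cf.induct)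
  case (3 Q P \<pi>)
  then show ?case by (simp add: ins.sub)
qed (auto intro: ins.root)

lemma vins_cf_leaf: "ctx f \<rho> \<Longrightarrow> vins f (cf \<rho>) (cf (\<rho> @ [{#}]))"
  using ins_cf_leaf[of \<rho>] by (cases \<rho> rule: cf.cases) (auto simp: vins_def ctx_def cf_Cons)

lemma cen_up: "ctx f \<pi> \<Longrightarrow> cen f (cf \<pi>) (up f \<pi>)"
  by (auto simp: cen_def)

lemma ctx_snoc: "ctx f \<pi> \<Longrightarrow> ctx f (\<pi> @ [Q])"
  by (auto simp: ctx_def)

lemma up_leaf: "ctx f \<rho> \<Longrightarrow> up f (\<rho> @ [{#}]) = Nd {#up f \<rho>#}"
  by (simp add: up_snoc)

text \<open>If the limbs with the new leaf were matched crosswise, cancelling the common limbs would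
  identify a limb with the same limb plus a leaf.\<close>

lemma spine_unique:
  assumes "\<rho> \<noteq> []" "\<rho>' \<noteq> []" "cf \<rho> = cf \<rho>'" "cf (\<rho> @ [{#}]) = cf (\<rho>' @ [{#}])"
  shows "\<rho> = \<rho>'"
  using assms
proof (induction "length \<rho>" arbitrary: \<rho> \<rho>' rule: less_induct)
  case less
  obtain Q \<tau> Q' \<tau>' where e: "\<rho> = Q # \<tau>" "\<rho>' = Q' # \<tau>'" using less.prems by (meson neq_Nil_conv)
  let ?c = "\<lambda>\<tau>. Nd (cf (\<tau> @ [{#}]))"
  have 1: "add_mset (?c \<tau>) Q = add_mset (?c \<tau>') Q'" using less.prems(4) e by (simp add: cf_Cons)
  show ?case
  proof (cases "\<tau> = []")
    case True
    then have "\<tau>' = []" using less.prems(3) 1 e by (cases "\<tau>' = []") (auto simp: cf_Cons dest: arg_cong[where f = size])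
    then show ?thesis using True e less.prems by simp
  next
    case False
    then have ne': "\<tau>' \<noteq> []" using less.prems(3) 1 e by (cases "\<tau>' = []") (auto simp: cf_Cons dest: arg_cong[where f = size])
    have 2: "add_mset (Nd (cf \<tau>)) Q = add_mset (Nd (cf \<tau>')) Q'" using less.prems(3) e False ne' by (simp add: cf_Cons)
    have "?c \<tau> = ?c \<tau>'"
    proof (rule ccontr)
      assume n: "?c \<tau> \<noteq> ?c \<tau>'"
      then obtain K where K: "Q = add_mset (?c \<tau>') K" "Q' = add_mset (?c \<tau>) K" by (rule add_mset_neqE[OF 1])
      have "{#Nd (cf \<tau>), ?c \<tau>'#} + K = {#Nd (cf \<tau>'), ?c \<tau>#} + K" using 2 K by simp
      then have "{#Nd (cf \<tau>), ?c \<tau>'#} = {#Nd (cf \<tau>'), ?c \<tau>#}" by (rule add_right_imp_eq)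
      then have "?c \<tau>' = Nd (cf \<tau>')" using n unfolding pair_mset_eq by auto
      then show False using ins_sz[OF ins_cf_leaf[OF ne']] by simp
    qed
    then show ?thesis using less.hyps[of \<tau> \<tau>'] 1 2 e False ne' by simp
  qed
qed

lemma cf_chain: "cf (\<rho> @ [{#}]) = {#Nd (cf \<rho>)#} \<Longrightarrow> \<rho> \<noteq> [] \<Longrightarrow> \<rho> = replicate (length \<rho>) {#}"
proof (induction \<rho>)
  case (Cons Q \<rho>)
  then show ?case by (cases "\<rho> = []") (auto simp: cf_Cons)
qed simp

lemma ht_replicate: "ht (Nd (cf (replicate (Suc k) {#}))) = Suc k"
  by (induction k) (auto simp: cf_Cons ht_add)

text \<open>Needed when an isomorphism exchanges two limbs at the centre. If these differ, each of
  them is a child of its own extension by a leaf, hence by size the only child, so both are paths;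
  equal heights make them equal.\<close>

lemma spine_swap_unique:
  assumes "add_mset (Nd (cf \<tau>)) (cf (\<tau>' @ [{#}])) = add_mset (Nd (cf \<tau>')) (cf (\<tau> @ [{#}]))"
    and "ht (Nd (cf \<tau>)) = ht (Nd (cf \<tau>'))" "\<tau> \<noteq> []" "\<tau>' \<noteq> []"
  shows "\<tau> = \<tau>'"
proof (cases "cf \<tau> = cf \<tau>'")
  case True
  then have "cf (\<tau> @ [{#}]) = cf (\<tau>' @ [{#}])" using assms(1) by simp
  then show ?thesis using spine_unique[OF assms(3,4) True] by blast
next
  case False
  have *: "\<tau> = replicate (length \<tau>) {#}" if m: "Nd (cf \<tau>) \<in># cf (\<tau> @ [{#}])" and ne: "\<tau> \<noteq> []" for \<tau>
  proof -
    obtain K where K: "cf (\<tau> @ [{#}]) = add_mset (Nd (cf \<tau>)) K" using multi_member_split[OF m] by blast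
    have "sz (Nd (cf (\<tau> @ [{#}]))) = Suc (sz (Nd (cf \<tau>)))" using ins_sz ins_cf_leaf ne by blast
    then have "\<Sum>\<^sub># (image_mset sz K) = 0" unfolding K by simp
    then have "K = {#}" by (cases K) auto
    then show ?thesis using K ne cf_chain by simp
  qed
  have "Nd (cf \<tau>') \<in># cf (\<tau>' @ [{#}])" "Nd (cf \<tau>) \<in># cf (\<tau> @ [{#}])"
    using False assms(1) by (metis insert_noteq_member rt.inject)+
  then have r: "\<tau> = replicate (length \<tau>) {#}" "\<tau>' = replicate (length \<tau>') {#}" using * assms by blast+
  obtain k k' where k: "length \<tau> = Suc k" "length \<tau>' = Suc k'" using assms(3,4) by (metis length_0_conv not0_implies_Suc)
  then have "ht (Nd (cf \<tau>)) = Suc k" "ht (Nd (cf \<tau>')) = Suc k'" using r ht_replicate by metis+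
  then show ?thesis using r k assms(2) by metis
qed

text \<open>
  Removal-similar leaves of a tree are similar: here \<open>X\<close> and \<open>Y\<close> are rooted at the neighbours of
  the two leaves.
\<close>

lemma remove_leaf_inj:
  assumes "Nd {#X#} \<approx> Nd {#Y#}" "X \<approx> Y"
  shows "X = Y"
proof -
  obtain f \<rho> where X: "ctx f \<rho>" "X = up f \<rho>" "hctr f (cf \<rho>)" using ht.up_ex by blast
  obtain \<rho>' where Y: "ctx f \<rho>'" "Y = up f \<rho>'" "cf \<rho>' = cf \<rho>" using up_closed' assms(2) X by metis
  let ?G = "cf (\<rho> @ [{#}])" and ?G' = "cf (\<rho>' @ [{#}])"
  have G: "cen f ?G (Nd {#X#})" "cen f ?G' (Nd {#Y#})"
    using X Y cen_up ctx_snoc up_leaf by metis+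
  have cX: "cen f (cf \<rho>) X" "cen f (cf \<rho>) Y" using X Y cen_up by metis+
  have v: "vins f (cf \<rho>) ?G" "vins f (cf \<rho>) ?G'" using vins_cf_leaf X Y by metis+
  have d: "diam (Nd {#X#}) = diam (Nd {#Y#})" "diam X = diam Y" using assms diam_ueq by blast+
  note dX = diam_vins[OF cX(1) X(3) v(1) G(1)] and dY = diam_vins[OF cX(2) X(3) v(2) G(2)]
  have ne: "\<rho> \<noteq> []" "\<rho>' \<noteq> []" using X Y by (auto simp: ctx_def)
  show ?thesis
  proof (cases "hctr f ?G \<and> hctr f ?G'")
    case True
    then have "?G = ?G'" using ht.cen_uniq[OF G(1) _ G(2) _ assms(1)] by simp
    then have "\<rho> = \<rho>'" using spine_unique[OF ne Y(3)[symmetric]] by blast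
    then show ?thesis using X(2) Y(2) by simp
  next
    case False
    \<comment> \<open>As the diameters agree, both new leaves lengthen a longest path, and both
      centres shift half an edge towards them.\<close>
    then have h: "ht (Nd ?G) = Suc (ht (Nd (cf \<rho>)))" "ht (Nd ?G') = Suc (ht (Nd (cf \<rho>)))"
      using dX dY d by auto
    show ?thesis
    proof (cases "cf \<rho> = {#}")
      case True
      then have "f" "cen True {#} Lf" using X(3) cen_True by (auto simp: ctr_def split: if_splits)
      then have "X \<approx> Lf" "Y \<approx> Lf" using cX True cen_imp_ueq by auto
      then show ?thesis using ueq_sz sz_eq_1 by (metis One_nat_def sz.simps image_mset_empty sum_mset.empty)
    next
      case ne0: False
      obtain Q \<tau> where r: "\<rho> = Q # \<tau>" using ne by (meson neq_Nil_conv)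
      obtain Q' \<tau>' where r': "\<rho>' = Q' # \<tau>'" using ne by (meson neq_Nil_conv)
      have tne: "\<tau> \<noteq> []" if "ht (Nd (cf ((Q # \<tau>) @ [{#}]))) = Suc (ht (Nd (cf \<rho>)))" "cf (Q # \<tau>) = cf \<rho>" for Q \<tau>
      proof
        assume t: "\<tau> = []"
        then have "cf \<rho> = Q" using that(2) by simp
        moreover have "ht (Nd (cf ((Q # \<tau>) @ [{#}]))) = max 2 (ht (Nd Q))" using t by (simp add: ht_add)
        moreover have "2 \<le> ht (Nd (cf \<rho>))" using ht_ex[OF ne0] by force
        ultimately show False using that(1) by simp
      qed
      have t: "\<tau> \<noteq> []" "\<tau>' \<noteq> []" using tne[of Q \<tau>] tne[of Q' \<tau>'] h Y(3) unfolding r r' by blast+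
      let ?D = "Nd (cf \<tau>)" and ?D' = "Nd (cf \<tau>')" and ?F = "Nd (cf (\<tau> @ [{#}]))" and ?F' = "Nd (cf (\<tau>' @ [{#}]))"
      have D: "cf \<rho> = add_mset ?D Q" "cf \<rho> = add_mset ?D' Q'" "?G = add_mset ?F Q" "?G' = add_mset ?F' Q'"
        using cf_Cons[OF t(1), of Q] cf_Cons[OF t(2), of Q'] Y(3) cf_Cons[of "\<tau> @ [{#}]" Q] cf_Cons[of "\<tau>' @ [{#}]" Q']
        unfolding r r' by simp_all
      have F: "ht ?F \<le> Suc (ht ?D)" "ht ?F' \<le> Suc (ht ?D')" using ins_ht[OF ins_cf_leaf] t by blast+
      have fin: "\<rho> = \<rho>'" if "Q = Q'" "?F = ?F'"
      proof -
        have "?D = ?D'" using D(1,2) that(1) by simp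
        then have "\<tau> = \<tau>'" using spine_unique[OF t] that(2) by blast
        then show ?thesis using that(1) r r' by simp
      qed
      have "\<rho> = \<rho>'"
      proof (cases f)
        case True
        have key: "ht (Nd Q) = ht F \<and> ht F = Suc (ht D)"
          if "cf \<rho> = add_mset D Q" "ht (Nd (add_mset F Q)) = Suc (ht (Nd (cf \<rho>)))" "ht F \<le> Suc (ht D)" for D F Q
        proof -
          have 1: "ht D < ht (Nd Q)" using X(3) that(1) True ctr_D by simp
          then have 2: "ht (Nd (cf \<rho>)) = ht (Nd Q)" using that(1) by (simp add: ht_add)
          show ?thesis using that(2,3) 1 unfolding 2 ht_add by linarith
        qed
        have k: "ht (Nd Q) = ht ?F \<and> ht ?F = Suc (ht ?D)" "ht (Nd Q') = ht ?F' \<and> ht ?F' = Suc (ht ?D')"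
          using key[OF D(1) _ F(1)] key[OF D(2) _ F(2)] h D(3,4) by metis+
        have "cen True (add_mset ?F Q) (Nd {#X#})" "cen True (add_mset ?F' Q') (Nd {#Y#})" using G D True by simp_all
        note c = recen_True[OF this(1) conjunct1[OF k(1), symmetric]] recen_True[OF this(2) conjunct1[OF k(2), symmetric]]
        have "{#?F, Nd Q#} = {#?F', Nd Q'#}" using ht.cen_uniq[OF c assms(1)] by simp
        then consider "?F = ?F'" "Q = Q'" | "?F = Nd Q'" "?F' = Nd Q" unfolding pair_mset_eq by auto
        then show ?thesis
        proof cases
          case 1
          then show ?thesis using fin by simp
        next
          case 2
          \<comment> \<open>The isomorphism reflects the tree at its central edge.\<close>
          then have "ht ?D = ht ?D'" using k by (metis Suc_inject)
          moreover have "add_mset ?D (cf (\<tau>' @ [{#}])) = add_mset ?D' (cf (\<tau> @ [{#}]))" using D(1,2) 2 by (metis rt.inject)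
          ultimately have "\<tau> = \<tau>'" using spine_swap_unique[OF _ _ t] by blast
          then show ?thesis using 2 r r' by (metis rt.inject)
        qed
      next
        case False
        obtain A where A: "Q = {#A#}" using X(1) r False size_1_singleton_mset by (fastforce simp: ctx_def)
        obtain A' where A': "Q' = {#A'#}" using Y(1) r' False size_1_singleton_mset by (fastforce simp: ctx_def)
        have e: "ht ?D = ht A" "ht ?D' = ht A'" using X(3) D(1,2) A A' False ctr_False_iff by metis+
        have "ht ?F = Suc (ht A)" "ht ?F' = Suc (ht A')"
        proof -
          have "ht (Nd (cf \<rho>)) = Suc (ht A)" unfolding D(1) A ht_add e(1) by simp
          moreover have "ht (Nd (cf \<rho>)) = Suc (ht A')" unfolding D(2) A' ht_add e(2) by simp
          ultimately show "ht ?F = Suc (ht A)" "ht ?F' = Suc (ht A')" using h F e unfolding D(3,4) A A' ht_add ht_empty by linarith+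
        qed
        note k = this
        have "cen False {#?F, A#} (Nd {#X#})" "cen False {#?F', A'#} (Nd {#Y#})" using G D A A' False by simp_all
        note c = recen_False[OF this(1) k(1)] recen_False[OF this(2) k(2)]
        have eq: "add_mset A (cf (\<tau> @ [{#}])) = add_mset A' (cf (\<tau>' @ [{#}]))" using ht.cen_uniq[OF c assms(1)] by simp
        have "{#?D, A#} = {#?D', A'#}" using D(1,2) A A' by simp
        then consider "A = A'" | "A = ?D'" "A' = ?D" unfolding pair_mset_eq by auto
        then show ?thesis
        proof cases
          case 1
          then have "cf (\<tau> @ [{#}]) = cf (\<tau>' @ [{#}])" using eq by simp
          then show ?thesis using fin 1 A A' by blast
        next
          case 2
          have "ht ?D = ht ?D'" using e 2 by argo
          moreover have "add_mset ?D (cf (\<tau>' @ [{#}])) = add_mset ?D' (cf (\<tau> @ [{#}]))" using eq 2 by argo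
          ultimately have "\<tau> = \<tau>'" using spine_swap_unique[OF _ _ t] by blast
          then show ?thesis using 2 r r' A A' by argo
        qed
      qed
      then show ?thesis using X(2) Y(2) by simp
    qed
  qed
qed

section \<open>Limbs between two inclusions\<close>

text \<open>
  The part of a multiset of limbs that changes when a leaf is added.
\<close>

inductive ad :: "rt multiset \<Rightarrow> rt multiset \<Rightarrow> bool" where
  leaf: "ad {#} {#Lf#}"
| sub: "ins X X' \<Longrightarrow> ad {#X#} {#X'#}"

lemma ins_ad: "ins (Nd M) (Nd M') \<longleftrightarrow> (\<exists>Q E E'. M = Q + E \<and> M' = Q + E' \<and> ad E E')"
proof
  assume "ins (Nd M) (Nd M')"
  then show "\<exists>Q E E'. M = Q + E \<and> M' = Q + E' \<and> ad E E'"
  proof (cases rule: ins_NdE)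
    case root
    then show ?thesis using ad.leaf by (metis add_mset_add_single empty_neutral(2) rt.inject)
  next
    case (sub X X' N)
    then show ?thesis using ad.sub by (metis add_mset_add_single rt.inject)
  qed
qed (auto elim!: ad.cases intro: ins.intros)

text \<open>A leaf added to a limb of size n raises this sum by 2n + 1, so it records the size of
  the limb that received the leaf.\<close>

definition sq :: "rt multiset \<Rightarrow> nat" where
  "sq M = (\<Sum>Z\<in>#M. (sz Z)\<^sup>2)"

definition tsz :: "rt multiset \<Rightarrow> nat" where
  "tsz M = \<Sum>\<^sub># (image_mset sz M)"

lemma sq_plus: "sq (M + N) = sq M + sq N"
  by (simp add: sq_def)

lemma ad_tsz: "ad E E' \<Longrightarrow> tsz E' = Suc (tsz E) \<and> sq E = (tsz E)\<^sup>2 \<and> sq E' = (tsz E')\<^sup>2"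
  by (auto elim!: ad.cases simp: tsz_def sq_def ins_sz)

lemma ad_single: "ad E E' \<Longrightarrow> \<exists>X. E' = {#X#}"
  by (auto elim: ad.cases)

lemma ad_empty: "ad {#} E' \<Longrightarrow> E' = {#Lf#}"
  by (auto elim: ad.cases)

lemma ad_small: "ad E E' \<Longrightarrow> X \<in># E \<Longrightarrow> E = {#X#}"
  by (auto elim!: ad.cases)

text \<open>Let n be the size of \<open>E0\<close>. If the first leaf enters another limb, the
  outcome is only possible if that limb grows from n + 1 to n + 2 and becomes \<open>E2\<close>,
  while \<open>E0\<close> grows into a replacement for it. The constant is n^2 + (n+2)^2 - 2(n+1)^2
  = 2.\<close>

lemma sandwich_step:
  assumes "ad E0 E1" "ad E1 E2" "ins (Nd (P + E0)) (Nd H)" "ins (Nd H) (Nd (P + E2))"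
  shows "(\<exists>L. H = P + L \<and> ad E0 L \<and> ad L E2) \<or> sq H = sq (P + E1) + 2"
proof -
  obtain Q1 F F' where 1: "P + E0 = Q1 + F" "H = Q1 + F'" "ad F F'" using assms(3) ins_ad by blast
  obtain Q2 K K' where 2: "H = Q2 + K" "P + E2 = Q2 + K'" "ad K K'" using assms(4) ins_ad by blast
  have HF: "H + F = P + E0 + F'" using 1 by (simp add: ac_simps)
  have "P + (E0 + F' + K') = H + F + K'" using HF by (simp add: ac_simps)
  also have "\<dots> = P + (E2 + K + F)" using 2 by (metis add.assoc add.commute)
  finally have eq: "E0 + F' + K' = E2 + K + F" by simp
  obtain c f' k' where s: "E2 = {#c#}" "F' = {#f'#}" "K' = {#k'#}" using ad_single assms(2) 1(3) 2(3) by meson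
  have t: "tsz E2 = tsz E0 + 2" "tsz E1 = tsz E0 + 1" "tsz F' = tsz F + 1" "tsz K' = tsz K + 1"
    using ad_tsz assms(1,2) 1(3) 2(3) by force+
  have n: "c \<notin># E0" "f' \<notin># F" "k' \<notin># K"
    using ad_small[OF assms(1)] ad_small[OF 1(3)] ad_small[OF 2(3)] t s by force+
  have "c \<in># E2 + K + F" using s by simp
  then have "c \<in># E0 + F' + K'" unfolding eq .
  then consider "c = k'" | "c = f'" using n s by auto
  then show ?thesis
  proof cases
    case 1
    then have K': "K' = E2" using s by simp
    have e: "E0 + F' = K + F" using eq unfolding K' by (simp add: ac_simps)
    have "f' \<in># E0 + F'" using s by simp
    then have "f' \<in># K" using n(2) unfolding e by simp
    then have KF: "K = F'" using ad_small[OF 2(3)] s by simp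
    have EF: "E0 = F" using e unfolding KF by (simp add: add.commute)
    have "H = P + F'" using HF unfolding EF by (simp add: ac_simps)
    then show ?thesis using \<open>ad F F'\<close> \<open>ad K K'\<close> unfolding K' KF EF by blast
  next
    case c: 2
    then have F': "F' = E2" using s by simp
    have e: "E0 + K' = K + F" using eq unfolding F' by (simp add: ac_simps)
    have "k' \<in># E0 + K'" using s by simp
    then have "k' \<in># F" using n(3) unfolding e by simp
    then have FK: "F = K'" using ad_small[OF 1(3)] s by simp
    have "sq H + sq F = sq P + sq E0 + sq E2" using arg_cong[OF HF, of sq] unfolding F' by (simp add: sq_plus)
    moreover have "sq F = (tsz E0 + 1)\<^sup>2" "sq E0 = (tsz E0)\<^sup>2" "sq E2 = (tsz E0 + 2)\<^sup>2" "sq E1 = (tsz E0 + 1)\<^sup>2"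
      using ad_tsz[OF assms(1)] ad_tsz[OF assms(2)] ad_tsz[OF 1(3)] t unfolding F' by auto
    ultimately have "sq H = sq (P + E1) + 2" by (simp add: sq_plus power2_eq_square algebra_simps)
    then show ?thesis by blast
  qed
qed

text \<open>
  If a leaf entered a limb off the spine, the sums of the squared sizes of the limbs of the two trees
  would differ by 2, with opposite signs for the two pairs of inclusions. So the leaves enter the limbs
  that contain the spines, and one recurses into these.
\<close>

lemma two_leaf_sandwich:
  assumes "\<rho> \<noteq> []" "\<rho>' \<noteq> []"
    and "ins (Nd (cf \<rho>)) (Nd (cf (\<rho>' @ [{#}])))" "ins (Nd (cf (\<rho>' @ [{#}]))) (Nd (cf (\<rho> @ [{#}, {#}])))"
    and "ins (Nd (cf \<rho>')) (Nd (cf (\<rho> @ [{#}])))" "ins (Nd (cf (\<rho> @ [{#}]))) (Nd (cf (\<rho>' @ [{#}, {#}])))"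
  shows "cf (\<rho> @ [{#}]) = cf (\<rho>' @ [{#}])"
  using assms
proof (induction "length \<rho>" arbitrary: \<rho> \<rho>' rule: less_induct)
  case less
  obtain Q \<tau> where r: "\<rho> = Q # \<tau>" using less.prems by (meson neq_Nil_conv)
  obtain Q' \<tau>' where r': "\<rho>' = Q' # \<tau>'" using less.prems by (meson neq_Nil_conv)
  define E0 where "E0 \<tau> = (if \<tau> = [] then {#} else {#Nd (cf \<tau>)#})" for \<tau>
  define E1 where "E1 \<tau> = {#Nd (cf (\<tau> @ [{#}]))#}" for \<tau>
  define E2 where "E2 \<tau> = {#Nd (cf (\<tau> @ [{#}, {#}]))#}" for \<tau>
  have c: "cf (Q # \<tau>) = Q + E0 \<tau>" "cf ((Q # \<tau>) @ [{#}]) = Q + E1 \<tau>" "cf ((Q # \<tau>) @ [{#}, {#}]) = Q + E2 \<tau>" for Q \<tau>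
    by (auto simp: E0_def E1_def E2_def cf_Cons)
  have a: "ad (E0 \<tau>) (E1 \<tau>)" "ad (E1 \<tau>) (E2 \<tau>)" for \<tau>
    using ins_cf_leaf[of \<tau>] ins_cf_leaf[of "\<tau> @ [{#}]"] by (auto simp: E0_def E1_def E2_def intro: ad.intros)
  let ?G = "Q + E1 \<tau>" and ?H = "Q' + E1 \<tau>'"
  note p = less.prems(3-6)[unfolded r r' c]
  from sandwich_step[OF a p(1,2)] sandwich_step[OF a p(3,4)]
  consider "sq ?H = sq ?G + 2" "sq ?G = sq ?H + 2"
    | L where "?H = Q + L" "ad (E0 \<tau>) L" "sq ?G = sq ?H + 2"
    | L where "?G = Q' + L" "ad (E0 \<tau>') L" "sq ?H = sq ?G + 2"
    | L L' where "?H = Q + L" "ad (E0 \<tau>) L" "ad L (E2 \<tau>)" "?G = Q' + L'" "ad (E0 \<tau>') L'" "ad L' (E2 \<tau>')"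
    by blast
  then show ?case
  proof cases
    case (2 L)
    then have "sq L = sq (E1 \<tau>)" using ad_tsz a(1) by metis
    then show ?thesis using 2 by (simp add: sq_plus)
  next
    case (3 L)
    then have "sq L = sq (E1 \<tau>')" using ad_tsz a(1) by metis
    then show ?thesis using 3 by (simp add: sq_plus)
  next
    case (4 L L')
    show ?thesis
    proof (rule ccontr)
      assume "\<not> ?thesis"
      then have ne: "?G \<noteq> ?H" unfolding r r' c by simp
      obtain y z where s: "L = {#y#}" "L' = {#z#}" using 4 ad_single by meson
      obtain x where x: "E1 \<tau> = {#x#}" by (simp add: E1_def)
      obtain w where w: "E1 \<tau>' = {#w#}" by (simp add: E1_def)
      have xy: "x \<noteq> y" using ne 4(1) s x by auto
      have e: "add_mset x Q = add_mset z Q'" "add_mset w Q' = add_mset y Q" using 4(1,4) s x w by simp_all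
      have xz: "x = z"
      proof (rule ccontr)
        assume n: "x \<noteq> z"
        then obtain K where "Q = add_mset z K" "Q' = add_mset x K" by (rule add_mset_neqE[OF e(1)])
        then have "{#w, x#} + K = {#y, z#} + K" using e(2) by simp
        then have "{#w, x#} = {#y, z#}" by (rule add_right_imp_eq)
        then show False using n xy unfolding pair_mset_eq by auto
      qed
      then have wy: "w = y" using e by simp
      have q: "ad (E0 \<tau>) (E1 \<tau>')" "ad (E1 \<tau>') (E2 \<tau>)" "ad (E0 \<tau>') (E1 \<tau>)" "ad (E1 \<tau>) (E2 \<tau>')" using 4 s x w xz wy by simp_all
      have "E0 \<tau> \<noteq> {#}"
      proof
        assume "E0 \<tau> = {#}"
        then have "E1 \<tau> = E1 \<tau>'" using ad_empty q(1) a(1)[of \<tau>] by metis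
        then show False using x w xy wy by simp
      qed
      moreover have "E0 \<tau>' \<noteq> {#}"
      proof
        assume "E0 \<tau>' = {#}"
        then have "E1 \<tau> = E1 \<tau>'" using ad_empty q(3) a(1)[of \<tau>'] by metis
        then show False using x w xy wy by simp
      qed
      ultimately have t: "\<tau> \<noteq> []" "\<tau>' \<noteq> []" by (auto simp: E0_def)
      have "cf (\<tau> @ [{#}]) = cf (\<tau>' @ [{#}])"
        using q t by (intro less.hyps) (auto simp: E0_def E1_def E2_def r elim!: ad.cases)
      then show False using x w xy wy by (simp add: E1_def)
    qed
  qed simp
qed

section \<open>Deepest leaves\<close>

lemma length_le_ht: "\<pi> \<noteq> [] \<Longrightarrow> length \<pi> \<le> ht (Nd (cf \<pi>))"
  by (induction \<pi> rule: cf.induct) (auto simp: ht_add)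

lemma ht_cf_leaf: "\<rho> \<noteq> [] \<Longrightarrow> ht (Nd (cf (\<rho> @ [{#}]))) = max (ht (Nd (cf \<rho>))) (Suc (length \<rho>))"
  by (induction \<rho> rule: cf.induct) (auto simp: ht_add)

text \<open>As \<open>X\<close> has an edge, the centre of \<open>Nd {#X#}\<close> is neither the
  leaf at its root nor the midpoint of the edge there, so it can be described as seen from
  \<open>X\<close>.\<close>

lemma leaf_ctx:
  assumes "X \<noteq> Lf"
  shows "\<exists>f \<rho>. ctx f \<rho> \<and> X = up f \<rho> \<and> hctr f (cf (\<rho> @ [{#}]))"
proof -
  obtain f \<pi> where p: "ctx f \<pi>" "Nd {#X#} = up f \<pi>" "hctr f (cf \<pi>)" using ht.up_ex by blast
  from p(1) show ?thesis
  proof (cases rule: ctx_cases)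
    case (vertex Q)
    then have "hctr True (add_mset X {#})" using p by simp
    then have "ht X < 1" using ctr_TrueD[of ht X "{#}"] by simp
    then show ?thesis by simp
  next
    case (edge Z Q)
    then have "Z = X" "Q = {#}" using p(2) by simp_all
    then have "ht X = ht Lf" using p(3) edge ctr_False_iff by simp
    then have "X = Lf" by (metis One_nat_def ht_empty ht_mem less_one multiset_nonemptyE rt.exhaust ht_pos(2))
    then show ?thesis using assms by simp
  next
    case (snoc \<rho> Q)
    then have "Q = {#}" "X = up f \<rho>" using p(2) by (simp_all add: up_snoc)
    then show ?thesis using snoc p(3) by blast
  qed
qed

text \<open>The leaf is vertex number \<open>length \<rho> + 1\<close> on its path, so by the bound
  it is not among the deepest ones, and no limb of maximal height owes its height to it.\<close>

lemma ctr_del_neutral: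
  assumes "ctx f \<rho>" "hctr f (cf (\<rho> @ [{#}]))" "length \<rho> + 2 \<le> ht (Nd (cf (\<rho> @ [{#}])))"
  shows "hctr f (cf \<rho>)"
proof -
  obtain Q \<tau> where r: "\<rho> = Q # \<tau>" using assms(1) by (auto simp: ctx_def neq_Nil_conv)
  let ?D = "Nd (cf \<tau>)" and ?F = "Nd (cf (\<tau> @ [{#}]))"
  have g: "cf (\<rho> @ [{#}]) = add_mset ?F Q" using r by (simp add: cf_Cons)
  have big: "length \<tau> + 3 \<le> max (Suc (ht ?F)) (ht (Nd Q))" using assms(3) r unfolding g ht_add by simp
  show ?thesis
  proof (cases f)
    case True
    have c: "ht Z < ht (Nd N)" if "add_mset ?F Q = add_mset Z N" for Z N
      using assms(2) True that ctr_TrueD unfolding g by metis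
    have "ht Z < ht (Nd N)" if e: "cf \<rho> = add_mset Z N" for Z N
    proof (cases "\<tau> = []")
      case t: True
      have "Q = add_mset Z N" using e r t by simp
      then have "ht Z < ht (Nd (add_mset Lf N))" using c[of Z "add_mset Lf N"] t by (simp add: add_mset_commute)
      moreover have "3 \<le> max 2 (max (Suc (ht Z)) (ht (Nd N)))" using big t \<open>Q = add_mset Z N\<close> by (simp add: ht_add)
      ultimately show ?thesis unfolding ht_add ht_empty by linarith
    next
      case t: False
      have u: "add_mset ?D Q = add_mset Z N" using e r t by (simp add: cf_Cons)
      have F: "ht ?F = max (ht ?D) (Suc (length \<tau>))" using ht_cf_leaf[OF t] .
      show ?thesis
      proof (cases "?D = Z")
        case True
        then have "N = Q" using u by simp
        have "ht ?F < ht (Nd Q)" using c by blast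
        then have "ht ?D < ht (Nd Q)" using F by linarith
        then show ?thesis using True \<open>N = Q\<close> by simp
      next
        case False
        obtain K where K: "Q = add_mset Z K" "N = add_mset ?D K" by (rule add_mset_neqE[OF u False])
        have "ht Z < ht (Nd (add_mset ?F K))" using c[of Z "add_mset ?F K"] K by (simp add: add_mset_commute)
        moreover have "length \<tau> + 3 \<le> max (Suc (ht ?F)) (max (Suc (ht Z)) (ht (Nd K)))" using big unfolding K ht_add .
        ultimately show ?thesis using F unfolding K ht_add by linarith
      qed
    qed
    then show ?thesis using True not_ctr_TrueE by (metis not_less)
  next
    case False
    then have t: "\<tau> \<noteq> []" using assms(1) r by (auto simp: ctx_def)
    obtain Y where Y: "Q = {#Y#}" using assms(1) r False size_1_singleton_mset by (fastforce simp: ctx_def)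
    have "ht ?F = ht Y" using assms(2) False unfolding g Y by (simp add: ctr_False_iff)
    moreover have "ht ?F = max (ht ?D) (Suc (length \<tau>))" using ht_cf_leaf[OF t] .
    ultimately have "ht ?D = ht Y" using big unfolding Y ht_add ht_empty by linarith
    then show ?thesis using False t unfolding r Y by (simp add: cf_Cons ctr_False_iff)
  qed
qed

lemma deepen_cases:
  assumes "ins X Y" "ht X < ht Y"
  obtains (root) "X = Lf" "Y = Nd {#Lf#}"
  | (sub) V V' N where "X = Nd (add_mset V N)" "Y = Nd (add_mset V' N)" "ins V V'" "ht V < ht V'"
      "ht (Nd N) < ht Y" "ht Y = Suc (ht V')"
  using assms(1)
proof cases
  case (root M)
  have "M = {#}"
  proof (rule ccontr)
    assume "M \<noteq> {#}"
    then obtain Z where "ht (Nd M) = Suc (ht Z)" using ht_ex by blast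
    then show False using assms(2) ht_ge1[of Z] unfolding root ht_add ht_empty by linarith
  qed
  then show ?thesis using root that(1) by simp
next
  case (sub V V' N)
  have "max (Suc (ht V)) (ht (Nd N)) < max (Suc (ht V')) (ht (Nd N))" using assms(2) unfolding sub ht_add .
  then have 1: "ht V < ht V'" "ht (Nd N) < Suc (ht V')" by linarith+
  then have "ht Y = Suc (ht V')" unfolding sub ht_add by linarith
  then show ?thesis using that(2)[OF sub(1,2,3) 1(1)] 1(2) by simp
qed

lemma ins_not_Lf: "\<not> ins X Lf"
  by (auto elim: ins.cases)

text \<open>A removal that lowers the height takes away the only deepest leaf.\<close>

lemma deepen_unique:
  assumes "ins X Y" "ins X' Y" "ht X < ht Y" "ht X' < ht Y"
  shows "X = X'"
  using assms
proof (induction "sz Y" arbitrary: X X' Y rule: less_induct)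
  case less
  from less.prems(1,3) show ?case
  proof (cases rule: deepen_cases)
    case root
    from less.prems(2,4) show ?thesis
    proof (cases rule: deepen_cases)
      case (sub V V' N)
      then show ?thesis using \<open>Y = Nd {#Lf#}\<close> ins_not_Lf by simp
    qed (use root in simp)
  next
    case (sub V V' N)
    note s = sub
    from less.prems(2,4) show ?thesis
    proof (cases rule: deepen_cases)
      case root
      then show ?thesis using s ins_not_Lf by simp
    next
      case (sub W W' N')
      have e: "add_mset V' N = add_mset W' N'" using s(2) sub(2) by simp
      have "V' = W'"
      proof (rule ccontr)
        assume "V' \<noteq> W'"
        then have "W' \<in># N" "V' \<in># N'" using e insert_noteq_member by metis+
        then show False using ht_mem[of W' N] s sub by linarith
      qed
      moreover have "sz V' < sz Y" using s(2) sz_mem by simp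
      ultimately have "V = W" using less.hyps s sub by blast
      then show ?thesis using e \<open>V' = W'\<close> s(1) sub(1) by simp
    qed
  qed
qed

section \<open>Branching vertices\<close>

text \<open>
  The number of branching vertices, where the root branches if it has two children, and the sum of
  their depths. A tree with \<open>nb R = 0\<close> is a path rooted at one of its ends.
\<close>

primrec nb :: "rt \<Rightarrow> nat" where
  "nb (Nd M) = (if 2 \<le> size M then 1 else 0) + \<Sum>\<^sub># (image_mset nb M)"

primrec sb :: "rt \<Rightarrow> nat" where
  "sb (Nd M) = (\<Sum>Z\<in>#M. nb Z) + \<Sum>\<^sub># (image_mset sb M)"

lemma nb_add: "nb (Nd (add_mset Z M)) = nb Z + nb (Nd M) + (if size M = 1 then 1 else 0)"
  by auto

lemma sb_add: "sb (Nd (add_mset Z M)) = sb Z + nb Z + sb (Nd M)"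
  by simp

lemma nb_Lf [simp]: "nb Lf = 0" and sb_Lf [simp]: "sb Lf = 0"
  by simp_all

declare nb.simps [simp del] sb.simps [simp del]

text \<open>An added leaf leaves the old branching vertices where they are; it can at most create a
  new one.\<close>

lemma ins_branching: "ins R R' \<Longrightarrow> nb R \<le> nb R' \<and> (nb R' = nb R \<longrightarrow> sb R' = sb R)"
  by (induction rule: ins.induct) (auto simp: nb_add sb_add)

text \<open>A leaf that is deeper than all others has no siblings, so attaching it creates no
  branching vertex.\<close>

lemma deepen_branching: "ins X Y \<Longrightarrow> ht X < ht Y \<Longrightarrow> nb X = nb Y \<and> sb X = sb Y"
proof (induction rule: ins.induct)
  case (root M)
  then show ?case by (cases rule: deepen_cases[OF ins.root]) (auto simp: nb_add sb_add)
next
  case (sub V V' N)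
  have "ht V < ht V'" using sub(3) unfolding ht_add by linarith
  then show ?case using sub by (simp add: nb_add sb_add)
qed

lemma spine_branching: "nb (Nd (cf (\<rho> @ [{#}, {#}]))) = nb (Nd (cf (\<rho> @ [{#}]))) \<and> sb (Nd (cf (\<rho> @ [{#}, {#}]))) = sb (Nd (cf (\<rho> @ [{#}])))"
  by (induction \<rho>) (auto simp: cf_Cons nb_add sb_add)

lemma nb_0_single:
  assumes "nb R = 0" "R \<noteq> Lf"
  obtains S where "R = Nd {#S#}" "nb S = 0"
proof -
  obtain S M where "R = Nd (add_mset S M)" using assms(2) by (metis multiset_cases rt.exhaust)
  moreover have "\<not> 2 \<le> size (add_mset S M)" using assms(1) calculation by (auto simp: nb.simps split: if_splits)
  then have "M = {#}" by (cases M) auto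
  ultimately show ?thesis using that assms(1) by (auto simp: nb_add)
qed

lemma nb_0_sb: "nb R = 0 \<Longrightarrow> sb R = 0"
proof (induction "sz R" arbitrary: R rule: less_induct)
  case less
  show ?case
  proof (cases "R = Lf")
    case False
    then obtain S where S: "R = Nd {#S#}" "nb S = 0" using less.prems nb_0_single by blast
    then have "sz S < sz R" by simp
    then show ?thesis using less.hyps S by (simp add: sb_add)
  qed simp
qed

lemma path_eq: "nb R = 0 \<Longrightarrow> nb S = 0 \<Longrightarrow> ht R = ht S \<Longrightarrow> R = S"
proof (induction "sz R" arbitrary: R S rule: less_induct)
  case less
  show ?case
  proof (cases "R = Lf \<or> S = Lf")
    case True
    have "T = Lf" if "ht T = 1" for T
      by (metis that One_nat_def ht_mem less_one multiset_nonemptyE rt.exhaust ht_pos(2))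
    then show ?thesis using True less.prems by (metis ht_Lf)
  next
    case False
    then obtain R' S' where e: "R = Nd {#R'#}" "nb R' = 0" "S = Nd {#S'#}" "nb S' = 0" using less.prems nb_0_single by metis
    moreover have "ht R' = ht S'" using less.prems(3) unfolding e ht_add ht_empty using ht_ge1[of R'] ht_ge1[of S'] by linarith
    moreover have "sz R' < sz R" using e by simp
    ultimately show ?thesis using less.hyps by metis
  qed
qed

lemma path_sz: "nb R = 0 \<Longrightarrow> sz R = ht R"
proof (induction "sz R" arbitrary: R rule: less_induct)
  case less
  show ?case
  proof (cases "R = Lf")
    case False
    then obtain S where S: "R = Nd {#S#}" "nb S = 0" using less.prems nb_0_single by blast
    then have "sz S = ht S" using less.hyps by simp
    then show ?thesis using S by (simp add: ht_add max_def)
  qed simp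
qed

lemma path_ins:
  assumes "ins R S" "nb S = 0"
  shows "nb R = 0" "ht S = Suc (ht R)"
proof -
  show "nb R = 0" using ins_branching[OF assms(1)] assms(2) by simp
  then show "ht S = Suc (ht R)" using path_sz assms ins_sz by metis
qed

section \<open>Counting vertices by depth\<close>

text \<open>The number of vertices at a given depth, where the root has depth 0.\<close>

primrec lev :: "rt \<Rightarrow> nat \<Rightarrow> nat" where
  "lev (Nd M) = (\<lambda>k. case k of 0 \<Rightarrow> 1 | Suc j \<Rightarrow> \<Sum>l\<in>#image_mset lev M. l j)"

lemma lev_0 [simp]: "lev R 0 = 1"
  by (cases R) simp

lemma lev_add: "lev (Nd (add_mset Z M)) (Suc j) = lev Z j + lev (Nd M) (Suc j)"
  by simp

lemma lev_Lf [simp]: "lev Lf (Suc j) = 0"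
  by simp

declare lev.simps [simp del]

lemma ins_lev: "ins R R' \<Longrightarrow> lev R k \<le> lev R' k"
proof (induction arbitrary: k rule: ins.induct)
  case (root M)
  then show ?case by (cases k) (auto simp: lev_add)
next
  case (sub X X' M)
  then show ?case by (cases k) (auto simp: lev_add)
qed

lemma lev_ge_ht: "ht R \<le> k \<Longrightarrow> lev R k = 0"
proof (induction k arbitrary: R)
  case (Suc k)
  obtain M where R: "R = Nd M" by (cases R)
  have "lev (Nd M) (Suc k) = 0" if "ht (Nd M) \<le> Suc k" for M
    using that
  proof (induction M)
    case (add Z M)
    then show ?case using Suc.IH by (simp add: lev_add ht_add)
  qed simp
  then show ?case using Suc.prems R by simp
qed simp

lemma deepen_lev: "ins X Y \<Longrightarrow> ht X < ht Y \<Longrightarrow> lev Y (ht Y - 1) = 1"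
proof (induction rule: ins.induct)
  case (root M)
  then show ?case by (cases rule: deepen_cases[OF ins.root]) (auto simp: lev_add ht_add)
next
  case (sub V V' N)
  have h: "ht V < ht V'" "ht (Nd N) < Suc (ht V')" using sub(3) unfolding ht_add by linarith+
  obtain j where j: "ht V' = Suc j" using ht_pos(1) gr0_implies_Suc by blast
  have "ht (Nd (add_mset V' N)) - 1 = Suc j" using h j unfolding ht_add by linarith
  moreover have "lev (Nd N) (Suc j) = 0" using lev_ge_ht h j by simp
  ultimately show ?case using sub.IH h j by (simp add: lev_add)
qed

lemma lev_cf_leaf: "1 \<le> lev (Nd (cf (\<tau> @ [{#}]))) (length \<tau>)"
  by (induction \<tau>) (auto simp: cf_Cons lev_add)

text \<open>Both paths end at the same depth of the same tree, where there is room for one vertex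
  only.\<close>

lemma lev_ctx_uniq:
  assumes "lev (Nd (cf (\<tau> @ [{#}]))) (length \<tau>) \<le> 1" "cf (\<tau> @ [{#}]) = cf (\<sigma> @ [{#}])" "length \<sigma> = length \<tau>"
  shows "\<sigma> = \<tau>"
  using assms
proof (induction \<tau> arbitrary: \<sigma>)
  case (Cons Q \<tau>)
  obtain P \<sigma>' where s: "\<sigma> = P # \<sigma>'" "length \<sigma>' = length \<tau>" using Cons.prems(3) by (cases \<sigma>) auto
  let ?F = "Nd (cf (\<tau> @ [{#}]))" and ?F' = "Nd (cf (\<sigma>' @ [{#}]))"
  have e: "add_mset ?F Q = add_mset ?F' P" using Cons.prems(2) s by (simp add: cf_Cons)
  have l: "lev (Nd (add_mset ?F Q)) (Suc (length \<tau>)) \<le> 1" using Cons.prems(1) by (simp add: cf_Cons)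
  have "?F = ?F'"
  proof (rule ccontr)
    assume "?F \<noteq> ?F'"
    then obtain K where "Q = add_mset ?F' K" by (rule add_mset_neqE[OF e])
    then have "lev ?F (length \<tau>) + lev ?F' (length \<tau>) \<le> 1" using l by (simp add: lev_add)
    then show False using lev_cf_leaf[of \<tau>] lev_cf_leaf[of \<sigma>'] s(2) by simp
  qed
  moreover then have "Q = P" using e by simp
  moreover have "lev ?F (length \<tau>) \<le> 1" using l by (simp add: lev_add)
  ultimately show ?case using Cons.IH[of \<sigma>'] s by simp
qed simp

lemma ins_ex: "R \<noteq> Lf \<Longrightarrow> \<exists>S. ins S R"
proof (induction R)
  case (Nd M)
  then obtain Z N where M: "M = add_mset Z N" by (metis multiset_cases)
  show ?case
  proof (cases "Z = Lf")
    case True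
    then show ?thesis using M ins.root by blast
  next
    case False
    then show ?thesis using Nd.IH[of Z] M ins.sub by auto
  qed
qed

text \<open>A tree that is not a path from its root has a leaf off some longest path
  downwards.\<close>

lemma ins_ex_same_ht: "nb R \<noteq> 0 \<Longrightarrow> \<exists>S. ins S R \<and> ht S = ht R"
proof (induction R)
  case (Nd M)
  then have "M \<noteq> {#}" by auto
  then obtain Z where Z: "Z \<in># M" "ht (Nd M) = Suc (ht Z)" using ht_ex by blast
  then obtain N where M: "M = add_mset Z N" by (meson multi_member_split)
  show ?case
  proof (cases "N = {#}")
    case True
    then have "nb Z \<noteq> 0" using Nd.prems M by (simp add: nb_add)
    then obtain S where "ins S Z" "ht S = ht Z" using Nd.IH[of Z] M by auto
    then show ?thesis using ins.sub[of S Z N] M by (intro exI[of _ "Nd (add_mset S N)"]) (simp add: ht_add)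
  next
    case False
    then obtain T where T: "ins T (Nd N)" using ins_ex by fastforce
    obtain K where K: "T = Nd K" by (cases T)
    have "ins (Nd (add_mset Z K)) (Nd M)" using ins_add T K M by simp
    moreover have "ht (Nd (add_mset Z K)) = ht (Nd M)"
      using ins_ht[OF T] Z(2) unfolding M K ht_add by linarith
    ultimately show ?thesis by blast
  qed
qed

section \<open>Leaf edges and neutral roots\<close>

text \<open>
  Some leaf of \<open>A\<close>, distinct from the root, can be removed such that \<open>A\<close> is recovered, including its root,
  from its isomorphism type and from what is left. The condition on the diameter will exclude that \<open>B\<close> is
  the rest of \<open>A\<close> with a leaf attached at the root.
\<close>

definition good :: "rt \<Rightarrow> bool" where
  "good A \<longleftrightarrow> (\<exists>P. ins (Nd {#P#}) A \<and> diam (Nd {#Nd {#P#}#}) = Suc (diam A) \<and>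
     (\<forall>X. ins (Nd {#P#}) X \<and> X \<approx> A \<longrightarrow> X = A))"

text \<open>Here the root is a deepest leaf seen from the centre and the removal does not move the
  centre. So a further leaf at the root lengthens the diameter, and every competitor has the same
  centre, which leaves only its limbs to be compared.\<close>

lemma good_ctx:
  assumes "ctx f \<rho>" "hctr f (cf (\<rho> @ [{#}]))" "ht (Nd (cf (\<rho> @ [{#}]))) = Suc (length \<rho>)"
    and "cins f \<rho>0 \<rho>" "ctx f \<rho>0" "hctr f (cf (\<rho>0 @ [{#}]))"
    and uniq: "\<And>\<sigma>. cins f (\<rho>0 @ [{#}]) \<sigma> \<Longrightarrow> cf \<sigma> = cf (\<rho> @ [{#}]) \<Longrightarrow> \<sigma> = \<rho> @ [{#}]"
  shows "good (Nd {#up f \<rho>#})"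
proof -
  let ?A = "Nd {#up f \<rho>#}" and ?P = "Nd {#up f \<rho>0#}"
  have A: "?A = up f (\<rho> @ [{#}])" and P: "?P = up f (\<rho>0 @ [{#}])" using assms up_leaf by metis+
  have c: "cins f (\<rho>0 @ [{#}]) (\<rho> @ [{#}])" using assms(4) cins_snocI by blast
  have x: "ctx f (\<rho> @ [{#}])" "ctx f (\<rho>0 @ [{#}])" using assms ctx_snoc by blast+
  have i: "ins ?P ?A" unfolding A P using cins_up[OF x(2) c] .
  have cA: "cen f (cf (\<rho> @ [{#}])) ?A" unfolding A using cen_up x by blast
  have cP: "cen f (cf (\<rho>0 @ [{#}])) ?P" unfolding P using cen_up x by blast
  have ne: "\<rho>0 \<noteq> []" "\<rho>0 @ [{#}] \<noteq> []" using assms(5) by (auto simp: ctx_def)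
  have len: "length \<rho>0 = length \<rho>" using cins_length assms(4) by fastforce
  have h0: "ht (Nd (cf (\<rho>0 @ [{#}]))) = Suc (length \<rho>)"
    using ins_ht[of "Nd (cf (\<rho>0 @ [{#}]))" "Nd (cf (\<rho> @ [{#}]))"] cins_cf[OF x(2) c] ht_cf_leaf[OF ne(1)] len assms(3)
    unfolding vins_def by linarith
  have dP: "diam ?P = diam ?A"
    using diam_eq[OF cA assms(2)] diam_eq[OF cP assms(6)] h0 assms(3) unfolding dm_def by simp
  have cPP: "cen f (cf ((\<rho>0 @ [{#}]) @ [{#}])) (Nd {#?P#})"
    using cen_up[OF ctx_snoc[OF x(2)]] up_leaf[OF x(2)] P by metis
  have "ht (Nd (cf ((\<rho>0 @ [{#}]) @ [{#}]))) = Suc (Suc (length \<rho>))"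
    using ht_cf_leaf[OF ne(2)] h0 len by simp
  then have "diam (Nd {#?P#}) = Suc (diam ?A)"
    using diam_vins[OF cP assms(6) vins_cf_leaf[OF x(2)] cPP] h0 dP by simp
  moreover have "X = ?A" if X: "ins ?P X" "X \<approx> ?A" for X
  proof -
    obtain \<sigma> where s: "cins f (\<rho>0 @ [{#}]) \<sigma>" "ctx f \<sigma>" "X = up f \<sigma>"
      using ins_up[OF x(2), of X] X(1) P by metis
    have cX: "cen f (cf \<sigma>) X" using cen_up s by metis
    have "hctr f (cf \<sigma>)"
      using diam_vins[OF cP assms(6) cins_cf[OF x(2) s(1)] cX] diam_ueq[OF X(2)] dP by auto
    then have "cf \<sigma> = cf (\<rho> @ [{#}])" using ht.cen_uniq[OF cX _ cA assms(2) X(2)] by simp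
    then show ?thesis using uniq[OF s(1)] s(3) A by simp
  qed
  ultimately show ?thesis using i unfolding good_def by blast
qed

text \<open>The leaf comes from a limb that does not contain the root. It could return elsewhere
  only if the reduced limb were a copy of the limb of the root, so that the two exchange their
  roles; this is what \<open>E' \<noteq> {#Nd (cf (\<tau> @ [{#}]))#}\<close> excludes.\<close>

lemma good_far:
  assumes "ctx f ((R + E) # \<tau>)" "hctr f (cf (((R + E) # \<tau>) @ [{#}]))"
    and "ht (Nd (cf (((R + E) # \<tau>) @ [{#}]))) = Suc (length ((R + E) # \<tau>))"
    and "ad E' E" "E' \<noteq> {#Nd (cf (\<tau> @ [{#}]))#}" "f \<or> size E' = size E"
    and "hctr f (add_mset (Nd (cf (\<tau> @ [{#}]))) (R + E'))"
  shows "good (Nd {#up f ((R + E) # \<tau>)#})"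
proof -
  let ?L = "Nd (cf (\<tau> @ [{#}]))"
  have i: "ins (Nd (R + E')) (Nd (R + E))" using assms(4) ins_ad by blast
  then have c: "cins f ((R + E') # \<tau>) ((R + E) # \<tau>)"
    using cinsI[OF i, of f "[]" \<tau>] assms(6) by auto
  have x: "ctx f ((R + E') # \<tau>)" using assms(1,6) by (auto simp: ctx_def)
  have e: "cf (((R + E') # \<tau>) @ [{#}]) = add_mset ?L (R + E')" "cf (((R + E) # \<tau>) @ [{#}]) = add_mset ?L (R + E)"
    by (simp_all add: cf_Cons)
  show ?thesis
  proof (rule good_ctx[OF assms(1,2,3) c x])
    show "hctr f (cf (((R + E') # \<tau>) @ [{#}]))" using assms(7) e by simp
    fix \<sigma>
    assume s: "cins f (((R + E') # \<tau>) @ [{#}]) \<sigma>" "cf \<sigma> = cf (((R + E) # \<tau>) @ [{#}])"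
    then obtain \<alpha> Q Q' \<beta> where p: "((R + E') # \<tau>) @ [{#}] = \<alpha> @ Q # \<beta>" "\<sigma> = \<alpha> @ Q' # \<beta>"
      unfolding cins_def by blast
    show "\<sigma> = ((R + E) # \<tau>) @ [{#}]"
    proof (cases \<alpha>)
      case Nil
      then have "\<sigma> = Q' # \<tau> @ [{#}]" using p by simp
      then have "add_mset ?L Q' = add_mset ?L (R + E)" using s(2) unfolding e by (simp add: cf_Cons)
      then show ?thesis using \<open>\<sigma> = Q' # \<tau> @ [{#}]\<close> by simp
    next
      case (Cons O1 \<alpha>')
      let ?s = "\<alpha>' @ Q' # \<beta>"
      have sg: "\<sigma> = (R + E') # ?s" using p Cons by simp
      then have "add_mset (Nd (cf ?s)) (R + E') = add_mset ?L (R + E)" using s(2) unfolding e by (simp add: cf_Cons)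
      then have "R + add_mset (Nd (cf ?s)) E' = R + add_mset ?L E" by simp
      then have k: "add_mset (Nd (cf ?s)) E' = add_mset ?L E" by (rule add_left_imp_eq)
      have "E' \<noteq> E" using ad_tsz[OF assms(4)] by auto
      then have "Nd (cf ?s) \<noteq> ?L" using k by auto
      then have "?L \<in># E'" using k insert_noteq_member by metis
      then show ?thesis using ad_small[OF assms(4)] assms(5) by blast
    qed
  qed
qed

lemma cf_all_empty: "(\<And>Q. Q \<in> set \<tau> \<Longrightarrow> Q = {#}) \<Longrightarrow> nb (Nd (cf \<tau>)) = 0"
proof (induction \<tau>)
  case (Cons Q \<tau>)
  have "nb (Nd (cf \<tau>)) = 0" by (rule Cons.IH) (use Cons.prems in simp)
  moreover have "Q = {#}" by (rule Cons.prems) simp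
  ultimately show ?case by (cases "\<tau> = []") (simp_all add: cf_Cons nb_add)
qed simp

text \<open>Covers the exception in \<open>good_far\<close>: the leaf is taken from the limb of the
  root, off the path to the root. Sizes force it back into this limb, and the root is the only
  vertex of its depth there, so its path is determined.\<close>

lemma good_near:
  assumes "ctx f ({#L#} # \<tau>)" "hctr f (cf (({#L#} # \<tau>) @ [{#}]))"
    and "ht (Nd (cf (({#L#} # \<tau>) @ [{#}]))) = Suc (length ({#L#} # \<tau>))"
    and L: "sz L = Suc (sz (Nd (cf (\<tau> @ [{#}]))))" "lev (Nd (cf (\<tau> @ [{#}]))) (length \<tau>) \<le> 1"
      "nb (Nd (cf (\<tau> @ [{#}]))) \<noteq> 0" "ht L = Suc (length \<tau>)"
  shows "good (Nd {#up f ({#L#} # \<tau>)#})"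
proof -
  let ?La = "Nd (cf (\<tau> @ [{#}]))"
  obtain Q where "Q \<in> set (\<tau> @ [{#}])" and Q2: "Q \<noteq> {#}"
    using cf_all_empty[of "\<tau> @ [{#}]"] L(3) by metis
  moreover from this have Q1: "Q \<in> set \<tau>" unfolding set_append by simp
  note Q = Q1 Q2
  obtain \<alpha> \<beta> where t: "\<tau> = \<alpha> @ Q # \<beta>" using split_list[OF Q1] by blast
  have "Nd Q \<noteq> Lf" using Q(2) by simp
  then obtain S where "ins S (Nd Q)" using ins_ex by blast
  then obtain Q0 where Q0: "ins (Nd Q0) (Nd Q)" by (metis rt.exhaust)
  let ?t0 = "\<alpha> @ Q0 # \<beta>"
  let ?L0 = "Nd (cf (?t0 @ [{#}]))"
  have c: "cins f ({#L#} # ?t0) ({#L#} # \<tau>)" using cinsI[OF Q0, of f "{#L#} # \<alpha>" \<beta>] t by simp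
  have x: "ctx f ({#L#} # ?t0)" using assms(1) t by (auto simp: ctx_def)
  have e: "cf (({#L#} # ?t0) @ [{#}]) = {#?L0, L#}" "cf (({#L#} # \<tau>) @ [{#}]) = {#?La, L#}"
    by (simp_all add: cf_Cons)
  have hLa: "ht ?La \<le> Suc (length \<tau>)" using assms(3) unfolding e ht_add by simp
  have x0: "ctx True ?t0" by (simp add: ctx_def)
  have c0: "cins True (?t0 @ [{#}]) (\<tau> @ [{#}])" using cinsI[OF Q0, of True \<alpha> "\<beta> @ [{#}]"] t by simp
  have i: "ins ?L0 ?La" using cins_cf[OF ctx_snoc[OF x0] c0] unfolding vins_def by blast
  have "length (?t0 @ [{#}]) \<le> ht ?L0" by (rule length_le_ht) simp
  then have h0: "ht ?L0 = Suc (length \<tau>)" "ht ?La = Suc (length \<tau>)" using ins_ht[OF i] hLa t by simp_all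
  show ?thesis
  proof (rule good_ctx[OF assms(1,2,3) c x])
    show "hctr f (cf (({#L#} # ?t0) @ [{#}]))"
    proof (cases f)
      case True
      have "ht Z < ht (Nd N)" if "{#?L0, L#} = add_mset Z N" for Z N
      proof -
        have "Z \<in># {#?L0, L#}" "N \<noteq> {#}" using that by auto
        then obtain W where "W \<in># N" by blast
        then have "W \<in># {#?L0, L#}" using that by auto
        then have "ht W = Suc (length \<tau>)" using h0 L(4) by auto
        moreover have "ht Z = Suc (length \<tau>)" using \<open>Z \<in># {#?L0, L#}\<close> h0 L(4) by auto
        ultimately show ?thesis using ht_mem[OF \<open>W \<in># N\<close>] by simp
      qed
      then show ?thesis unfolding e using True not_ctr_TrueE by (metis not_less)
    next
      case False
      then show ?thesis unfolding e using h0 L(4) by (simp add: ctr_False_iff)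
    qed
    fix \<sigma>
    assume s: "cins f (({#L#} # ?t0) @ [{#}]) \<sigma>" "cf \<sigma> = cf (({#L#} # \<tau>) @ [{#}])"
    then obtain \<gamma> P P' \<delta> where p: "({#L#} # ?t0) @ [{#}] = \<gamma> @ P # \<delta>" "\<sigma> = \<gamma> @ P' # \<delta>" "ins (Nd P) (Nd P')"
      unfolding cins_def by blast
    show "\<sigma> = ({#L#} # \<tau>) @ [{#}]"
    proof (cases \<gamma>)
      case Nil
      then have "\<sigma> = P' # ?t0 @ [{#}]" "P = {#L#}" using p by simp_all
      then have k: "add_mset ?L0 P' = {#?La, L#}" using s(2) unfolding e by (simp add: cf_Cons)
      have "sz ?La = Suc (sz ?L0)" using ins_sz[OF i] .
      then have "?L0 \<noteq> ?La" "?L0 \<noteq> L" using L(1) by auto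
      moreover have "?L0 \<in># {#?La, L#}" using k by (metis union_single_eq_member)
      ultimately show ?thesis by simp
    next
      case (Cons O1 \<gamma>')
      let ?s = "\<gamma>' @ P' # \<delta>"
      have sg: "\<sigma> = {#L#} # ?s" using p Cons by simp
      then have "add_mset (Nd (cf ?s)) {#L#} = {#?La, L#}" using s(2) unfolding e by (simp add: cf_Cons)
      then have k: "cf ?s = cf (\<tau> @ [{#}])" by simp
      have lens: "length ?s = Suc (length \<tau>)" using p(1) Cons t by (metis length_append_singleton length_append length_Cons append_Cons list.inject)
      have ne: "?s \<noteq> []" by simp
      obtain \<sigma>' U where U: "?s = \<sigma>' @ [U]" using ne by (metis rev_exhaust)
      \<comment> \<open>A leaf put back below the root would exceed the height of the limb.\<close>
      have "U = {#}"
      proof (rule ccontr)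
        assume "U \<noteq> {#}"
        then obtain V W where "U = add_mset V W" by (metis multiset_cases)
        moreover obtain VM where "V = Nd VM" by (cases V)
        ultimately have "cf ?s = cf (\<sigma>' @ [W, VM])"
          using cf_snoc[of "\<sigma>' @ [W]" VM] U by simp
        moreover have "length (\<sigma>' @ [W, VM]) = Suc (Suc (length \<tau>))" using lens U by simp
        ultimately show False using length_le_ht[of "\<sigma>' @ [W, VM]"] k h0(2) by simp
      qed
      then have "\<sigma>' = \<tau>" using lev_ctx_uniq[OF L(2), of \<sigma>'] k U lens by simp
      then show ?thesis using sg U \<open>U = {#}\<close> by simp
    qed
  qed
qed

section \<open>Comparing roots and branching at the centres\<close>

definition fav :: "rt \<Rightarrow> rt \<Rightarrow> bool" where
  "fav A B \<longleftrightarrow> (\<exists>f G H. cen f G A \<and> hctr f G \<and> cen f H B \<and> hctr f H \<and>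
     nb (Nd H) \<le> nb (Nd G) \<and> (nb (Nd H) = nb (Nd G) \<longrightarrow> sb (Nd H) < sb (Nd G)))"

lemma fav_asym: "fav A B \<Longrightarrow> \<not> fav B A"
proof
  assume "fav A B" "fav B A"
  then obtain f G H f' G' H' where
    1: "cen f G A" "hctr f G" "cen f H B" "hctr f H"
      "nb (Nd H) \<le> nb (Nd G)" "nb (Nd H) = nb (Nd G) \<longrightarrow> sb (Nd H) < sb (Nd G)" and
    2: "cen f' G' B" "hctr f' G'" "cen f' H' A" "hctr f' H'"
      "nb (Nd H') \<le> nb (Nd G')" "nb (Nd H') = nb (Nd G') \<longrightarrow> sb (Nd H') < sb (Nd G')"
    unfolding fav_def by blast
  have "G = H'" "H = G'" using ht.cen_uniq[OF 1(1,2) 2(3,4)] ht.cen_uniq[OF 1(3,4) 2(1,2)] by simp_all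
  then show False using 1 2 by simp
qed

text \<open>
  Attaching one or two vertices one after the other at the root of \<open>X\<close> changes neither the centre nor
  the height.
\<close>

definition neutral :: "rt \<Rightarrow> bool" where
  "neutral X \<longleftrightarrow> (\<exists>f \<rho>. ctx f \<rho> \<and> X = up f \<rho> \<and> hctr f (cf (\<rho> @ [{#}])) \<and>
     length \<rho> + 2 \<le> ht (Nd (cf (\<rho> @ [{#}]))))"

lemma neutralE:
  assumes "neutral X"
  obtains f \<rho> where "ctx f \<rho>" "X = up f \<rho>" "cen f (cf \<rho>) X" "hctr f (cf \<rho>)"
    "cen f (cf (\<rho> @ [{#}])) (Nd {#X#})" "hctr f (cf (\<rho> @ [{#}]))"
    "cen f (cf (\<rho> @ [{#}, {#}])) (Nd {#Nd {#X#}#})" "hctr f (cf (\<rho> @ [{#}, {#}]))"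
    "diam (Nd {#X#}) = diam X" "diam (Nd {#Nd {#X#}#}) = diam X"
proof -
  obtain f \<rho> where r: "ctx f \<rho>" "X = up f \<rho>" "hctr f (cf (\<rho> @ [{#}]))" "length \<rho> + 2 \<le> ht (Nd (cf (\<rho> @ [{#}])))"
    using assms unfolding neutral_def by blast
  have x: "ctx f (\<rho> @ [{#}])" "\<rho> \<noteq> []" using r ctx_snoc by (auto simp: ctx_def)
  have u: "hctr f (cf \<rho>)" using ctr_del_neutral r by blast
  have c: "cen f (cf \<rho>) X" "cen f (cf (\<rho> @ [{#}])) (Nd {#X#})" using r x cen_up up_leaf by metis+
  have "up f ((\<rho> @ [{#}]) @ [{#}]) = Nd {#Nd {#X#}#}" using up_leaf[OF x(1)] up_leaf[OF r(1)] r(2) by simp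
  then have c2: "cen f (cf (\<rho> @ [{#}, {#}])) (Nd {#Nd {#X#}#})" using cen_up[OF ctx_snoc[OF x(1)], of "{#}"] by simp
  have h: "ht (Nd (cf (\<rho> @ [{#}]))) = ht (Nd (cf \<rho>))" using ht_cf_leaf[OF x(2)] r(4) by linarith
  have h2: "ht (Nd (cf (\<rho> @ [{#}, {#}]))) = ht (Nd (cf (\<rho> @ [{#}])))"
    using ht_cf_leaf[of "\<rho> @ [{#}]"] r(4) by simp
  have v2: "vins f (cf (\<rho> @ [{#}])) (cf (\<rho> @ [{#}, {#}]))" using vins_cf_leaf[OF x(1)] by simp
  have "diam (Nd {#X#}) = diam X" using diam_vins[OF c(1) u vins_cf_leaf[OF r(1)] c(2)] h by simp
  moreover have "hctr f (cf (\<rho> @ [{#}, {#}]))" "diam (Nd {#Nd {#X#}#}) = diam (Nd {#X#})"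
    using diam_vins[OF c(2) r(3) v2 c2] h2 by simp_all
  ultimately show ?thesis using that[OF r(1,2) c(1) u c(2) r(3) c2] by simp
qed

text \<open>If the root is not neutral, the first leaf attached there is already a deepest one, so
  the second one lengthens a longest path.\<close>

lemma deepE:
  assumes "\<not> neutral X" "X \<noteq> Lf"
  obtains f \<rho> where "ctx f \<rho>" "X = up f \<rho>" "hctr f (cf (\<rho> @ [{#}]))"
    "ht (Nd (cf (\<rho> @ [{#}]))) = Suc (length \<rho>)" "diam (Nd {#Nd {#X#}#}) = Suc (diam (Nd {#X#}))"
    "cen f (cf (\<rho> @ [{#}])) (Nd {#X#})" "cen f (cf (\<rho> @ [{#}, {#}])) (Nd {#Nd {#X#}#})"
proof -
  obtain f \<rho> where r: "ctx f \<rho>" "X = up f \<rho>" "hctr f (cf (\<rho> @ [{#}]))" using leaf_ctx assms(2) by blast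
  have "length (\<rho> @ [{#}]) \<le> ht (Nd (cf (\<rho> @ [{#}])))" by (rule length_le_ht) simp
  then have h: "ht (Nd (cf (\<rho> @ [{#}]))) = Suc (length \<rho>)" using assms(1) r unfolding neutral_def by force
  have x: "ctx f (\<rho> @ [{#}])" using r ctx_snoc by blast
  have c: "cen f (cf (\<rho> @ [{#}])) (Nd {#X#})" using r x cen_up up_leaf by metis
  have "up f ((\<rho> @ [{#}]) @ [{#}]) = Nd {#Nd {#X#}#}" using up_leaf[OF x(1)] up_leaf[OF r(1)] r(2) by simp
  then have c2: "cen f (cf (\<rho> @ [{#}, {#}])) (Nd {#Nd {#X#}#})" using cen_up[OF ctx_snoc[OF x(1)], of "{#}"] by simp
  have h2: "ht (Nd (cf (\<rho> @ [{#}, {#}]))) = Suc (Suc (length \<rho>))"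
    using ht_cf_leaf[of "\<rho> @ [{#}]"] h by simp
  have v2: "vins f (cf (\<rho> @ [{#}])) (cf (\<rho> @ [{#}, {#}]))" using vins_cf_leaf[OF x(1)] by simp
  have "diam (Nd {#Nd {#X#}#}) = Suc (diam (Nd {#X#}))"
    using diam_vins[OF c(1) r(3) v2 c2] h2 h by simp
  then show ?thesis using that[OF r h _ c c2] by simp
qed

section \<open>Deepest roots\<close>

lemma filter_ht_eq:
  assumes "\<And>Z. Z \<in># N \<Longrightarrow> ht Z < k"
  shows "filter_mset (\<lambda>Z. ht Z = k) N = {#}"
proof (rule ccontr)
  assume "filter_mset (\<lambda>Z. ht Z = k) N \<noteq> {#}"
  then obtain Z where Z: "Z \<in># filter_mset (\<lambda>Z. ht Z = k) N" using multiset_nonemptyE by blast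
  then have "ht Z = k" by simp
  moreover have "Z \<in># N" using Z by simp
  ultimately show False using assms by blast
qed

lemma top_pair_uniq:
  assumes "add_mset X (add_mset Y K) = add_mset V (add_mset W N)"
    and "ht X = k" "ht Y = k" "ht V = k" "ht W = k"
    and "\<And>Z. Z \<in># K \<Longrightarrow> ht Z < k" "\<And>Z. Z \<in># N \<Longrightarrow> ht Z < k"
  shows "(X = V \<and> Y = W \<or> X = W \<and> Y = V) \<and> K = N"
proof -
  have "filter_mset (\<lambda>Z. ht Z = k) (add_mset X (add_mset Y K)) = filter_mset (\<lambda>Z. ht Z = k) (add_mset V (add_mset W N))"
    by (rule arg_cong[OF assms(1)])
  moreover have "filter_mset (\<lambda>Z. ht Z = k) (add_mset X (add_mset Y K)) = {#X, Y#}"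
    using assms(2,3) filter_ht_eq[OF assms(6)] by simp
  moreover have "filter_mset (\<lambda>Z. ht Z = k) (add_mset V (add_mset W N)) = {#V, W#}"
    using assms(4,5) filter_ht_eq[OF assms(7)] by simp
  ultimately have p: "{#X, Y#} = {#V, W#}" by argo
  have "{#X, Y#} + K = {#V, W#} + N" using assms(1) by simp
  then have "{#X, Y#} + K = {#X, Y#} + N" unfolding p .
  then have "K = N" by (rule add_left_imp_eq)
  then show ?thesis using p unfolding pair_mset_eq by blast
qed

text \<open>
  Both \<open>B\<close> and \<open>A = Nd {#A1#}\<close> are obtained by removing a leaf from \<open>Nd {#A#}\<close>, whose centre is half an
  edge away from those of \<open>A\<close> and \<open>B\<close>. So either the centres agree and \<open>A \<approx> B\<close>, or they lie on different
  sides, and then \<open>B\<close> loses a deepest leaf in the part \<open>Q\<close> or \<open>Y\<close> that is opposite to the limb of the root.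
\<close>

lemma deep_structure:
  assumes A: "\<not> neutral A1" "A1 \<noteq> Lf"
    and B: "incl B (Nd {#Nd {#A1#}#})" "diam B = diam (Nd {#A1#})" "\<not> Nd {#A1#} \<approx> B"
  obtains (vertex) Q \<tau> X' X Y' where "A1 = up True (Q # \<tau>)" "X' = Nd (cf (\<tau> @ [{#}]))" "X = Nd (cf (\<tau> @ [{#}, {#}]))"
      "cen True (add_mset X' Q) (Nd {#A1#})" "hctr True (add_mset X' Q)" "ht X' = Suc (length \<tau>)" "ht X = length \<tau> + 2"
      "ht (Nd Q) = length \<tau> + 2" "ins Y' (Nd Q)" "ht Y' < ht (Nd Q)"
      "cen True (add_mset Y' (ch X)) B" "hctr True (add_mset Y' (ch X))"
  | (edge) Y K \<tau> X' X Y' where "A1 = up False ({#Y#} # K # \<tau>)" "X' = Nd (cf (\<tau> @ [{#}]))" "X = Nd (cf (\<tau> @ [{#}, {#}]))"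
      "cen False {#Nd (add_mset X' K), Y#} (Nd {#A1#})" "ht (Nd (add_mset X' K)) = ht Y" "ht X' = Suc (length \<tau>)" "ht X = length \<tau> + 2"
      "ht Y = length \<tau> + 2" "ins Y' Y" "ht Y' < ht Y"
      "cen False {#X, Nd (add_mset Y' K)#} B" "ht X = ht (Nd (add_mset Y' K))"
proof -
  obtain f \<rho> where r: "ctx f \<rho>" "A1 = up f \<rho>" and G: "hctr f (cf (\<rho> @ [{#}]))"
    and hG: "ht (Nd (cf (\<rho> @ [{#}]))) = Suc (length \<rho>)" and dA: "diam (Nd {#Nd {#A1#}#}) = Suc (diam (Nd {#A1#}))"
    and cA: "cen f (cf (\<rho> @ [{#}])) (Nd {#A1#})" and cA2: "cen f (cf (\<rho> @ [{#}, {#}])) (Nd {#Nd {#A1#}#})"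
    using deepE[OF A] by blast
  obtain fB H where H0: "cen fB H B" "hctr fB H" using ht.cen_ex by blast
  have "dm fB H = dm f (cf (\<rho> @ [{#}]))" using diam_eq[OF H0] diam_eq[OF cA G] B(2) by argo
  note d = dm_eqD[OF this]
  then have ff: "fB = f" and hH: "ht (Nd H) = Suc (length \<rho>)" unfolding hG by blast+
  have cB: "cen f H B" and H: "hctr f H" using H0 unfolding ff .
  have ne: "H \<noteq> {#}"
  proof
    assume "H = {#}"
    then have "length \<rho> = 0" using hH by simp
    then show False using r(1) by (simp add: ctx_def)
  qed
  have AB: "cf (\<rho> @ [{#}]) \<noteq> H" using cen_imp_ueq[OF cA] cB B(3) by blast
  obtain M where M: "vins f H M" "cen f M (Nd {#Nd {#A1#}#})" using cen_incl[OF cB B(1)] by blast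
  \<comment> \<open>The larger tree has a greater diameter than \<open>B\<close>, so the leaf
    missing in \<open>B\<close> deepens one of its limbs.\<close>
  have "ht (Nd M) \<noteq> ht (Nd H)" using diam_vins[OF cB H M] dA B(2) by linarith
  then obtain Z' Z N where Z: "H = add_mset Z' N" "M = add_mset Z N" "ins Z' Z" "ht Z' < ht Z"
    "ht Z = ht (Nd H)" "if f then ht (Nd N) = ht (Nd H) else \<exists>Y. N = {#Y#} \<and> ht Z' = ht Y"
    using ctr_vins_deep[OF H M(1) _ ne] by metis
  show ?thesis
  proof (cases f)
    case True
    obtain Q \<tau> where q: "\<rho> = Q # \<tau>" using r(1) by (cases \<rho>) (auto simp: ctx_def)
    let ?X' = "Nd (cf (\<tau> @ [{#}]))" and ?X = "Nd (cf (\<tau> @ [{#}, {#}]))"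
    have e: "cf (\<rho> @ [{#}]) = add_mset ?X' Q" "cf (\<rho> @ [{#}, {#}]) = add_mset ?X Q"
      unfolding q by (simp_all add: cf_Cons)
    have iX: "ins ?X' ?X" using ins_cf_leaf[of "\<tau> @ [{#}]"] by simp
    have l: "Suc (length \<tau>) \<le> ht ?X'" using length_le_ht[of "\<tau> @ [{#}]"] by simp
    have h1: "ht ?X' < ht (Nd Q)" by (rule ctr_TrueD) (use G True e in simp)
    have "ht (Nd (add_mset ?X' Q)) = length \<tau> + 2" using hG unfolding e by (simp add: q)
    then have hX': "ht ?X' = Suc (length \<tau>)" and hY: "ht (Nd Q) = length \<tau> + 2"
      using l h1 unfolding ht_add by linarith+
    have hX: "ht ?X = length \<tau> + 2" using ht_cf_leaf[of "\<tau> @ [{#}]"] hX' by simp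
    have c1: "cen False {#?X, Nd Q#} (Nd {#Nd {#A1#}#})" "hctr False {#?X, Nd Q#}"
      using recen_True[of ?X Q "Nd {#Nd {#A1#}#}"] cA2 True e hX hY by simp_all
    have c2: "cen False {#Z, Nd N#} (Nd {#Nd {#A1#}#})" "hctr False {#Z, Nd N#}"
      using recen_True[of Z N "Nd {#Nd {#A1#}#}"] M(2) Z True by simp_all
    have p: "{#?X, Nd Q#} = {#Z, Nd N#}" using ht.cen_uniq[OF c1 c2] by blast
    \<comment> \<open>This is the case of centres on the same side: each tree lacks the only deepest
      leaf of the same limb, so they would be isomorphic.\<close>
    have "\<not> (?X = Z \<and> Q = N)"
    proof
      assume z: "?X = Z \<and> Q = N"
      then have "?X' = Z'" using deepen_unique[OF iX, of Z'] Z(3,4) hX hX' by simp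
      then show False using AB e Z(1) z by simp
    qed
    then have s: "?X = Nd N" "Nd Q = Z" using p unfolding pair_mset_eq by auto
    then have H': "H = add_mset Z' (ch ?X)" using Z(1) by simp
    have cB': "cen True (add_mset Z' (ch ?X)) B" "hctr True (add_mset Z' (ch ?X))" using cB H True unfolding H' by simp_all
    have cA': "cen True (add_mset ?X' Q) (Nd {#A1#})" "hctr True (add_mset ?X' Q)" using cA G e(1) True by simp_all
    have A1': "A1 = up True (Q # \<tau>)" using r(2) q True by simp
    show ?thesis
      by (rule vertex[OF A1' refl refl cA' hX' hX hY _ _ cB']) (use Z(3,4) s(2) in simp_all)
  next
    case False
    obtain Y K \<tau> where q: "\<rho> = {#Y#} # K # \<tau>"
    proof -
      have "2 \<le> length \<rho>" "size (hd \<rho>) = 1" using r(1) False by (auto simp: ctx_def)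
      then obtain Q K \<tau> where "\<rho> = Q # K # \<tau>" "size Q = 1" by (cases \<rho>; cases "tl \<rho>") auto
      moreover then obtain Y where "Q = {#Y#}" using size_1_singleton_mset by blast
      ultimately show ?thesis using that by blast
    qed
    let ?X' = "Nd (cf (\<tau> @ [{#}]))" and ?X = "Nd (cf (\<tau> @ [{#}, {#}]))"
    let ?W' = "Nd (add_mset ?X' K)" and ?W = "Nd (add_mset ?X K)"
    have e: "cf (\<rho> @ [{#}]) = {#?W', Y#}" "cf (\<rho> @ [{#}, {#}]) = {#?W, Y#}"
      unfolding q by (simp_all add: cf_Cons)
    have iX: "ins ?X' ?X" using ins_cf_leaf[of "\<tau> @ [{#}]"] by simp
    have l: "Suc (length \<tau>) \<le> ht ?X'" using length_le_ht[of "\<tau> @ [{#}]"] by simp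
    have h1: "ht ?W' = ht Y" using G False e ctr_False_iff by metis
    have "ht (Nd {#?W', Y#}) = length \<tau> + 3" using hG unfolding e by (simp add: q)
    then have hY: "ht Y = length \<tau> + 2" using h1 by (simp add: ht_add)
    then have hW': "max (Suc (ht ?X')) (ht (Nd K)) = length \<tau> + 2" using h1 unfolding ht_add by argo
    then have hX': "ht ?X' = Suc (length \<tau>)" and hK: "ht (Nd K) \<le> length \<tau> + 2" using l by linarith+
    have hX: "ht ?X = length \<tau> + 2" using ht_cf_leaf[of "\<tau> @ [{#}]"] hX' by simp
    have hW: "ht ?W = Suc (ht Y)" using hX hK hY unfolding ht_add by linarith
    have c1: "cen True (add_mset Y (add_mset ?X K)) (Nd {#Nd {#A1#}#})" "hctr True (add_mset Y (add_mset ?X K))"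
      using recen_False[of ?W Y "Nd {#Nd {#A1#}#}"] cA2 False e hW by simp_all
    obtain Y2 where Y2: "N = {#Y2#}" "ht Z' = ht Y2" using Z(6) False by auto
    have hZ: "ht Z = length \<tau> + 3" using Z(5) hH by (simp add: q)
    have "ht Z' = length \<tau> + 2" using Z(3,4) ins_ht[OF Z(3)] hZ by linarith
    then have hY2: "ht Y2 = length \<tau> + 2" and nZ': "Z' \<noteq> Lf" using Y2 by auto
    have c2: "cen True (add_mset Y2 (ch Z)) (Nd {#Nd {#A1#}#})" "hctr True (add_mset Y2 (ch Z))"
      using recen_False[of Z Y2 "Nd {#Nd {#A1#}#}"] M(2) Z(2) Y2(1) False hZ hY2 by simp_all
    obtain V V' N' where V: "Z' = Nd (add_mset V N')" "Z = Nd (add_mset V' N')" "ins V V'" "ht V < ht V'"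
      "ht (Nd N') < ht Z" "ht Z = Suc (ht V')"
      using deepen_cases[OF Z(3,4)] nZ' by metis
    have p: "add_mset Y (add_mset ?X K) = add_mset Y2 (add_mset V' N')"
      using ht.cen_uniq[OF c1 c2] V(2) by simp
    have m1: "ht Z < length \<tau> + 2" if "Z \<in># K" for Z using ht_mem[OF that] hK by linarith
    have m2: "ht W < length \<tau> + 2" if "W \<in># N'" for W using ht_mem[OF that] V(5) hZ by linarith
    have hV': "ht V' = length \<tau> + 2" using V(6) hZ by linarith
    have "(Y = Y2 \<and> ?X = V' \<or> Y = V' \<and> ?X = Y2) \<and> K = N'"
      using top_pair_uniq[OF p hY hX hY2 hV' m1 m2] .
    moreover have "\<not> (Y = Y2 \<and> ?X = V' \<and> K = N')"
    proof
      assume z: "Y = Y2 \<and> ?X = V' \<and> K = N'"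
      then have "?X' = V" using deepen_unique[OF iX, of V] V(3,4) hX hX' by simp
      then have "H = {#?W', Y#}" using Z(1) Y2(1) V(1) z by simp
      then show False using AB e by simp
    qed
    ultimately have s: "Y = V'" "?X = Y2" "K = N'" by blast+
    have "H = {#?X, Nd (add_mset V K)#}" using Z(1) Y2(1) V(1) s(2,3) by simp
    then have cB': "cen False {#?X, Nd (add_mset V K)#} B" and "hctr False {#?X, Nd (add_mset V K)#}" using cB H False by simp_all
    then have hH': "ht ?X = ht (Nd (add_mset V K))" using ctr_False_iff by blast
    have cA': "cen False {#?W', Y#} (Nd {#A1#})" using cA e(1) False by simp
    have A1': "A1 = up False ({#Y#} # K # \<tau>)" using r(2) q False by simp
    show ?thesis
      by (rule edge[OF A1' refl refl cA' h1 hX' hX hY _ _ cB' hH']) (use V(3,4) s(1) in simp_all)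
  qed
qed

section \<open>The part opposite to a deepest root\<close>

lemma spine_path:
  assumes "ins X' X" "ht X' = k" "ht X = Suc k" "nb X' = 0"
  shows "X = Nd {#X'#}" "nb X = 0"
proof -
  show n: "nb X = 0" using deepen_branching[of X' X] assms by simp
  show "X = Nd {#X'#}" by (rule path_eq[OF n]) (use assms in \<open>simp_all add: nb_add ht_add\<close>)
qed

text \<open>As \<open>Nd Q\<close> is no path, it has a leaf whose removal keeps its height, and
  \<open>good_far\<close> applies unless this turns a limb of \<open>Q\<close> into a copy of
  \<open>X'\<close>. Then a leaf of another limb of \<open>Q\<close> will do or, if there is no
  other limb, \<open>good_near\<close>. That fails only if \<open>X'\<close> is a path, which
  contradicts the inclusion of \<open>A1\<close> in \<open>B\<close>.\<close>

lemma deep_nonpath_vertex: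
  assumes A1: "A1 = up True (Q # \<tau>)" and X: "X' = Nd (cf (\<tau> @ [{#}]))" "X = Nd (cf (\<tau> @ [{#}, {#}]))"
    and cA: "cen True (add_mset X' Q) (Nd {#A1#})" "hctr True (add_mset X' Q)"
    and h: "ht X' = Suc (length \<tau>)" "ht X = length \<tau> + 2" "ht (Nd Q) = length \<tau> + 2"
    and Y': "ins Y' (Nd Q)" "ht Y' < ht (Nd Q)"
    and cB: "cen True (add_mset Y' (ch X)) B" "hctr True (add_mset Y' (ch X))"
    and i: "incl A1 B" "\<not> Nd {#A1#} \<approx> B" "diam B = diam (Nd {#A1#})" and nY: "nb (Nd Q) \<noteq> 0"
  shows "good (Nd {#A1#})"
proof -
  have iX: "ins X' X" unfolding X using ins_cf_leaf[of "\<tau> @ [{#}]"] by simp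
  have x: "ctx True (Q # \<tau>)" by (simp add: ctx_def)
  have e: "cf ((Q # \<tau>) @ [{#}]) = add_mset X' Q" by (simp add: cf_Cons X)
  have hG: "ht (Nd (cf ((Q # \<tau>) @ [{#}]))) = Suc (length (Q # \<tau>))" unfolding e using h by (simp add: ht_add)
  have hc: "hctr True (cf ((Q # \<tau>) @ [{#}]))" unfolding e by (rule cA)
  have hQ: "ht Z \<le> Suc (length \<tau>)" if "Z \<in># Q" for Z using ht_mem[OF that] h by linarith
  have far: "good (Nd {#A1#})"
    if "Q = R + E" "ad E' E" "E' \<noteq> {#X'#}" "ht (Nd (R + E')) = length \<tau> + 2" for R E E'
  proof -
    have "hctr True (add_mset X' (R + E'))"
    proof (rule ccontr)
      assume "\<not> hctr True (add_mset X' (R + E'))"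
      then obtain Z M where Z: "add_mset X' (R + E') = add_mset Z M" "ht (Nd M) \<le> ht Z" using not_ctr_TrueE by metis
      show False
      proof (cases "Z = X'")
        case True
        then have "M = R + E'" using Z(1) by simp
        then show False using Z(2) True h that(4) by simp
      next
        case False
        then obtain N where N: "M = add_mset X' N" "R + E' = add_mset Z N" using Z(1) add_mset_neqE by metis
        have "Z \<in># R + E'" using N(2) by simp
        from ht_mem[OF this] that(4) have "ht Z < length \<tau> + 2" by simp
        moreover have "length \<tau> + 2 \<le> ht (Nd M)" unfolding N ht_add using h by simp
        ultimately show False using Z(2) by simp
      qed
    qed
    then show ?thesis unfolding A1 that(1)
      using good_far[of True R E \<tau> E'] x hc hG that unfolding X(1) by simp
  qed
  obtain S where S: "ins S (Nd Q)" "ht S = length \<tau> + 2" using ins_ex_same_ht[OF nY] h by metis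
  obtain Q0 where Q0: "S = Nd Q0" by (cases S)
  obtain R E' E where E: "Q0 = R + E'" "Q = R + E" "ad E' E" using S(1) unfolding Q0 ins_ad by blast
  show ?thesis
  proof (cases "E' = {#X'#}")
    case False
    show ?thesis by (rule far[OF E(2,3) False]) (use S(2) Q0 E(1) in simp)
  next
    case True
    obtain L where L: "E = {#L#}" "ins X' L"
      using E(3) True by (cases rule: ad.cases) auto
    have hL: "ht L = Suc (length \<tau>)" using hQ[of L] E(2) L(1) ins_ht[OF L(2)] h by simp
    have Q: "Q = add_mset L R" using E(2) L(1) by simp
    have "Nd Q \<noteq> Nd {#Lf#}" using nY by (auto simp: nb_add)
    then obtain V V' N where V: "Y' = Nd (add_mset V N)" "Nd Q = Nd (add_mset V' N)" "ins V V'" "ht V < ht V'"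
      "ht (Nd N) < ht (Nd Q)" "ht (Nd Q) = Suc (ht V')"
      using deepen_cases[OF Y'] by metis
    have lt: "ht W \<le> length \<tau>" if "W \<in># N" for W using ht_mem[OF that] V(5) h by linarith
    have LR: "add_mset L R = add_mset V' N" using V(2) Q by simp
    \<comment> \<open>Some removal lowers the height of \<open>Nd Q\<close>, so only one limb of
      \<open>Q\<close> is of maximal height, and both \<open>L\<close> and \<open>V'\<close>
      are.\<close>
    have "L = V' \<and> R = N"
    proof (rule ccontr)
      assume n: "\<not> (L = V' \<and> R = N)"
      have "L \<noteq> V'" using n LR by auto
      then obtain K where "N = add_mset L K" using LR add_mset_neqE by metis
      then show False using lt[of L] hL by simp
    qed
    then have LV: "L = V'" "R = N" by blast+
    show ?thesis
    proof (cases "R = {#}")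
      case False
      then have "Nd R \<noteq> Lf" by simp
      then obtain R0 where R0: "ins (Nd R0) (Nd R)" using ins_ex by (metis rt.exhaust)
      then obtain P F' F where F: "R0 = P + F'" "R = P + F" "ad F' F" unfolding ins_ad by blast
      \<comment> \<open>The limbs in \<open>R\<close> are too low to contain a copy of
        \<open>X'\<close>.\<close>
      have ne: "F' \<noteq> {#X'#}"
      proof
        assume FX: "F' = {#X'#}"
        obtain W where W: "F = {#W#}" "ins X' W" using F(3) FX by (cases rule: ad.cases) auto
        then have "W \<in># N" using F(2) LV by simp
        from lt[OF this] ins_ht[OF W(2)] h show False by simp
      qed
      have "ht (Nd (add_mset L R0)) = length \<tau> + 2"
      proof (rule antisym)
        show "ht (Nd (add_mset L R0)) \<le> length \<tau> + 2" using ins_ht[OF ins_add[OF R0, of L]] Q h by simp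
      qed (simp add: ht_add hL)
      then show ?thesis using far[of "add_mset L P" F F'] F ne Q by simp
    next
      case True
      then have QL: "Q = {#L#}" using Q by simp
      show ?thesis
      proof (cases "nb X' = 0")
        case False
        have "lev V' (ht V' - 1) = 1"  using deepen_lev[OF V(3,4)] .
        then have "lev X' (length \<tau>) \<le> 1" using ins_lev[OF L(2), of "length \<tau>"] LV(1) hL by simp
        then have "good (Nd {#up True ({#L#} # \<tau>)#})"
          using good_near[of True L \<tau>] x hc hG ins_sz[OF L(2)] False hL unfolding QL X(1) by blast
        then show ?thesis unfolding A1 QL .
      next
        case nX: True
        have XX: "X = Nd {#X'#}" "nb X = 0" using spine_path[OF iX] h nX by simp_all
        have Y'V: "Y' = Nd {#V#}" using V(1) LV(2) True by simp
        have cB1: "cen True {#Nd {#V#}, X'#} B" "hctr True {#Nd {#V#}, X'#}"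
          using cB unfolding Y'V XX(1) by simp_all
        have nbL: "nb V = nb L" "sb V = sb L" "nb L \<noteq> 0"
          using deepen_branching[OF V(3,4)] LV(1) nY unfolding QL by (simp_all add: nb_add)
        have nt: "\<tau> \<noteq> []"
        proof
          assume "\<tau> = []"
          then have "ht L = 1" using hL by simp
          then have "L = Lf" using ht_mem[of _ "ch L"] by (cases L) (metis One_nat_def ht_pos(2) less_Suc0 multiset_nonemptyE rt.sel)
          then show False using nbL by simp
        qed
        let ?U = "Nd (cf \<tau>)"
        have iU: "ins ?U X'" using ins_cf_leaf[OF nt] X(1) by simp
        have U: "nb ?U = 0" "ht ?U = length \<tau>" using path_ins[OF iU nX] h by simp_all
        have XU: "Nd {#?U#} = X'" by (rule path_eq) (use U nX h in \<open>simp_all add: nb_add ht_add\<close>)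
        have "cen True (add_mset L {#?U#}) A1"
          using cen_up[of True "Q # \<tau>"] nt unfolding A1 QL by (simp add: cf_Cons add_mset_commute ctx_def)
        from recen_True[OF this] have c1: "cen False {#L, X'#} A1" "hctr False {#L, X'#}"
          unfolding XU using hL h by simp_all
        \<comment> \<open>The leaf that leads from \<open>A1\<close> to \<open>B\<close> lengthens
          the diameter, so it deepens one of the halves \<open>L\<close> and \<open>X'\<close> of
          \<open>A1\<close>.\<close>
        have d1: "Suc (diam A1) = 2 * (length \<tau> + 2)" using diam_eq[OF c1] hL h by (simp add: dm_def ht_add)
        have d2: "diam B = 2 * (length \<tau> + 2)" using i(3) diam_eq[OF cA] hG unfolding e by (simp add: dm_def)
        obtain M where M: "vins False {#L, X'#} M" "cen False M B" using cen_incl[OF c1(1) i(1)] by blast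
        have "ht (Nd M) \<noteq> ht (Nd {#L, X'#})" using diam_vins[OF c1 M] d1 d2 by linarith
        then obtain P P' N1 where P: "{#L, X'#} = add_mset P N1" "M = add_mset P' N1" "ins P P'" "ht P < ht P'"
          "ht P' = ht (Nd {#L, X'#})" "\<exists>Y. N1 = {#Y#} \<and> ht P = ht Y"
          using ctr_vins_deep[OF c1(2) M(1)] by (metis empty_not_add_mset)
        obtain W where W: "N1 = {#W#}" "ht P = ht W" using P(6) by blast
        have hP': "ht P' = length \<tau> + 2" using P(5) hL h by (simp add: ht_add)
        have LX: "L = P \<and> X' = W \<or> L = W \<and> X' = P" using P(1) unfolding W(1) pair_mset_eq .
        have "ht W = length \<tau> + 1" using LX hL h by auto
        then have "cen True (add_mset W (ch P')) B" "hctr True (add_mset W (ch P'))"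
          using recen_False[of P' W B] M(2) P(2) W(1) hP' by simp_all
        from ht.cen_uniq[OF this cB1] have k: "add_mset W (ch P') = {#Nd {#V#}, X'#}" by simp
        have False using LX
        proof
          assume a: "L = P \<and> X' = W"
          then have "ch P' = {#Nd {#V#}#}" using k by simp
          then have P': "P' = Nd {#Nd {#V#}#}" by (metis rt.collapse)
          \<comment> \<open>Two vertices above the root of \<open>V\<close> push its branching
            vertices down by two, so \<open>sb\<close> could not agree.\<close>
          have "nb P' = nb L \<and> sb P' = sb L" using deepen_branching[OF P(3,4)] a by simp
          then show False unfolding P' using nbL by (simp add: nb_add sb_add)
        next
          assume a: "L = W \<and> X' = P"
          have "L \<noteq> X'" using nbL nX by auto
          moreover have "L \<in># {#Nd {#V#}, X'#}" using a k by (metis union_single_eq_member)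
          ultimately have "L = Nd {#V#}" by simp
          then have "{#Nd {#V#}, X'#} = add_mset X' Q" unfolding QL by simp
          then show False using cen_imp_ueq[OF cA(1)] cB1(1) i(2) by metis
        qed
        then show ?thesis ..
      qed
    qed
  qed
qed

text \<open>At a central edge the part opposite to the root is a single half \<open>Y\<close>. So
  the only exception to \<open>good_far\<close> is that \<open>Y\<close> is the half of the root
  with an additional leaf.\<close>

lemma deep_nonpath_edge:
  assumes A1: "A1 = up False ({#Y#} # K # \<tau>)" and X: "X' = Nd (cf (\<tau> @ [{#}]))" "X = Nd (cf (\<tau> @ [{#}, {#}]))"
    and cA: "cen False {#Nd (add_mset X' K), Y#} (Nd {#A1#})" "ht (Nd (add_mset X' K)) = ht Y"
    and h: "ht X' = Suc (length \<tau>)" "ht X = length \<tau> + 2" "ht Y = length \<tau> + 2"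
    and Y': "ins Y' Y" "ht Y' < ht Y"
    and cB: "cen False {#X, Nd (add_mset Y' K)#} B" "ht X = ht (Nd (add_mset Y' K))"
    and i: "incl A1 B" "\<not> Nd {#A1#} \<approx> B" "diam B = diam (Nd {#A1#})" and nY: "nb Y \<noteq> 0"
  shows "good (Nd {#A1#})"
proof -
  let ?W = "Nd (add_mset X' K)"
  have iX: "ins X' X" unfolding X using ins_cf_leaf[of "\<tau> @ [{#}]"] by simp
  have x: "ctx False ({#Y#} # K # \<tau>)" by (simp add: ctx_def)
  have W: "?W = Nd (cf ((K # \<tau>) @ [{#}]))" by (simp add: cf_Cons X)
  have e: "cf (({#Y#} # K # \<tau>) @ [{#}]) = {#?W, Y#}" by (simp add: cf_Cons X)
  have hG: "ht (Nd (cf (({#Y#} # K # \<tau>) @ [{#}]))) = Suc (length ({#Y#} # K # \<tau>))"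
    unfolding e using h cA(2) by (simp add: ht_add[of ?W] ht_add[of Y])
  have hc: "hctr False (cf (({#Y#} # K # \<tau>) @ [{#}]))" unfolding e ctr_False_iff by (rule cA)
  obtain S where S: "ins S Y" "ht S = length \<tau> + 2" using ins_ex_same_ht[OF nY] h by metis
  show ?thesis
  proof (cases "S = ?W")
    case False
    then have "{#S#} \<noteq> {#Nd (cf ((K # \<tau>) @ [{#}]))#}" unfolding W by simp
    moreover have "hctr False (add_mset (Nd (cf ((K # \<tau>) @ [{#}]))) ({#} + {#S#}))"
      unfolding W[symmetric] using S(2) cA(2) h by (simp add: ctr_False_iff)
    moreover have "ad {#S#} {#Y#}" using S(1) by (rule ad.sub)
    ultimately have "good (Nd {#up False (({#} + {#Y#}) # K # \<tau>)#})"
      using good_far[of False "{#}" "{#Y#}" "K # \<tau>" "{#S#}"] x hc hG by simp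
    then show ?thesis unfolding A1 by simp
  next
    case SW: True
    then have iW: "ins ?W Y" using S(1) by simp
    show ?thesis
    proof (cases "nb ?W = 0")
      case False
      \<comment> \<open>\<open>Y\<close> has a unique deepest leaf, so the smaller \<open>?W\<close>
        has at most one vertex at this depth, as \<open>good_near\<close> requires.\<close>
      have "lev Y (ht Y - 1) = 1"  using deepen_lev[OF Y'] .
      then have "lev ?W (length (K # \<tau>)) \<le> 1" using ins_lev[OF iW, of "length (K # \<tau>)"] h by simp
      then show ?thesis
        using good_near[of False Y "K # \<tau>"] x hc hG ins_sz[OF iW] False h unfolding A1 W by simp
    next
      case True
      have K: "K = {#}" and nX: "nb X' = 0"
      proof -
        have "?W \<noteq> Lf" by simp
        then obtain S' where "?W = Nd {#S'#}" using nb_0_single[OF True] by blast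
        then have "add_mset X' K = {#S'#}" by simp
        then show K: "K = {#}" by (simp add: add_mset_eq_single)
        show "nb X' = 0" using True unfolding K by (simp add: nb_add)
      qed
      have XX: "X = Nd {#X'#}" "nb X = 0" using spine_path[OF iX] h nX by simp_all
      have cB1: "cen False {#X, Nd {#Y'#}#} B" "hctr False {#X, Nd {#Y'#}#}"
        using cB unfolding K ctr_False_iff by simp_all
      have cA1: "cen False {#X, Y#} (Nd {#A1#})" using cA(1) K XX(1) by simp
      have YY: "Y \<noteq> Nd {#Y'#}" using cen_imp_ueq[OF cA1] cB1(1) i(2) by metis
      let ?U = "Nd (cf ({#} # \<tau>))"
      have iU: "ins ?U X" using ins_cf_leaf[of "{#} # \<tau>"] XX(1) X(1) by (simp add: cf_Cons)
      have U: "nb ?U = 0" "ht ?U = Suc (length \<tau>)" using path_ins[OF iU XX(2)] h by simp_all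
      have "cen False {#Y, ?U#} A1"
        using cen_up[of False "{#Y#} # K # \<tau>"] x unfolding A1 K by (simp add: cf_Cons add_mset_commute)
      from recen_False[OF this] have c1: "cen True (add_mset ?U (ch Y)) A1" "hctr True (add_mset ?U (ch Y))"
        using U(2) h by simp_all
      have hY: "ht (Nd (ch Y)) = length \<tau> + 2" using h by simp
      have d1: "diam A1 = 2 * (length \<tau> + 2)" using diam_eq[OF c1] hY U(2) by (simp add: dm_def ht_add)
      have d2: "diam B = Suc (2 * (length \<tau> + 2))"
        using diam_eq[OF cB1] h cB(2) K by (simp add: dm_def ht_add[of X] ht_add[of "Nd {#Y'#}" "{#}"])
      obtain M where M: "vins True (add_mset ?U (ch Y)) M" "cen True M B" using cen_incl[OF c1(1) i(1)] by blast
      have "ht (Nd M) \<noteq> ht (Nd (add_mset ?U (ch Y)))" using diam_vins[OF c1 M] d1 d2 by linarith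
      then obtain P P' N where P: "add_mset ?U (ch Y) = add_mset P N" "M = add_mset P' N" "ins P P'" "ht P < ht P'"
        "ht P' = ht (Nd (add_mset ?U (ch Y)))" "ht (Nd N) = ht (Nd (add_mset ?U (ch Y)))"
        using ctr_vins_deep[OF c1(2) M(1)] by (metis empty_not_add_mset)
      have hP': "ht P' = length \<tau> + 2" "ht (Nd N) = length \<tau> + 2" using P(5,6) hY U(2) by (simp_all add: ht_add)
      have "cen False {#P', Nd N#} B" "hctr False {#P', Nd N#}"
        using recen_True[of P' N B] M(2) P(2) hP' by simp_all
      from ht.cen_uniq[OF this cB1] have k: "{#P', Nd N#} = {#X, Nd {#Y'#}#}" by simp
      have False
      proof (cases "P = ?U")
        case True
        have "N = ch Y" using P(1) True by simp
        then have k2: "{#P', Y#} = {#X, Nd {#Y'#}#}" using k by simp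
        have "nb P' = 0" using deepen_branching[OF P(3,4)] True U(1) by simp
        then have "P' = X" using path_eq[OF _ XX(2), of P'] hP' h by simp
        then have "Y = Nd {#Y'#}" using k2 by simp
        then show False using YY by simp
      next
        case False
        then obtain N0 where N0: "ch Y = add_mset P N0" "N = add_mset ?U N0" using P(1) add_mset_neqE by metis
        from k consider "P' = X" | "P' = Nd {#Y'#}" "Nd N = X" unfolding pair_mset_eq by blast
        then show False
        proof cases
          case 1
          then have "nb P = 0" "ht P = Suc (length \<tau>)" using path_ins[OF P(3)] XX(2) hP' by simp_all
          then have "P = ?U" using path_eq[OF _ U(1), of P] U(2) by simp
          then show False using False by simp
        next
          case 2
          then have n0: "nb (Nd N) = 0" using XX by simp
          have "Nd N \<noteq> Lf" using N0(2) by simp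
          then obtain S' where "Nd N = Nd {#S'#}" using nb_0_single[OF n0] by blast
          then have "N0 = {#}" using N0(2) by (simp add: add_mset_eq_single)
          then have YP: "Y = Nd {#P#}" using N0(1) by (metis rt.collapse)
          \<comment> \<open>As far as \<open>nb\<close> and \<open>sb\<close> can tell,
            \<open>P\<close> and \<open>Y'\<close> each arise from the other by a new vertex above
            the root. This raises \<open>sb\<close> unless nothing branches.\<close>
          have "nb (Nd {#Y'#}) = nb P \<and> sb (Nd {#Y'#}) = sb P" using deepen_branching[OF P(3,4)] 2(1) by simp
          moreover have "nb Y' = nb (Nd {#P#}) \<and> sb Y' = sb (Nd {#P#})" using deepen_branching[OF Y'] YP by simp
          ultimately have "nb P = 0" by (simp add: nb_add sb_add)
          then show False using nY YP by (simp add: nb_add)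
        qed
      qed
      then show ?thesis ..
    qed
  qed
qed

text \<open>The centre of \<open>B\<close> is the root of \<open>X\<close>, so the branching
  vertices of \<open>X\<close> are one step closer to it than in \<open>A\<close>, and the opposite
  path contributes none below the centre.\<close>

lemma deep_path_vertex:
  assumes X: "ins X' X"
    and cA: "cen True (add_mset X' Q) A" "hctr True (add_mset X' Q)"
    and h: "ht X' = Suc k" "ht X = k + 2" "ht (Nd Q) = k + 2"
    and Y': "ins Y' (Nd Q)" "ht Y' < ht (Nd Q)"
    and cB: "cen True (add_mset Y' (ch X)) B" "hctr True (add_mset Y' (ch X))"
    and i: "\<not> A \<approx> B" and nY: "nb (Nd Q) = 0"
  shows "fav A B"
proof -
  have "Nd Q \<noteq> Lf" using h(3) by auto
  then obtain Lz where Lz: "Q = {#Lz#}" "nb Lz = 0" using nb_0_single[OF nY] by blast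
  have pY: "nb Y' = 0" "ht Y' = Suc k" using path_ins[OF Y'(1) nY] h by simp_all
  have bX: "nb X' = nb X" "sb X' = sb X" using deepen_branching[OF X] h by simp_all
  obtain C where C: "X = Nd C" by (cases X)
  have nA: "nb (Nd (add_mset X' Q)) = Suc (nb X)" "sb (Nd (add_mset X' Q)) = sb X + nb X"
    using Lz nb_0_sb[OF Lz(2)] bX by (simp_all add: nb_add sb_add)
  have nB: "nb (Nd (add_mset Y' (ch X))) = nb X + (if size (ch X) = 1 then 1 else 0)" "sb (Nd (add_mset Y' (ch X))) = sb X"
    using pY nb_0_sb[OF pY(1)] C by (simp_all add: nb_add sb_add)
  have nX: "nb X \<noteq> 0"
  proof
    assume "nb X = 0"
    then have n: "nb X' = 0" using bX by simp
    have XX: "X = Nd {#X'#}" using spine_path[OF X h(1)] h(2) n by simp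
    have hL: "ht Lz = Suc k" using h(3) Lz(1) by (simp add: ht_add)
    have "Y' = X'" using path_eq[OF pY(1) n] pY(2) h(1) by simp
    moreover have "Lz = X'" using path_eq[OF Lz(2) n] hL h(1) by simp
    ultimately have "add_mset X' Q = add_mset Y' (ch X)" using XX Lz(1) by simp
    then show False using cen_imp_ueq[OF cA(1)] cB(1) i by metis
  qed
  have 1: "nb (Nd (add_mset Y' (ch X))) \<le> nb (Nd (add_mset X' Q))" unfolding nA nB by simp
  have 2: "sb (Nd (add_mset Y' (ch X))) < sb (Nd (add_mset X' Q))" unfolding nA nB using nX by simp
  show ?thesis unfolding fav_def using 1 2 cA cB by blast
qed

text \<open>In \<open>A\<close> the limb of the root hangs below the end of the central edge; in
  \<open>B\<close> it is a half of its own, so its branching vertices are one step closer to the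
  midpoint.\<close>

lemma deep_path_edge:
  assumes X: "ins X' X"
    and cA: "cen False {#Nd (add_mset X' K), Y#} A" "ht (Nd (add_mset X' K)) = ht Y"
    and h: "ht X' = Suc k" "ht X = k + 2" "ht Y = k + 2"
    and Y': "ins Y' Y" "ht Y' < ht Y"
    and cB: "cen False {#X, Nd (add_mset Y' K)#} B" "ht X = ht (Nd (add_mset Y' K))"
    and i: "\<not> A \<approx> B" and nY: "nb Y = 0"
  shows "fav A B"
proof -
  have pY: "nb Y' = 0" "ht Y' = Suc k" using path_ins[OF Y'(1) nY] h by simp_all
  have bX: "nb X' = nb X" "sb X' = sb X" using deepen_branching[OF X] h by simp_all
  note s0 = nb_0_sb[OF pY(1)] nb_0_sb[OF nY]
  have nX: "nb X \<noteq> 0"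
  proof
    assume n: "nb X = 0"
    then have n': "nb X' = 0" using bX by simp
    have "X = Y" using path_eq[OF n nY] h by simp
    moreover have "Y' = X'" using path_eq[OF pY(1) n'] pY(2) h by simp
    ultimately have "{#Nd (add_mset X' K), Y#} = {#X, Nd (add_mset Y' K)#}" by simp
    then show False using cen_imp_ueq[OF cA(1)] cB(1) i by metis
  qed
  have c: "hctr False {#Nd (add_mset X' K), Y#}" "hctr False {#X, Nd (add_mset Y' K)#}"
    unfolding ctr_False_iff by (rule cA(2), rule cB(2))
  have 1: "nb (Nd {#X, Nd (add_mset Y' K)#}) \<le> nb (Nd {#Nd (add_mset X' K), Y#})"
    using pY nY bX by (simp add: nb_add)
  have "sb (Nd {#Nd (add_mset X' K), Y#}) = sb (Nd {#X, Nd (add_mset Y' K)#}) + nb X"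
    using pY nY bX s0 by (simp add: nb_add sb_add)
  then have 2: "sb (Nd {#X, Nd (add_mset Y' K)#}) < sb (Nd {#Nd (add_mset X' K), Y#})" using nX by linarith
  show ?thesis unfolding fav_def using 1 2 cA(1) cB(1) c by blast
qed

lemma deep_good_or_fav:
  assumes "\<not> neutral A1" "A1 \<noteq> Lf" "incl B (Nd {#Nd {#A1#}#})" "diam B = diam (Nd {#A1#})"
    "\<not> Nd {#A1#} \<approx> B" "incl A1 B"
  shows "good (Nd {#A1#}) \<or> fav (Nd {#A1#}) B"
  using assms(1-5)
proof (cases rule: deep_structure)
  case (vertex Q \<tau> X' X Y')
  have iX: "ins X' X" unfolding vertex using ins_cf_leaf[of "\<tau> @ [{#}]"] by simp
  show ?thesis
  proof (cases "nb (Nd Q) = 0")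
    case True
    show ?thesis using deep_path_vertex[OF iX vertex(4-12) assms(5) True] by blast
  next
    case False
    show ?thesis using deep_nonpath_vertex[OF vertex assms(6,5,4) False] by blast
  qed
next
  case (edge Y K \<tau> X' X Y')
  have iX: "ins X' X" unfolding edge using ins_cf_leaf[of "\<tau> @ [{#}]"] by simp
  show ?thesis
  proof (cases "nb Y = 0")
    case True
    show ?thesis using deep_path_edge[OF iX edge(4-12) assms(5) True] by blast
  next
    case False
    show ?thesis using deep_nonpath_edge[OF edge assms(6,5,4) False] by blast
  qed
qed

text \<open>Neutrality of \<open>B1\<close> turns the inclusion of \<open>A\<close> in
  \<open>Nd {#B#}\<close> into one at the centre. The leaf at the root of \<open>B\<close> hangs on
  a leaf, so \<open>Nd {#B#}\<close> branches exactly as \<open>B\<close> does, and \<open>A\<close>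
  cannot branch more.\<close>

lemma fav_not_neutral:
  assumes "fav A B" "neutral B1" "B = Nd {#B1#}" "incl A (Nd {#B#})" "diam A = diam B"
  shows False
proof -
  obtain f G H where c: "cen f G A" "hctr f G" "cen f H B" "hctr f H"
    and n: "nb (Nd H) \<le> nb (Nd G)" "nb (Nd H) = nb (Nd G) \<longrightarrow> sb (Nd H) < sb (Nd G)"
    using assms(1) unfolding fav_def by blast
  obtain f' \<rho> where r: "cen f' (cf (\<rho> @ [{#}])) B" "hctr f' (cf (\<rho> @ [{#}]))"
    "cen f' (cf (\<rho> @ [{#}, {#}])) (Nd {#B#})" "hctr f' (cf (\<rho> @ [{#}, {#}]))"
    "diam B = diam B1" "diam (Nd {#B#}) = diam B1"
    using neutralE[OF assms(2)] unfolding assms(3) by metis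
  have H: "H = cf (\<rho> @ [{#}])" using ht.cen_uniq[OF c(3,4) r(1,2)] by simp
  have "diam (Nd {#B#}) = diam A" using r(5,6) assms(5) by simp
  then have "vins f G (cf (\<rho> @ [{#}, {#}]))" using incl_cenD[OF c(1,2) assms(4) _ r(3,4)] by blast
  then have "ins (Nd G) (Nd (cf (\<rho> @ [{#}, {#}])))" unfolding vins_def by blast
  from ins_branching[OF this] spine_branching[of \<rho>] n show False unfolding H by linarith
qed

section \<open>The separating edge\<close>

text \<open>
  The conditions under which \<open>T - aa\<^sub>1\<close> and \<open>T - e\<close> for a leaf edge \<open>e\<close> of \<open>A\<close>, with \<open>P\<close> the rest of \<open>A\<close>,
  reconstruct \<open>T\<close> together with \<open>T - ab\<close>. Here \<open>X\<close> and \<open>Y\<close> are the halves of a reconstruction, rooted at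
  the ends of the edge that joins them.
\<close>

definition edge_sep :: "rt \<Rightarrow> rt \<Rightarrow> bool" where
  "edge_sep A1 B \<longleftrightarrow> (\<forall>X1 Y. (Nd {#X1#} \<approx> Nd {#A1#} \<and> Y \<approx> B \<or> Nd {#X1#} \<approx> B \<and> Y \<approx> Nd {#A1#}) \<and>
     X1 \<approx> A1 \<and> Nd {#Y#} \<approx> Nd {#B#} \<longrightarrow> X1 = A1 \<and> Y = B)"

definition leaf_sep :: "rt \<Rightarrow> rt \<Rightarrow> rt \<Rightarrow> bool" where
  "leaf_sep A B P \<longleftrightarrow> ins P A \<and> (\<forall>X X' Y. (X \<approx> A \<and> Y \<approx> B \<or> X \<approx> B \<and> Y \<approx> A) \<and>
     ins X' X \<and> Nd (add_mset X' (ch Y)) \<approx> Nd (add_mset P (ch B)) \<longrightarrow> X = A \<and> Y = B)"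

text \<open>If the halves stayed in place, \<open>remove_leaf_inj\<close> would determine both ends
  of the edge. So a failure exchanges the halves, and comparing what it exchanges gives the
  inclusions.\<close>

lemma edge_sep_or_incl:
  assumes "\<not> edge_sep A1 B"
  shows "\<not> Nd {#A1#} \<approx> B" "incl A1 B" "incl (Nd {#A1#}) (Nd {#B#})"
proof -
  obtain X1 Y where c: "Nd {#X1#} \<approx> Nd {#A1#} \<and> Y \<approx> B \<or> Nd {#X1#} \<approx> B \<and> Y \<approx> Nd {#A1#}"
    and e: "X1 \<approx> A1" "Nd {#Y#} \<approx> Nd {#B#}" and n: "\<not> (X1 = A1 \<and> Y = B)"
    using assms unfolding edge_sep_def by blast
  have n1: "\<not> (Nd {#X1#} \<approx> Nd {#A1#} \<and> Y \<approx> B)" using remove_leaf_inj e n by blast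
  then have s: "Nd {#X1#} \<approx> B" "Y \<approx> Nd {#A1#}" using c by blast+
  show "\<not> Nd {#A1#} \<approx> B" using n1 s ueq_sym ueq_trans by meson
  show "incl A1 B" using incl_ueq[OF incl_Nd e(1) s(1)] .
  show "incl (Nd {#A1#}) (Nd {#B#})" using incl_ueq[OF incl_Nd s(2) e(2)] .
qed

lemma sz_ctr_join:
  assumes "sz P < sz (Nd M)" "\<And>Z. Z \<in># M \<Longrightarrow> sz Z \<le> sz P"
  shows "ctr sz True (add_mset P M)"
proof (rule ccontr)
  assume "\<not> ctr sz True (add_mset P M)"
  then obtain Z N where Z: "add_mset P M = add_mset Z N" "sz (Nd N) \<le> sz Z" using not_ctr_TrueE by metis
  show False
  proof (cases "Z = P")
    case True
    then show False using Z assms(1) by simp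
  next
    case False
    then obtain K where K: "M = add_mset Z K" "N = add_mset P K" using Z(1) add_mset_neqE by metis
    have "sz P < sz (Nd N)" by (rule sz_mem) (simp add: K)
    moreover have "sz Z \<le> sz P" by (rule assms(2)) (simp add: K)
    ultimately show False using Z(2) by simp
  qed
qed

text \<open>In the large component of \<open>T - e\<close>, one vertex short of two full halves, the
  end of the joining edge in the complete half is the unique centroid vertex. Hence that end and the
  limbs there are known.\<close>

lemma good_leaf_sep:
  assumes "good A" "sz A = sz B" "diam A = diam B" "\<not> A \<approx> B"
  shows "\<exists>P. leaf_sep A B P"
proof -
  obtain P0 where P0: "ins (Nd {#P0#}) A" "diam (Nd {#Nd {#P0#}#}) = Suc (diam A)"
    "\<And>X. ins (Nd {#P0#}) X \<Longrightarrow> X \<approx> A \<Longrightarrow> X = A"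
    using assms(1) unfolding good_def by blast
  let ?P = "Nd {#P0#}"
  have c: "ctr sz True (add_mset R (ch Y))" if "Suc (sz R) = sz Y" for R Y
  proof (rule sz_ctr_join)
    show "sz R < sz (Nd (ch Y))" using that by simp
    show "sz Z \<le> sz R" if z: "Z \<in># ch Y" for Z using sz_mem[of Z "ch Y"] z that \<open>Suc (sz R) = sz Y\<close> by simp
  qed
  have "X = A \<and> Y = B" if x: "X \<approx> A \<and> Y \<approx> B \<or> X \<approx> B \<and> Y \<approx> A" "ins X' X"
    "Nd (add_mset X' (ch Y)) \<approx> Nd (add_mset ?P (ch B))" for X X' Y
  proof -
    have s: "sz X = sz B" "sz Y = sz B" using x(1) assms(2) ueq_sz by metis+
    have sX: "Suc (sz X') = sz B" "Suc (sz ?P) = sz B" using ins_sz[OF x(2)] ins_sz[OF P0(1)] s assms(2) by simp_all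
    have k: "add_mset X' (ch Y) = add_mset ?P (ch B)"
      using sz.cen_uniq[OF cen_True c cen_True c x(3)] sX s by simp
    show ?thesis
    proof (cases "X' = ?P")
      case True
      then have "Y = B" using k by (simp add: rt.expand)
      moreover have "X \<approx> A" using x(1) \<open>Y = B\<close> assms(4) ueq_sym by blast
      then have "X = A" using P0(3) x(2) True by blast
      ultimately show ?thesis by blast
    next
      case False
      then obtain N where N: "ch Y = add_mset ?P N" "ch B = add_mset X' N" using k add_mset_neqE by metis
      have B: "B = Nd (add_mset X' N)" using N(2) by (metis rt.collapse)
      \<comment> \<open>\<open>X'\<close> is only one vertex smaller than \<open>B\<close>.\<close>
      have "N = {#}"
      proof (rule ccontr)
        assume "N \<noteq> {#}"
        then obtain W N' where "N = add_mset W N'" by (metis multiset_cases)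
        then show False using sX(1) sz_pos(1)[of W] unfolding B by simp
      qed
      then have "Y = Nd {#?P#}" using N(1) by (metis rt.collapse)
      then have "diam Y = Suc (diam A)" using P0(2) by simp
      moreover have "diam Y = diam A" using x(1) diam_ueq assms(3) by metis
      ultimately show ?thesis by simp
    qed
  qed
  then show ?thesis unfolding leaf_sep_def using P0(1) by blast
qed

text \<open>At a neutral root the diameter is already that of \<open>A1\<close>, which lies in
  \<open>B\<close>. Otherwise a further leaf at the root lengthens it, and \<open>B\<close> lacks
  only one leaf of that longer tree.\<close>

lemma diam_le_incl:
  assumes "A1 \<noteq> Lf" "incl A1 B" "incl B (Nd {#Nd {#A1#}#})"
  shows "diam (Nd {#A1#}) \<le> diam B"
proof (cases "neutral A1")
  case True
  then have "diam (Nd {#A1#}) = diam A1" using neutralE by metis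
  then show ?thesis using diam_incl[OF assms(2)] by linarith
next
  case False
  then have "diam (Nd {#Nd {#A1#}#}) = Suc (diam (Nd {#A1#}))" using deepE assms(1) by metis
  then show ?thesis using diam_incl[OF assms(3)] by linarith
qed

text \<open>Neutral roots and equal diameters keep all centres in place, so the four inclusions
  become the hypotheses of \<open>two_leaf_sandwich\<close>.\<close>

lemma neutral_ueq:
  assumes n: "neutral A1" "neutral B1" and AB: "A = Nd {#A1#}" "B = Nd {#B1#}" and d: "diam A = diam B"
    and i: "incl A1 B" "incl B (Nd {#A#})" "incl B1 A" "incl A (Nd {#B#})"
  shows "A \<approx> B"
proof -
  obtain f \<rho> where a: "ctx f \<rho>" "cen f (cf \<rho>) A1" "hctr f (cf \<rho>)" "cen f (cf (\<rho> @ [{#}])) A" "hctr f (cf (\<rho> @ [{#}]))"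
    "cen f (cf (\<rho> @ [{#}, {#}])) (Nd {#A#})" "hctr f (cf (\<rho> @ [{#}, {#}]))" "diam A = diam A1" "diam (Nd {#A#}) = diam A1"
    using neutralE[OF n(1)] unfolding AB by metis
  obtain f' \<sigma> where b: "ctx f' \<sigma>" "cen f' (cf \<sigma>) B1" "hctr f' (cf \<sigma>)" "cen f' (cf (\<sigma> @ [{#}])) B" "hctr f' (cf (\<sigma> @ [{#}]))"
    "cen f' (cf (\<sigma> @ [{#}, {#}])) (Nd {#B#})" "hctr f' (cf (\<sigma> @ [{#}, {#}]))" "diam B = diam B1" "diam (Nd {#B#}) = diam B1"
    using neutralE[OF n(2)] unfolding AB by metis
  have ds: "diam B = diam A1" "diam (Nd {#A#}) = diam B" "diam A = diam B1" "diam (Nd {#B#}) = diam A" using a(8,9) b(8,9) d by simp_all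
  have 1: "f' = f \<and> vins f (cf \<rho>) (cf (\<sigma> @ [{#}]))" using incl_cenD[OF a(2,3) i(1) ds(1) b(4,5)] .
  have 2: "vins f' (cf (\<sigma> @ [{#}])) (cf (\<rho> @ [{#}, {#}]))" using incl_cenD[OF b(4,5) i(2) ds(2) a(6,7)] by blast
  have 3: "vins f' (cf \<sigma>) (cf (\<rho> @ [{#}]))" using incl_cenD[OF b(2,3) i(3) ds(3) a(4,5)] by blast
  have 4: "vins f (cf (\<rho> @ [{#}])) (cf (\<sigma> @ [{#}, {#}]))" using incl_cenD[OF a(4,5) i(4) ds(4) b(6,7)] by blast
  have "\<rho> \<noteq> []" "\<sigma> \<noteq> []" using a(1) b(1) by (simp_all add: ctx_def)
  then have e: "cf (\<rho> @ [{#}]) = cf (\<sigma> @ [{#}])" using two_leaf_sandwich 1 2 3 4 unfolding vins_def by blast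
  have ff: "f' = f" using 1 by blast
  show ?thesis using cen_imp_ueq[OF a(4)[unfolded e]] b(4) unfolding ff by blast
qed

theorem separating_edge:
  assumes AB: "A = Nd {#A1#}" "B = Nd {#B1#}" and "sz A = sz B" and L: "A1 \<noteq> Lf" "B1 \<noteq> Lf"
  shows "edge_sep A1 B \<or> edge_sep B1 A \<or> (\<exists>P. leaf_sep A B P) \<or> (\<exists>P. leaf_sep B A P)"
proof (rule ccontr)
  assume n: "\<not> ?thesis"
  then have "\<not> edge_sep A1 B" "\<not> edge_sep B1 A" by blast+
  note a = edge_sep_or_incl[OF this(1)] and b = edge_sep_or_incl[OF this(2)]
  have i: "incl A1 B" "incl B (Nd {#A#})" "incl B1 A" "incl A (Nd {#B#})" and ne: "\<not> A \<approx> B" "\<not> B \<approx> A"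
    using a b unfolding AB by blast+
  have d: "diam A = diam B"
    using diam_le_incl[OF L(1), of B] diam_le_incl[OF L(2), of A] i AB by (simp add: antisym)
  have ng: "\<not> good A" "\<not> good B"
    using n good_leaf_sep[OF _ assms(3) d ne(1)] good_leaf_sep[OF _ assms(3)[symmetric] d[symmetric] ne(2)] by blast+
  have dA: "fav A B" if "\<not> neutral A1"
    using deep_good_or_fav[OF that L(1), of B] i d ne ng unfolding AB by metis
  have dB: "fav B A" if "\<not> neutral B1"
    using deep_good_or_fav[OF that L(2), of A] i d ne ng unfolding AB by metis
  show False
  proof (cases "neutral A1")
    case nA: True
    show False
    proof (cases "neutral B1")
      case True
      then show False using neutral_ueq[OF nA True AB d i] ne by blast
    next
      case False
      then show False using fav_not_neutral[OF dB nA AB(1) i(2)] d by simp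
    qed
  next
    case nA: False
    show False
    proof (cases "neutral B1")
      case True
      then show False using fav_not_neutral[OF dA[OF nA] True AB(2) i(4) d] by simp
    next
      case False
      then show False using fav_asym dA[OF nA] dB by blast
    qed
  qed
qed

section \<open>Shapes of tree graphs\<close>

text \<open>Links a concrete tree with root \<open>r\<close> to its term. Trees are hung onto the
  root one at a time, matching \<open>add_mset\<close> on the children.\<close>

inductive shp :: "'a set \<Rightarrow> 'a set set \<Rightarrow> 'a \<Rightarrow> rt \<Rightarrow> bool" where
  base: "shp {r} {} r Lf"
| join: "shp V E r (Nd M) \<Longrightarrow> shp V' E' s S \<Longrightarrow> V \<inter> V' = {} \<Longrightarrow>
    shp (V \<union> V') (insert {r, s} (E \<union> E')) r (Nd (add_mset S M))"

lemma shp_root: "shp V E r R \<Longrightarrow> r \<in> V"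
  by (induction rule: shp.induct) auto

lemma shp_finite: "shp V E r R \<Longrightarrow> finite V"
  by (induction rule: shp.induct) auto

lemma shp_edge: "shp V E r R \<Longrightarrow> e \<in> E \<Longrightarrow> e \<subseteq> V \<and> card e = 2"
proof (induction arbitrary: e rule: shp.induct)
  case (join V E r M V' E' s S)
  have "r \<in> V" "s \<in> V'" using join shp_root by metis+
  moreover from this have "r \<noteq> s" using join.hyps(3) by blast
  ultimately have "{r, s} \<subseteq> V \<union> V' \<and> card {r, s} = 2" by simp
  then show ?case using join.prems join.IH by blast
qed simp

lemma shp_sgraph: "shp V E r R \<Longrightarrow> sgraph (Graph V E)"
  using shp_finite shp_edge unfolding sgraph_def by fastforce

lemma shp_card: "shp V E r R \<Longrightarrow> card V = sz R"
proof (induction rule: shp.induct)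
  case (join V E r M V' E' s S)
  then show ?case using shp_finite card_Un_disjoint[of V V'] by fastforce
qed simp

lemma shp_degree: "shp V E r R \<Longrightarrow> finite {e \<in> E. r \<in> e} \<and> card {e \<in> E. r \<in> e} = size (ch R)"
proof (induction rule: shp.induct)
  case (join V E r M V' E' s S)
  have r: "r \<in> V" "s \<in> V'" "r \<notin> V'" "s \<notin> V" using join shp_root by fast+
  have "{e \<in> insert {r, s} (E \<union> E'). r \<in> e} = insert {r, s} {e \<in> E. r \<in> e}"
    using shp_edge[OF join(2)] r by blast
  moreover have "{r, s} \<notin> {e \<in> E. r \<in> e}" using shp_edge[OF join(1)] r by blast
  ultimately show ?case using join.IH by simp
qed simp

lemma shp_join_root:
  assumes "shp V E r R" "shp V' E' s S" "V \<inter> V' = {}"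
  shows "shp (V \<union> V') (insert {r, s} (E \<union> E')) r (Nd (add_mset S (ch R)))"
  using shp.join[OF _ assms(2,3), of E r "ch R"] assms(1) by simp

lemma shp_Lf:
  assumes "shp V E r Lf"
  shows "V = {r}" "E = {}"
proof -
  have "card V = 1" using shp_card[OF assms] by simp
  then show V: "V = {r}" using shp_root[OF assms] by (auto simp: card_1_singleton_iff)
  show "E = {}"
  proof (rule ccontr)
    assume "E \<noteq> {}"
    then obtain e where "e \<subseteq> {r}" "card e = 2" using shp_edge[OF assms] V by blast
    then show False using card_mono[of "{r}" e] by simp
  qed
qed

definition splits :: "'a set \<Rightarrow> 'a set set \<Rightarrow> 'a \<Rightarrow> rt \<Rightarrow> 'a set \<Rightarrow> 'a set set \<Rightarrow> rt multiset \<Rightarrow> 'a set \<Rightarrow> 'a set set \<Rightarrow> 'a \<Rightarrow> rt \<Rightarrow> bool" where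
  "splits V E r R V1 E1 M V2 E2 s S \<longleftrightarrow> shp V1 E1 r (Nd M) \<and> shp V2 E2 s S \<and> V1 \<inter> V2 = {} \<and>
     V = V1 \<union> V2 \<and> E = insert {r, s} (E1 \<union> E2) \<and> R = Nd (add_mset S M)"

lemma splits_extend:
  assumes "splits V E r (Nd M) V1 E1 M1 V2 E2 s S" "shp V' E' t U" "V \<inter> V' = {}"
  shows "splits (V \<union> V') (insert {r, t} (E \<union> E')) r (Nd (add_mset U M)) (V1 \<union> V') (insert {r, t} (E1 \<union> E')) (add_mset U M1) V2 E2 s S"
proof -
  have d: "V1 \<inter> V' = {}" "V = V1 \<union> V2" using assms unfolding splits_def by auto
  have "shp (V1 \<union> V') (insert {r, t} (E1 \<union> E')) r (Nd (add_mset U M1))"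
    using shp.join[OF _ assms(2) d(1)] assms(1) unfolding splits_def by blast
  then show ?thesis using assms d unfolding splits_def by auto
qed

lemma splits_at:
  assumes "shp V E r R" "v \<in> V" "v \<noteq> r"
  obtains V1 E1 M V2 E2 s S where "splits V E r R V1 E1 M V2 E2 s S" "v \<in> V2"
proof -
  have "\<exists>V1 E1 M V2 E2 s S. splits V E r R V1 E1 M V2 E2 s S \<and> v \<in> V2" using assms
  proof (induction rule: shp.induct)
    case (join V E r M V' E' s S)
    show ?case
    proof (cases "v \<in> V'")
      case True
      have "splits (V \<union> V') (insert {r, s} (E \<union> E')) r (Nd (add_mset S M)) V E M V' E' s S"
        using join.hyps unfolding splits_def by blast
      then show ?thesis using True by blast
    next
      case False
      then have "v \<in> V" using join.prems by blast
      then obtain V1 E1 M1 V2 E2 s1 S1 where "splits V E r (Nd M) V1 E1 M1 V2 E2 s1 S1" "v \<in> V2"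
        using join.IH(1) join.prems by blast
      then show ?thesis using splits_extend[OF _ join.hyps(2,3)] by blast
    qed
  qed simp
  then show ?thesis using that by blast
qed

lemma splits_adj:
  assumes "shp V E r R" "{r, v} \<in> E"
  obtains V1 E1 M V2 E2 S where "splits V E r R V1 E1 M V2 E2 v S"
proof -
  have v: "v \<in> V" "v \<noteq> r" using shp_edge[OF assms] by auto
  obtain V1 E1 M V2 E2 s S where s: "splits V E r R V1 E1 M V2 E2 s S" "v \<in> V2"
    using splits_at[OF assms(1) v] .
  have c: "shp V1 E1 r (Nd M)" "shp V2 E2 s S" "V1 \<inter> V2 = {}" "E = insert {r, s} (E1 \<union> E2)"
    using s(1) unfolding splits_def by blast+
  have "{r, v} \<notin> E1" using shp_edge[OF c(1), of "{r, v}"] c(3) s(2) by blast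
  moreover have "{r, v} \<notin> E2" using shp_edge[OF c(2), of "{r, v}"] c(3) shp_root[OF c(1)] by blast
  ultimately have "{r, v} = {r, s}" using assms(2) c(4) by blast
  then have "v = s" using v by (auto simp: doubleton_eq_iff)
  then show ?thesis using that s(1) by blast
qed

lemma splits_shape:
  assumes "shp V E r (Nd (add_mset S M))"
  obtains V1 E1 V2 E2 s where "splits V E r (Nd (add_mset S M)) V1 E1 M V2 E2 s S"
proof -
  have "\<exists>V1 E1 V2 E2 s. splits V E r R V1 E1 (ch R - {#S#}) V2 E2 s S" if "shp V E r R" "S \<in># ch R" for R
    using that
  proof (induction rule: shp.induct)
    case (join V E r M V' E' s S')
    show ?case
    proof (cases "S = S'")
      case True
      have "splits (V \<union> V') (insert {r, s} (E \<union> E')) r (Nd (add_mset S' M)) V E M V' E' s S'"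
        using join.hyps unfolding splits_def by blast
      then show ?thesis unfolding True rt.sel add_mset_remove_trivial by blast
    next
      case False
      then have S: "S \<in># M" using join.prems by simp
      then obtain V1 E1 V2 E2 s1 where "splits V E r (Nd M) V1 E1 (M - {#S#}) V2 E2 s1 S"
        using join.IH(1) by auto
      moreover have "add_mset S' (M - {#S#}) = ch (Nd (add_mset S' M)) - {#S#}" using False S by simp
      ultimately show ?thesis using splits_extend[OF _ join.hyps(2,3)] by metis
    qed
  qed simp
  from this[OF assms] show ?thesis using that by auto
qed

lemma splits_flip:
  assumes "splits V E r R V1 E1 M V2 E2 s S"
  shows "shp V E s (Nd (add_mset (Nd M) (ch S)))" "rstep R (Nd (add_mset (Nd M) (ch S)))"
proof -
  have c: "shp V1 E1 r (Nd M)" "shp V2 E2 s S" "V2 \<inter> V1 = {}" "V = V2 \<union> V1" "E = insert {s, r} (E2 \<union> E1)" "R = Nd (add_mset S M)"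
    using assms unfolding splits_def by blast+
  show "shp V E s (Nd (add_mset (Nd M) (ch S)))" using shp_join_root[OF c(2,1,3)] c by simp
  show "rstep R (Nd (add_mset (Nd M) (ch S)))" unfolding c(6) by (rule rstep)
qed

lemma shp_rstep: "shp V E r R \<Longrightarrow> rstep R S \<Longrightarrow> \<exists>s. shp V E s S"
  by (metis rstep.cases splits_shape splits_flip(1))

lemma shp_ueq:
  assumes "shp V E r R" "R \<approx> S"
  shows "\<exists>s. shp V E s S"
  using assms(2,1)
proof (induction arbitrary: r rule: converse_rtranclp_induct)
  case (step R R')
  obtain s where "shp V E s R'" using shp_rstep[OF step.prems step.hyps(1)] by blast
  then show ?case by (rule step.IH)
qed blast

lemma shp_reach: "shp V E r R \<Longrightarrow> v \<in> V \<Longrightarrow> (r, v) \<in> {(x, y). {x, y} \<in> E}\<^sup>*"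
proof (induction arbitrary: v rule: shp.induct)
  case (join V E r M V' E' s S)
  let ?R = "{(x, y). {x, y} \<in> insert {r, s} (E \<union> E')}"
  show ?case
  proof (cases "v \<in> V")
    case True
    have "{(x, y). {x, y} \<in> E}\<^sup>* \<subseteq> ?R\<^sup>*" by (rule rtrancl_mono) blast
    then show ?thesis using join.IH(1)[OF True] by blast
  next
    case False
    have "{(x, y). {x, y} \<in> E'}\<^sup>* \<subseteq> ?R\<^sup>*" by (rule rtrancl_mono) blast
    moreover have "(s, v) \<in> {(x, y). {x, y} \<in> E'}\<^sup>*" using join.IH(2) join.prems False by blast
    moreover have "(r, s) \<in> ?R" by blast
    ultimately show ?thesis by (meson converse_rtrancl_into_rtrancl subsetD)
  qed
qed simp

lemma reroot:
  assumes "shp V E r R" "v \<in> V"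
  shows "\<exists>S. shp V E v S \<and> R \<approx> S"
  using shp_reach[OF assms]
proof (induction rule: rtrancl_induct)
  case base
  show ?case using assms(1) by blast
next
  case (step y z)
  then obtain S where S: "shp V E y S" "R \<approx> S" by blast
  have "{y, z} \<in> E" using step.hyps by blast
  then obtain V1 E1 M V2 E2 U where u: "splits V E y S V1 E1 M V2 E2 z U" using splits_adj[OF S(1)] by metis
  then show ?case using splits_flip[OF u] S(2) by (meson rtranclp.rtrancl_into_rtrancl)
qed

lemma shp_path:
  "shp V E r R \<Longrightarrow> v \<in> V \<Longrightarrow> \<exists>p. p \<noteq> [] \<and> distinct p \<and> hd p = r \<and> last p = v \<and> set p \<subseteq> V \<and> successively (\<lambda>x y. {x, y} \<in> E) p"
proof (induction arbitrary: v rule: shp.induct)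
  case (base r)
  then show ?case by (intro exI[of _ "[r]"]) simp
next
  case (join V E r M V' E' s S)
  show ?case
  proof (cases "v \<in> V")
    case True
    then obtain p where "p \<noteq> [] \<and> distinct p \<and> hd p = r \<and> last p = v \<and> set p \<subseteq> V \<and> successively (\<lambda>x y. {x, y} \<in> E) p"
      using join.IH(1) by blast
    then show ?thesis by (intro exI[of _ p]) (auto elim: successively_mono)
  next
    case False
    then obtain p where p: "p \<noteq> [] \<and> distinct p \<and> hd p = s \<and> last p = v \<and> set p \<subseteq> V' \<and> successively (\<lambda>x y. {x, y} \<in> E') p"
      using join.IH(2) join.prems by blast
    have "r \<notin> set p" using p shp_root[OF join.hyps(1)] join.hyps(3) by blast
    moreover have "successively (\<lambda>x y. {x, y} \<in> insert {r, s} (E \<union> E')) p"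
      using p by (auto elim: successively_mono)
    ultimately show ?thesis using p shp_root[OF join.hyps(1)]
      by (intro exI[of _ "r # p"]) (auto simp: successively_Cons)
  qed
qed

lemma shp_closed:
  assumes "shp U K u R" "K \<subseteq> E" "\<And>e. e \<in> E \<Longrightarrow> e \<inter> W \<noteq> {} \<Longrightarrow> e \<subseteq> W" "U \<inter> W \<noteq> {}"
  shows "U \<subseteq> W"
proof
  obtain w where w: "w \<in> U" "w \<in> W" using assms(4) by blast
  fix v assume v: "v \<in> U"
  obtain S where S: "shp U K w S" using reroot[OF assms(1) w(1)] by blast
  show "v \<in> W" using shp_reach[OF S v]
  proof (induction rule: rtrancl_induct)
    case (step y z)
    then have "{y, z} \<in> E" "{y, z} \<inter> W \<noteq> {}" using assms(2) by auto
    then show ?case using assms(3) by blast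
  qed (rule w)
qed

lemma shp_image:
  "shp V E r R \<Longrightarrow> inj_on f V \<Longrightarrow> shp (f ` V) ((`) f ` E) (f r) R"
proof (induction rule: shp.induct)
  case (join V E r M V' E' s S)
  have d: "f ` V \<inter> f ` V' = {}" using join.prems join.hyps(3) unfolding inj_on_def by blast
  have i: "inj_on f V" "inj_on f V'" using join.prems by (auto intro: inj_on_subset)
  have "shp (f ` V \<union> f ` V') (insert {f r, f s} ((`) f ` E \<union> (`) f ` E')) (f r) (Nd (add_mset S M))"
    using shp.join[OF join.IH(1)[OF i(1)] join.IH(2)[OF i(2)] d] .
  then show ?case by (simp add: image_Un)
qed (simp add: shp.base)

text \<open>Every piece is connected and no edge leaves it, so pieces that meet coincide.\<close>

lemma two_pieces_eq:
  assumes "shp U1 K1 u1 R1" "shp U2 K2 u2 R2" "U1 \<inter> U2 = {}"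
    and "shp W1 F1 w1 S1" "shp W2 F2 w2 S2" "W1 \<inter> W2 = {}"
    and V: "U1 \<union> U2 = W1 \<union> W2" and E: "K1 \<union> K2 = F1 \<union> F2"
  shows "U1 = W1 \<and> K1 = F1 \<and> U2 = W2 \<and> K2 = F2 \<or> U1 = W2 \<and> K1 = F2 \<and> U2 = W1 \<and> K2 = F1"
proof -
  have cl: "e \<subseteq> X1" if "shp X1 L1 x1 Q1" "shp X2 L2 x2 Q2" "X1 \<inter> X2 = {}" "e \<in> L1 \<union> L2" "e \<inter> X1 \<noteq> {}"
    for X1 X2 :: "'a set" and L1 L2 x1 x2 Q1 Q2 e
    using shp_edge[OF that(1)] shp_edge[OF that(2)] that(3-5) by blast
  have K: "L1 = {e \<in> L1 \<union> L2. e \<subseteq> X1}" if "shp X1 L1 x1 Q1" "shp X2 L2 x2 Q2" "X1 \<inter> X2 = {}"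
    for X1 X2 :: "'a set" and L1 L2 x1 x2 Q1 Q2
  proof -
    have "\<not> e \<subseteq> X1" if "e \<in> L2" for e using shp_edge[OF \<open>shp X2 L2 x2 Q2\<close> that] \<open>X1 \<inter> X2 = {}\<close>
      by (metis Int_absorb1 card.empty inf.absorb_iff2 inf_mono subset_empty zero_neq_numeral order_refl)
    then show ?thesis using shp_edge[OF that(1)] by blast
  qed
  have one: "X1 = Y1 \<and> L1 = P1 \<and> X2 = Y2 \<and> L2 = P2"
    if x: "shp X1 L1 x1 Q1" "shp X2 L2 x2 Q2" "X1 \<inter> X2 = {}" and y: "shp Y1 P1 y1 T1" "shp Y2 P2 y2 T2" "Y1 \<inter> Y2 = {}"
      and v: "X1 \<union> X2 = Y1 \<union> Y2" and e: "L1 \<union> L2 = P1 \<union> P2" and w: "X1 \<inter> Y1 \<noteq> {}"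
    for X1 X2 Y1 Y2 :: "'a set" and L1 L2 P1 P2 x1 x2 y1 y2 Q1 Q2 T1 T2
  proof -
    have "X1 \<subseteq> Y1" by (rule shp_closed[OF x(1), of "P1 \<union> P2"]) (use e w cl[OF y] in blast)+
    moreover have "Y1 \<subseteq> X1" by (rule shp_closed[OF y(1), of "L1 \<union> L2"]) (use e w cl[OF x] in blast)+
    ultimately have 1: "X1 = Y1" "X2 = Y2" using v x(3) y(3) by blast+
    have "X2 \<inter> X1 = {}" "Y2 \<inter> Y1 = {}" using x(3) y(3) by blast+
    note k = K[OF x] K[OF y] K[OF x(2,1) this(1)] K[OF y(2,1) this(2)]
    have e': "L2 \<union> L1 = P2 \<union> P1" using e by blast
    have "L1 = P1" using k(1) unfolding 1 e using k(2) by argo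
    moreover have "L2 = P2" using k(3) unfolding 1 e' using k(4) by argo
    ultimately show ?thesis using 1 by blast
  qed
  show ?thesis
  proof (cases "U1 \<inter> W1 = {}")
    case False
    then show ?thesis using one[OF assms(1-6) V E] by blast
  next
    case True
    have "W2 \<inter> W1 = {}" using assms(6) by blast
    moreover have "U1 \<inter> W2 \<noteq> {}" using True V shp_root[OF assms(1)] by blast
    ultimately show ?thesis using one[OF assms(1-3) assms(5,4)] V E by (simp add: Un_commute)
  qed
qed

lemma shp_unique:
  assumes "shp V E r R" "shp V E r R'"
  shows "R = R'"
  using assms
proof (induction "card V" arbitrary: V E r R R' rule: less_induct)
  case less
  obtain M where M: "R = Nd M" by (cases R)
  show ?case
  proof (cases "M = {#}")
    case True
    then have "card V = 1" using shp_card[OF less.prems(1)] M by simp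
    then have "sz R' = 1" using shp_card[OF less.prems(2)] by simp
    then show ?thesis using sz_eq_1 M True by simp
  next
    case False
    then obtain S N where N: "M = add_mset S N" by (metis multiset_cases)
    obtain V1 E1 V2 E2 s where s: "splits V E r R V1 E1 N V2 E2 s S"
      using splits_shape less.prems(1) unfolding M N by metis
    then have c: "shp V1 E1 r (Nd N)" "shp V2 E2 s S" "V1 \<inter> V2 = {}" "V = V1 \<union> V2" "E = insert {r, s} (E1 \<union> E2)"
      "R = Nd (add_mset S N)"
      unfolding splits_def by blast+
    have "{r, s} \<in> E" using c(5) by blast
    then obtain V1' E1' N' V2' E2' S' where "splits V E r R' V1' E1' N' V2' E2' s S'"
      using splits_adj[OF less.prems(2)] by metis
    then have c': "shp V1' E1' r (Nd N')" "shp V2' E2' s S'" "V1' \<inter> V2' = {}" "V = V1' \<union> V2'" "E = insert {r, s} (E1' \<union> E2')"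
      "R' = Nd (add_mset S' N')"
      unfolding splits_def by blast+
    have n: "{r, s} \<notin> X1 \<union> X2" if "shp Y1 X1 r A1" "shp Y2 X2 s A2" "Y1 \<inter> Y2 = {}" for X1 X2 Y1 Y2 A1 A2
      using shp_edge[OF that(1), of "{r, s}"] shp_edge[OF that(2), of "{r, s}"] shp_root[OF that(1)] shp_root[OF that(2)] that(3) by blast
    have "insert {r, s} (E1 \<union> E2) = insert {r, s} (E1' \<union> E2')" using c(5) c'(5) by argo
    then have E12: "E1 \<union> E2 = E1' \<union> E2'" using insert_ident[OF n[OF c(1-3)] n[OF c'(1-3)]] by blast
    have V12: "V1 \<union> V2 = V1' \<union> V2'" using c(4) c'(4) by argo
    have p: "V1 = V1' \<and> E1 = E1' \<and> V2 = V2' \<and> E2 = E2' \<or> V1 = V2' \<and> E1 = E2' \<and> V2 = V1' \<and> E2 = E1'"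
      using two_pieces_eq[OF c(1-3) c'(1-3) V12 E12] .
    have "V1 \<noteq> V2'" using shp_root[OF c(1)] shp_root[OF c'(1)] c'(3) by blast
    then have e: "V1 = V1'" "E1 = E1'" "V2 = V2'" "E2 = E2'" using p by blast+
    have "V1 \<subset> V" "V2 \<subset> V" using c(3,4) shp_root[OF c(1)] shp_root[OF c(2)] by blast+
    then have "card V1 < card V" "card V2 < card V" using shp_finite[OF less.prems(1)] psubset_card_mono by blast+
    note l = this
    have "Nd N = Nd N'" using less.hyps[OF l(1) c(1)] c'(1) unfolding e .
    moreover have "S = S'" using less.hyps[OF l(2) c(2)] c'(2) unfolding e .
    ultimately show ?thesis using c(6) c'(6) by simp
  qed
qed

lemma shp_ueqI: "shp V E r R \<Longrightarrow> shp V E s S \<Longrightarrow> R \<approx> S"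
  using reroot shp_unique shp_root by metis

lemma shp_iso:
  assumes "shp V E r R" "shp V' E' r' R"
  shows "\<exists>f. inj_on f V \<and> f ` V = V' \<and> (`) f ` E = E' \<and> f r = r'"
  using assms
proof (induction arbitrary: V' E' r' rule: shp.induct)
  case (base r)
  show ?case using shp_Lf[OF base] by (intro exI[of _ "\<lambda>_. r'"]) simp
next
  case (join V E r M W F s S)
  obtain V1 E1 V2 E2 t where "splits V' E' r' (Nd (add_mset S M)) V1 E1 M V2 E2 t S"
    using splits_shape[OF join.prems] .
  then have c: "shp V1 E1 r' (Nd M)" "shp V2 E2 t S" "V1 \<inter> V2 = {}" "V' = V1 \<union> V2" "E' = insert {r', t} (E1 \<union> E2)"
    unfolding splits_def by blast+
  obtain f g where f: "inj_on f V" "f ` V = V1" "(`) f ` E = E1" "f r = r'"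
    and g: "inj_on g W" "g ` W = V2" "(`) g ` F = E2" "g s = t" using join.IH c by metis
  let ?h = "\<lambda>x. if x \<in> V then f x else g x"
  have hf: "?h ` X = f ` X" if "X \<subseteq> V" for X using that by auto
  have hg: "?h ` X = g ` X" if "X \<subseteq> W" for X using that join.hyps(3) by (intro image_cong) auto
  have hW: "?h x = g x" if "x \<in> W" for x using that join.hyps(3) by auto
  have "inj_on ?h V" using f(1) inj_on_cong[of V ?h f] by simp
  moreover have "inj_on ?h W" using g(1) inj_on_cong[of W ?h g] hW by blast
  moreover have "?h ` V = V1" "?h ` W = V2" using hf[of V] hg[of W] f(2) g(2) by auto
  ultimately have 1: "inj_on ?h (V \<union> W)" unfolding inj_on_Un using c(3) by blast
  have 2: "?h ` (V \<union> W) = V'" unfolding image_Un using hf[of V] hg[of W] f g c by simp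
  have "(`) ?h ` E = (`) f ` E"
    by (rule image_cong[OF refl]) (use hf shp_edge[OF join.hyps(1)] in presburger)
  moreover have "(`) ?h ` F = (`) g ` F"
    by (rule image_cong[OF refl]) (use hg shp_edge[OF join.hyps(2)] in presburger)
  moreover have rs: "?h r = r'" "?h s = t" using shp_root[OF join.hyps(1)] shp_root[OF join.hyps(2)] f g join.hyps(3) by auto
  ultimately have 3: "(`) ?h ` insert {r, s} (E \<union> F) = E'"
    unfolding image_insert image_Un using f(3) g(3) c(5) rs by (simp only: image_insert image_empty)
  show ?case using 1 2 3 rs(1) by (intro exI[of _ ?h] conjI)
qed

section \<open>Reconstruction from two edge-cards\<close>

lemma graph_iso_sym: "G \<simeq> H \<Longrightarrow> H \<simeq> G"
proof -
  assume "G \<simeq> H"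
  then obtain f where f: "bij_betw f (verts G) (verts H)"
    "\<And>u v. u \<in> verts G \<Longrightarrow> v \<in> verts G \<Longrightarrow> {u, v} \<in> edges G \<longleftrightarrow> {f u, f v} \<in> edges H"
    unfolding iso_def by blast
  let ?g = "inv_into (verts G) f"
  have g: "?g u \<in> verts G" "f (?g u) = u" if "u \<in> verts H" for u
    using that f(1) bij_betw_inv_into_right bij_betw_imp_surj_on inv_into_into by metis+
  have "{u, v} \<in> edges H \<longleftrightarrow> {?g u, ?g v} \<in> edges G" if "u \<in> verts H" "v \<in> verts H" for u v
    using f(2)[OF g(1)[OF that(1)] g(1)[OF that(2)]] g(2)[OF that(1)] g(2)[OF that(2)] by simp
  then show "H \<simeq> G" unfolding iso_def using bij_betw_inv_into[OF f(1)] by blast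
qed

lemma iso_imageI:
  assumes "inj_on f V" "\<And>e. e \<in> E \<Longrightarrow> e \<subseteq> V"
  shows "Graph V E \<simeq> Graph (f ` V) ((`) f ` E)"
proof -
  have "{u, v} \<in> E" if uv: "u \<in> V" "v \<in> V" "{f u, f v} \<in> (`) f ` E" for u v
  proof -
    obtain e where e: "e \<in> E" "{f u, f v} = f ` e" using uv(3) by auto
    have "f ` {u, v} = f ` e" using e(2) by simp
    then have "{u, v} = e" using inj_on_image_eq_iff[OF assms(1), of "{u, v}" e] uv assms(2)[OF e(1)] by simp
    then show ?thesis using e(1) by simp
  qed
  moreover have "{f u, f v} \<in> (`) f ` E" if "{u, v} \<in> E" for u v using that by (metis image_eqI image_insert image_empty)
  ultimately show ?thesis unfolding iso_def using assms(1)
    by (intro exI[of _ f]) (auto simp: bij_betw_def)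
qed

lemma iso_imageE:
  assumes "G \<simeq> H" "sgraph G" "sgraph H"
  obtains f where "inj_on f (verts G)" "verts H = f ` verts G" "edges H = (`) f ` edges G"
proof -
  obtain f where f: "bij_betw f (verts G) (verts H)"
    "\<And>u v. u \<in> verts G \<Longrightarrow> v \<in> verts G \<Longrightarrow> {u, v} \<in> edges G \<longleftrightarrow> {f u, f v} \<in> edges H"
    using assms(1) unfolding iso_def by blast
  have v: "verts H = f ` verts G" using f(1) by (simp add: bij_betw_def)
  have "edges H = (`) f ` edges G"
  proof
    show "edges H \<subseteq> (`) f ` edges G"
    proof
      fix e assume e: "e \<in> edges H"
      then have "e \<subseteq> verts H" "card e = 2" using assms(3) unfolding sgraph_def by blast+
      then obtain p q where pq: "e = {p, q}" "{p, q} \<subseteq> f ` verts G" unfolding v card_2_iff by metis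
      then obtain u w where w: "p = f u" "u \<in> verts G" "q = f w" "w \<in> verts G" by blast
      have u: "e = f ` {u, w}" "u \<in> verts G" "w \<in> verts G" using pq w by simp_all
      then have "{u, w} \<in> edges G" using f(2) e by simp
      then show "e \<in> (`) f ` edges G" using u(1) by blast
    qed
    show "(`) f ` edges G \<subseteq> edges H"
    proof
      fix e assume "e \<in> (`) f ` edges G"
      then obtain d where d: "d \<in> edges G" "e = f ` d" by blast
      then have "d \<subseteq> verts G" "card d = 2" using assms(2) unfolding sgraph_def by blast+
      then obtain p q where "d = {p, q}" "p \<in> verts G" "q \<in> verts G" unfolding card_2_iff by (metis insert_subset)
      then show "e \<in> edges H" using d f(2) by simp
    qed
  qed
  then show ?thesis using that f(1) v by (simp add: bij_betw_def)
qed

lemma shp_isoI: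
  assumes "shp V E r R" "shp V' E' r' R'" "R \<approx> R'"
  shows "Graph V E \<simeq> Graph V' E'"
proof -
  obtain s where s: "shp V E s R'" using shp_ueq[OF assms(1,3)] by blast
  then obtain f where "inj_on f V" "f ` V = V'" "(`) f ` E = E'" using shp_iso[OF s assms(2)] by blast
  then show ?thesis using iso_imageI[of f V E] shp_edge[OF assms(1)] by blast
qed

lemma shp_disjoint_edges:
  assumes "shp V E r R" "shp V' E' s S" "V \<inter> V' = {}"
  shows "E \<inter> E' = {}"
proof (rule ccontr)
  assume "E \<inter> E' \<noteq> {}"
  then obtain e where "e \<in> E" "e \<in> E'" by blast
  then have "e \<subseteq> V" "card e = 2" "e \<subseteq> V'" using shp_edge assms by metis+
  then have "e = {}" "card e = 2" using assms(3) by blast+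
  then show False by simp
qed

text \<open>The two implications record the cases on which the second edge-card depends: a leaf is
  cut off, or the root itself is left alone.\<close>

definition cut :: "'a set \<Rightarrow> 'a set set \<Rightarrow> 'a \<Rightarrow> rt \<Rightarrow> 'a set \<Rightarrow> 'a set \<Rightarrow> 'a set set \<Rightarrow> rt \<Rightarrow> 'a set \<Rightarrow> 'a set set \<Rightarrow> 'a \<Rightarrow> rt \<Rightarrow> bool" where
  "cut V E r R e V1 E1 R1 V2 E2 s R2 \<longleftrightarrow> V = V1 \<union> V2 \<and> V1 \<inter> V2 = {} \<and> E - {e} = E1 \<union> E2 \<and>
     shp V1 E1 r R1 \<and> shp V2 E2 s R2 \<and> (sz R2 = 1 \<longrightarrow> ins R1 R) \<and> (sz R1 = 1 \<longrightarrow> R = Nd {#R2#})"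

lemma cut_ex: "shp V E r R \<Longrightarrow> e \<in> E \<Longrightarrow> \<exists>V1 E1 R1 V2 E2 s R2. cut V E r R e V1 E1 R1 V2 E2 s R2"
proof (induction rule: shp.induct)
  case (join V E r M V' E' s S)
  have rs: "r \<in> V" "s \<in> V'" using shp_root join.hyps by fast+
  have n: "e' \<noteq> {r, s}" "e' \<notin> E'" if "e' \<in> E" for e'
    using shp_edge[OF join.hyps(1) that] shp_disjoint_edges[OF join.hyps] that rs join.hyps(3) by auto
  have n': "e' \<noteq> {r, s}" if "e' \<in> E'" for e' using shp_edge[OF join.hyps(2) that] rs join.hyps(3) by auto
  consider (new) "e = {r, s}" | (left) "e \<in> E" | (right) "e \<in> E'" using join.prems by blast
  then show ?case
  proof cases
    case new
    have "insert {r, s} (E \<union> E') - {e} = E \<union> E'" using n n' new by blast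
    moreover have "ins (Nd M) (Nd (add_mset S M))" if "sz S = 1" using that ins.root unfolding sz_eq_1 by blast
    moreover have "M = {#}" if "sz (Nd M) = 1" using that unfolding sz_eq_1 by simp
    ultimately have "cut (V \<union> V') (insert {r, s} (E \<union> E')) r (Nd (add_mset S M)) e V E (Nd M) V' E' s S"
      unfolding cut_def using join.hyps by blast
    then show ?thesis by blast
  next
    case left
    then obtain V1 E1 R1 V2 E2 t R2 where "cut V E r (Nd M) e V1 E1 R1 V2 E2 t R2" using join.IH(1) by blast
    then have c: "V = V1 \<union> V2" "V1 \<inter> V2 = {}" "E - {e} = E1 \<union> E2" "shp V1 E1 r R1" "shp V2 E2 t R2"
      "sz R2 = 1 \<longrightarrow> ins R1 (Nd M)" unfolding cut_def by blast+
    have d: "V1 \<inter> V' = {}" using c(1) join.hyps(3) by blast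
    have s: "shp (V1 \<union> V') (insert {r, s} (E1 \<union> E')) r (Nd (add_mset S (ch R1)))"
      using shp_join_root[OF c(4) join.hyps(2) d] .
    have "insert {r, s} (E \<union> E') - {e} = insert {r, s} ((E - {e}) \<union> E')" using n[OF left] by blast
    then have "insert {r, s} (E \<union> E') - {e} = insert {r, s} (E1 \<union> E') \<union> E2" unfolding c(3) by blast
    moreover have "V \<union> V' = (V1 \<union> V') \<union> V2" "(V1 \<union> V') \<inter> V2 = {}" using c(1,2) join.hyps(3) by blast+
    moreover have "ins (Nd (add_mset S (ch R1))) (Nd (add_mset S M))" if "sz R2 = 1"
      using ins_add[of "ch R1" M] c(6) that by simp
    moreover have "sz (Nd (add_mset S (ch R1))) \<noteq> 1" unfolding sz_eq_1 by simp
    ultimately have "cut (V \<union> V') (insert {r, s} (E \<union> E')) r (Nd (add_mset S M)) e (V1 \<union> V') (insert {r, s} (E1 \<union> E')) (Nd (add_mset S (ch R1))) V2 E2 t R2"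
      unfolding cut_def using s c(5) by blast
    then show ?thesis by blast
  next
    case right
    then obtain V1 E1 R1 V2 E2 t R2 where "cut V' E' s S e V1 E1 R1 V2 E2 t R2" using join.IH(2) by blast
    then have c: "V' = V1 \<union> V2" "V1 \<inter> V2 = {}" "E' - {e} = E1 \<union> E2" "shp V1 E1 s R1" "shp V2 E2 t R2"
      "sz R2 = 1 \<longrightarrow> ins R1 S" unfolding cut_def by blast+
    have d: "V \<inter> V1 = {}" using c(1) join.hyps(3) by blast
    have s: "shp (V \<union> V1) (insert {r, s} (E \<union> E1)) r (Nd (add_mset R1 M))"
      using shp.join[OF join.hyps(1) c(4) d] .
    have "insert {r, s} (E \<union> E') - {e} = insert {r, s} (E \<union> (E' - {e}))" using n n'[OF right] right by blast
    then have "insert {r, s} (E \<union> E') - {e} = insert {r, s} (E \<union> E1) \<union> E2" unfolding c(3) by blast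
    moreover have "V \<union> V' = (V \<union> V1) \<union> V2" "(V \<union> V1) \<inter> V2 = {}" using c(1,2) join.hyps(3) by blast+
    moreover have "ins (Nd (add_mset R1 M)) (Nd (add_mset S M))" if "sz R2 = 1"
      using ins.sub c(6) that by blast
    moreover have "sz (Nd (add_mset R1 M)) \<noteq> 1" unfolding sz_eq_1 by simp
    ultimately have "cut (V \<union> V') (insert {r, s} (E \<union> E')) r (Nd (add_mset S M)) e (V \<union> V1) (insert {r, s} (E \<union> E1)) (Nd (add_mset R1 M)) V2 E2 t R2"
      unfolding cut_def using s c(5) by blast
    then show ?thesis by blast
  qed
qed simp

lemma pieces_sgraph:
  assumes "shp V1 E1 r R" "shp V2 E2 s S"
  shows "sgraph (Graph (V1 \<union> V2) (E1 \<union> E2))"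
  using shp_finite[OF assms(1)] shp_finite[OF assms(2)] shp_edge[OF assms(1)] shp_edge[OF assms(2)]
  unfolding sgraph_def by fastforce

lemma pieces_transport:
  assumes "G \<simeq> Graph (V1 \<union> V2) (E1 \<union> E2)" "sgraph G" "shp V1 E1 r R" "shp V2 E2 s S" "V1 \<inter> V2 = {}"
  obtains W1 F1 r' W2 F2 s' where "shp W1 F1 r' R" "shp W2 F2 s' S" "W1 \<inter> W2 = {}" "verts G = W1 \<union> W2" "edges G = F1 \<union> F2"
proof -
  obtain f where f: "inj_on f (V1 \<union> V2)" "verts G = f ` (V1 \<union> V2)" "edges G = (`) f ` (E1 \<union> E2)"
    using iso_imageE[OF graph_iso_sym[OF assms(1)] pieces_sgraph[OF assms(3,4)] assms(2)] by auto
  have i: "inj_on f V1" "inj_on f V2" using f(1) by (auto intro: inj_on_subset)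
  have "f ` V1 \<inter> f ` V2 = {}" using f(1) assms(5) unfolding inj_on_def by blast
  then show ?thesis using that[OF shp_image[OF assms(3) i(1)] shp_image[OF assms(4) i(2)]] f(2,3) by (simp add: image_Un)
qed

lemma sgraph_del_edge: "sgraph G \<Longrightarrow> sgraph (del_edge G e)"
  unfolding sgraph_def del_edge_def by simp

text \<open>Reduces reconstruction to terms: \<open>key\<close> has to show that the two components
  of the second card, given up to isomorphism, determine the rooted halves \<open>X\<close> and
  \<open>Y\<close> of any competitor.\<close>

lemma reconstructs_pair:
  assumes A: "shp V1 E1 a A" and B: "shp V2 E2 b B" and V: "V1 \<inter> V2 = {}" and AB: "sz A = sz B"
    and T: "T = Graph (V1 \<union> V2) (insert {a, b} (E1 \<union> E2))"
    and R: "shp U1 K1 u1 R1" "shp U2 K2 u2 R2" "U1 \<inter> U2 = {}" "V1 \<union> V2 = U1 \<union> U2"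
      "insert {a, b} (E1 \<union> E2) - {e} = K1 \<union> K2" "sz A < sz R1"
    and key: "\<And>X Xa Xb Y. X \<approx> A \<and> Y \<approx> B \<or> X \<approx> B \<and> Y \<approx> A \<Longrightarrow> sz Xb = 1 \<longrightarrow> ins Xa X \<Longrightarrow>
      sz Xa = 1 \<longrightarrow> X = Nd {#Xb#} \<Longrightarrow> sz X = sz Xa + sz Xb \<Longrightarrow> Xb \<approx> R2 \<Longrightarrow>
      Nd (add_mset Xa (ch Y)) \<approx> R1 \<Longrightarrow> X = A \<and> Y = B"
  shows "reconstructs T [{a, b}, e]"
  unfolding reconstructs_def
proof (intro allI impI)
  fix H :: "nat graph" and fs
  assume H: "sgraph H \<and> distinct fs \<and> set fs \<subseteq> edges H \<and> length fs = length [{a, b}, e] \<and>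
    (\<forall>i<length [{a, b}, e]. del_edge H (fs ! i) \<simeq> del_edge T ([{a, b}, e] ! i))"
  then obtain f1 f2 where fs: "fs = [f1, f2]" by (auto simp: numeral_2_eq_2 length_Suc_conv)
  have f: "f1 \<noteq> f2" "f1 \<in> edges H" "f2 \<in> edges H" using H fs by auto
  have sH: "sgraph H" using H by blast
  have h: "del_edge H f1 \<simeq> del_edge T {a, b}" "del_edge H f2 \<simeq> del_edge T e" using H unfolding fs by force+
  have ab: "a \<in> V1" "b \<in> V2" using shp_root A B by fast+
  have "{a, b} \<notin> E1 \<union> E2" using shp_edge[OF A, of "{a, b}"] shp_edge[OF B, of "{a, b}"] ab V by blast
  then have d1: "del_edge T {a, b} = Graph (V1 \<union> V2) (E1 \<union> E2)" unfolding T del_edge_def by simp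
  have d2: "del_edge T e = Graph (U1 \<union> U2) (K1 \<union> K2)" using R(4,5) unfolding T del_edge_def by simp
  obtain W1 F1 a' W2 F2 b' where W0: "shp W1 F1 a' A" "shp W2 F2 b' B" "W1 \<inter> W2 = {}"
    "verts (del_edge H f1) = W1 \<union> W2" "edges (del_edge H f1) = F1 \<union> F2"
    by (rule pieces_transport[OF h(1)[unfolded d1] sgraph_del_edge[OF sH] A B V])
  note W = W0[unfolded del_edge_def graph.sel]
  obtain Z1 L1 z1 Z2 L2 z2 where Z0: "shp Z1 L1 z1 R1" "shp Z2 L2 z2 R2" "Z1 \<inter> Z2 = {}"
    "verts (del_edge H f2) = Z1 \<union> Z2" "edges (del_edge H f2) = L1 \<union> L2"
    by (rule pieces_transport[OF h(2)[unfolded d2] sgraph_del_edge[OF sH] R(1-3)])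
  note Z = Z0[unfolded del_edge_def graph.sel]
  have f1: "f1 \<subseteq> W1 \<union> W2" "card f1 = 2" using sH f(2) W(4) unfolding sgraph_def by auto
  \<comment> \<open>If \<open>f1\<close> lay inside one piece, no component of \<open>H\<close>
    would have more than \<open>sz A\<close> vertices, which is too few for
    \<open>Z1\<close>.\<close>
  have cross: False if "f1 \<subseteq> W1 \<or> f1 \<subseteq> W2"
  proof -
    have ed: "e' \<subseteq> W1 \<or> e' \<subseteq> W2" if "e' \<in> edges H" for e'
    proof (cases "e' = f1")
      case True
      then show ?thesis using \<open>f1 \<subseteq> W1 \<or> f1 \<subseteq> W2\<close> by simp
    next
      case False
      then have "e' \<in> F1 \<union> F2" using that unfolding W(5)[symmetric] by simp
      then show ?thesis using shp_edge[OF W(1), of e'] shp_edge[OF W(2), of e'] by blast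
    qed
    have L: "L1 \<subseteq> edges H" using Z(5) by blast
    have 1: "Z1 \<subseteq> W1" if "Z1 \<inter> W1 \<noteq> {}"
      by (rule shp_closed[OF Z(1) L]) (use that ed W(3) in blast)+
    have 2: "Z1 \<subseteq> W2" if "Z1 \<inter> W2 \<noteq> {}"
      by (rule shp_closed[OF Z(1) L]) (use that ed W(3) in blast)+
    have "Z1 \<subseteq> W1 \<or> Z1 \<subseteq> W2" using 1 2 Z(4) W(4) shp_root[OF Z(1)] by blast
    then have "card Z1 \<le> card W1 \<or> card Z1 \<le> card W2" using card_mono shp_finite W(1,2) by metis
    then show False using shp_card[OF Z(1)] shp_card[OF W(1)] shp_card[OF W(2)] AB R(6) by simp
  qed
  then obtain x y where xy: "x \<in> W1" "y \<in> W2" "f1 = {x, y}"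
  proof -
    obtain p q where "f1 = {p, q}" using f1(2) card_2_iff by metis
    then show ?thesis using cross f1(1) that[of p q] that[of q p] by (auto simp: insert_commute)
  qed
  have eH: "edges H = insert {x, y} (F1 \<union> F2)" using W(5) f(2) xy(3) by blast
  \<comment> \<open>Here \<open>X\<close> is the half that contains \<open>f2\<close>. It may be a
    copy of \<open>A\<close> or of \<open>B\<close>, whence the disjunction.\<close>
  have main: "H \<simeq> T" if w: "shp W F x X" "shp W' F' y Y" "W \<inter> W' = {}" and vH: "verts H = W \<union> W'" and
    eH: "edges H = insert {x, y} (F \<union> F')" "f2 \<in> F" and u: "X \<approx> A \<and> Y \<approx> B \<or> X \<approx> B \<and> Y \<approx> A"
    for W F x X W' F' y Y
  proof -
    obtain Wa Fa Xa Wb Fb z Xb where "cut W F x X f2 Wa Fa Xa Wb Fb z Xb" using cut_ex[OF w(1) eH(2)] by metis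
    then have c: "W = Wa \<union> Wb" "Wa \<inter> Wb = {}" "F - {f2} = Fa \<union> Fb" "shp Wa Fa x Xa" "shp Wb Fb z Xb"
      "sz Xb = 1 \<longrightarrow> ins Xa X" "sz Xa = 1 \<longrightarrow> X = Nd {#Xb#}" unfolding cut_def by blast+
    have d: "W' \<inter> Wa = {}" "(W' \<union> Wa) \<inter> Wb = {}" "verts H = (W' \<union> Wa) \<union> Wb" using w(3) c(1,2) vH by blast+
    have P: "shp (W' \<union> Wa) (insert {y, x} (F' \<union> Fa)) y (Nd (add_mset Xa (ch Y)))" using shp_join_root[OF w(2) c(4) d(1)] .
    have "f2 \<noteq> {x, y}" "f2 \<notin> F'"
      using shp_edge[OF w(1) eH(2)] shp_disjoint_edges[OF w(1-3)] eH(2) shp_root[OF w(2)] w(3) by auto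
    then have "edges H - {f2} = insert {y, x} (F' \<union> (F - {f2}))" unfolding eH(1) by (auto simp: insert_commute)
    then have E: "insert {y, x} (F' \<union> Fa) \<union> Fb = L1 \<union> L2" unfolding c(3) Z(5) by blast
    have sX: "sz X = sz A" "sz Y = sz B" using u AB ueq_sz by metis+
    have sc: "sz X = sz Xa + sz Xb"
      using shp_card[OF w(1)] shp_card[OF c(4)] shp_card[OF c(5)] c(1,2) card_Un_disjoint shp_finite[OF c(4)] shp_finite[OF c(5)] by metis
    have "(W' \<union> Wa) \<union> Wb = Z1 \<union> Z2" using d(3) Z(4) by simp
    from two_pieces_eq[OF P c(5) d(2) Z(1-3) this E]
    have XY: "X = A \<and> Y = B"
    proof
      assume p: "W' \<union> Wa = Z1 \<and> insert {y, x} (F' \<union> Fa) = L1 \<and> Wb = Z2 \<and> Fb = L2"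
      then have "shp Z1 L1 y (Nd (add_mset Xa (ch Y)))" "shp Z2 L2 z Xb" using P c(5) by simp_all
      then have "Nd (add_mset Xa (ch Y)) \<approx> R1" "Xb \<approx> R2" using shp_ueqI Z(1,2) by metis+
      then show ?thesis using key[OF u c(6,7) sc] by blast
    next
      assume p: "W' \<union> Wa = Z2 \<and> insert {y, x} (F' \<union> Fa) = L2 \<and> Wb = Z1 \<and> Fb = L1"
      \<comment> \<open>\<open>Xb\<close> is a part of one half and cannot be the large
        component.\<close>
      then have "sz Xb = sz R1" using shp_card[OF c(5)] shp_card[OF Z(1)] by simp
      then show ?thesis using sc sX R(6) by simp
    qed
    have ds: "W' \<inter> W = {}" "V2 \<inter> V1 = {}" using w(3) V by blast+
    have s: "shp (W' \<union> W) (insert {y, x} (F' \<union> F)) y (Nd (add_mset X (ch Y)))"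
      "shp (V2 \<union> V1) (insert {b, a} (E2 \<union> E1)) b (Nd (add_mset A (ch B)))"
      by (rule shp_join_root[OF w(2,1) ds(1)], rule shp_join_root[OF B A ds(2)])
    have "H = Graph (W' \<union> W) (insert {y, x} (F' \<union> F))" using vH eH(1) by (cases H) (auto simp: insert_commute)
    moreover have "T = Graph (V2 \<union> V1) (insert {b, a} (E2 \<union> E1))" unfolding T by (auto simp: insert_commute)
    ultimately show "H \<simeq> T" using shp_isoI[OF s] XY by simp
  qed
  obtain X where X: "shp W1 F1 x X" "A \<approx> X" using reroot[OF W(1) xy(1)] by blast
  obtain Y where Y: "shp W2 F2 y Y" "B \<approx> Y" using reroot[OF W(2) xy(2)] by blast
  have "f2 \<in> F1 \<union> F2" using f W(5) by blast
  then show "H \<simeq> T"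
  proof
    assume "f2 \<in> F1"
    then show ?thesis using main[OF X(1) Y(1) W(3,4) eH] X(2) Y(2) ueq_sym by blast
  next
    assume f2: "f2 \<in> F2"
    have "W2 \<inter> W1 = {}" "verts H = W2 \<union> W1" "edges H = insert {y, x} (F2 \<union> F1)" using W(3,4) eH by (auto simp: insert_commute)
    then show ?thesis using main[OF Y(1) X(1) _ _ _ f2] X(2) Y(2) ueq_sym by blast
  qed
qed

lemma edge_sep_reconstructs:
  assumes A: "shp V1 E1 a (Nd {#A1#})" and B: "shp V2 E2 b B" and V: "V1 \<inter> V2 = {}" and AB: "Suc (sz A1) = sz B"
    and T: "T = Graph (V1 \<union> V2) (insert {a, b} (E1 \<union> E2))" and sep: "edge_sep A1 B"
  shows "\<exists>e\<in>E1. reconstructs T [{a, b}, e]"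
proof -
  obtain W1 F1 W2 F2 s where "splits V1 E1 a (Nd {#A1#}) W1 F1 {#} W2 F2 s A1" using splits_shape A by metis
  then have c: "shp W1 F1 a Lf" "shp W2 F2 s A1" "W1 \<inter> W2 = {}" "V1 = W1 \<union> W2" "E1 = insert {a, s} (F1 \<union> F2)"
    unfolding splits_def by blast+
  have rt: "a \<in> W1" "s \<in> W2" "b \<in> V2" using shp_root c(1,2) B by fast+
  have d: "W1 \<inter> V2 = {}" "W2 \<inter> V2 = {}" "(W1 \<union> V2) \<inter> W2 = {}" using c(3,4) V by blast+
  have n: "{a, s} \<notin> F1 \<union> F2 \<union> E2" "{a, s} \<noteq> {a, b}"
    using shp_edge[OF c(1), of "{a, s}"] shp_edge[OF c(2), of "{a, s}"] shp_edge[OF B, of "{a, s}"] rt c(3) d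
    by (auto simp: doubleton_eq_iff)
  have R1: "shp (W1 \<union> V2) (insert {a, b} (F1 \<union> E2)) a (Nd {#B#})"
    using shp_join_root[OF c(1) B d(1)] by simp
  have "reconstructs T [{a, b}, {a, s}]"
  proof (rule reconstructs_pair[OF A B V _ T R1 c(2) d(3)])
    show "sz (Nd {#A1#}) = sz B" "sz (Nd {#A1#}) < sz (Nd {#B#})" using AB by simp_all
    show "V1 \<union> V2 = W1 \<union> V2 \<union> W2" using c(4) by blast
    show "insert {a, b} (E1 \<union> E2) - {{a, s}} = insert {a, b} (F1 \<union> E2) \<union> F2" using n unfolding c(5) by blast
    fix X Xa Xb Y
    assume u: "X \<approx> Nd {#A1#} \<and> Y \<approx> B \<or> X \<approx> B \<and> Y \<approx> Nd {#A1#}" and 1: "sz Xa = 1 \<longrightarrow> X = Nd {#Xb#}"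
      and sx: "sz X = sz Xa + sz Xb" and x: "Xb \<approx> A1" "Nd (add_mset Xa (ch Y)) \<approx> Nd {#B#}"
    have "sz X = sz (Nd {#A1#})" using u AB ueq_sz by (metis \<open>sz (Nd {#A1#}) = sz B\<close>)
    \<comment> \<open>The small component takes all vertices of \<open>X\<close> but one, so
      \<open>f2\<close> isolates the end \<open>x\<close> within its half.\<close>
    then have a1: "sz Xa = 1" using sx ueq_sz[OF x(1)] by simp
    then have XX: "X = Nd {#Xb#}" using 1 by blast
    have "Nd {#Y#} \<approx> Nd {#B#}"
      using x(2) a1 leaf_ueq[of Y] ueq_sym ueq_trans unfolding sz_eq_1 by metis
    then have "Xb = A1 \<and> Y = B" using sep u x(1) unfolding XX edge_sep_def by blast
    then show "X = Nd {#A1#} \<and> Y = B" using XX by simp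
  qed
  then show ?thesis using c(5) by blast
qed

lemma shp_ins:
  assumes "ins P A" "shp V E a A"
  shows "\<exists>V0 E0 v e. shp V0 E0 a P \<and> v \<notin> V0 \<and> V = insert v V0 \<and> e \<notin> E0 \<and> E = insert e E0"
  using assms
proof (induction arbitrary: V E a rule: ins.induct)
  case (root M)
  obtain W1 F1 W2 F2 s where "splits V E a (Nd (add_mset Lf M)) W1 F1 M W2 F2 s Lf" using splits_shape root by metis
  then have c: "shp W1 F1 a (Nd M)" "shp W2 F2 s Lf" "W1 \<inter> W2 = {}" "V = W1 \<union> W2" "E = insert {a, s} (F1 \<union> F2)"
    unfolding splits_def by blast+
  note W2 = shp_Lf(1)[OF c(2)]
  have "F2 = {}" by (rule shp_Lf(2)[OF c(2)])
  moreover have "{a, s} \<notin> F1" using shp_edge[OF c(1), of "{a, s}"] c(3) W2 by blast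
  moreover have "s \<notin> W1" using c(3) W2 by blast
  ultimately show ?case using c W2 by (intro exI[of _ W1] exI[of _ F1] exI[of _ s] exI[of _ "{a, s}"]) simp
next
  case (sub X X' M)
  obtain W1 F1 W2 F2 s where "splits V E a (Nd (add_mset X' M)) W1 F1 M W2 F2 s X'" using splits_shape sub.prems by metis
  then have c: "shp W1 F1 a (Nd M)" "shp W2 F2 s X'" "W1 \<inter> W2 = {}" "V = W1 \<union> W2" "E = insert {a, s} (F1 \<union> F2)"
    unfolding splits_def by blast+
  obtain V0 E0 v e where v: "shp V0 E0 s X" "v \<notin> V0" "W2 = insert v V0" "e \<notin> E0" "F2 = insert e E0"
    using sub.IH[OF c(2)] by blast
  have d: "W1 \<inter> V0 = {}" "v \<notin> W1" using c(3) v(3) by blast+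
  have "e \<in> F2" using v(5) by blast
  then have "e \<noteq> {a, s}" "e \<notin> F1" using shp_edge[OF c(2)] shp_disjoint_edges[OF c(1-3)] shp_root[OF c(1)] c(3) by blast+
  then have "e \<notin> insert {a, s} (F1 \<union> E0)" using v(4) by blast
  moreover have "shp (W1 \<union> V0) (insert {a, s} (F1 \<union> E0)) a (Nd (add_mset X M))" using shp.join[OF c(1) v(1) d(1)] .
  moreover have "V = insert v (W1 \<union> V0)" "v \<notin> W1 \<union> V0" "E = insert e (insert {a, s} (F1 \<union> E0))" using c(4,5) v d by blast+
  ultimately show ?case by blast
qed

lemma leaf_sep_reconstructs:
  assumes A: "shp V1 E1 a A" and B: "shp V2 E2 b B" and V: "V1 \<inter> V2 = {}" and AB: "sz A = sz B"
    and T: "T = Graph (V1 \<union> V2) (insert {a, b} (E1 \<union> E2))" and sep: "leaf_sep A B P"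
  shows "\<exists>e\<in>E1. reconstructs T [{a, b}, e]"
proof -
  have P: "ins P A" using sep unfolding leaf_sep_def by blast
  obtain V0 E0 v e where v: "shp V0 E0 a P" "v \<notin> V0" "V1 = insert v V0" "e \<notin> E0" "E1 = insert e E0"
    using shp_ins[OF P A] by blast
  have d: "V2 \<inter> V0 = {}" "(V2 \<union> V0) \<inter> {v} = {}" using V v(2,3) by blast+
  have e: "e \<in> E1" using v(5) by blast
  have "e \<noteq> {a, b}" "e \<notin> E2" using shp_edge[OF A e] shp_disjoint_edges[OF A B V] e shp_root[OF B] V by blast+
  have R1: "shp (V2 \<union> V0) (insert {b, a} (E2 \<union> E0)) b (Nd (add_mset P (ch B)))"
    using shp_join_root[OF B v(1) d(1)] .
  have "reconstructs T [{a, b}, e]"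
  proof (rule reconstructs_pair[OF A B V AB T R1 shp.base[of v] d(2)])
    show "V1 \<union> V2 = V2 \<union> V0 \<union> {v}" using v(3) by blast
    have "{a, b} = {b, a}" by blast
    then show "insert {a, b} (E1 \<union> E2) - {e} = insert {b, a} (E2 \<union> E0) \<union> {}"
      using \<open>e \<noteq> {a, b}\<close> \<open>e \<notin> E2\<close> v(4) unfolding v(5) by blast
    have "sz (Nd (add_mset P (ch B))) = sz P + sz B" by (cases B) simp
    then show "sz A < sz (Nd (add_mset P (ch B)))" using AB sz_pos(1)[of P] by linarith
    fix X Xa Xb Y
    assume u: "X \<approx> A \<and> Y \<approx> B \<or> X \<approx> B \<and> Y \<approx> A" "sz Xb = 1 \<longrightarrow> ins Xa X" and
      x: "Xb \<approx> Lf" "Nd (add_mset Xa (ch Y)) \<approx> Nd (add_mset P (ch B))"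
    have "sz Xb = 1" using ueq_sz[OF x(1)] by simp
    then show "X = A \<and> Y = B" using sep u x(2) unfolding leaf_sep_def by blast
  qed
  then show ?thesis using e by blast
qed

section \<open>From graphs to shapes\<close>

lemma reach_closed:
  assumes "(u, v) \<in> {(x, y). {x, y} \<in> E}\<^sup>*" "u \<in> W" "\<And>e. e \<in> E \<Longrightarrow> e \<inter> W \<noteq> {} \<Longrightarrow> e \<subseteq> W"
  shows "v \<in> W"
  using assms(1)
proof (induction rule: rtrancl_induct)
  case (step y z)
  then have "{y, z} \<in> E" "{y, z} \<inter> W \<noteq> {}" by auto
  then show ?case using assms(3) by blast
qed (rule assms(2))

text \<open>A largest subtree through \<open>a\<close> that has a shape spans \<open>T\<close> by
  connectedness, and an edge missing in it would close a cycle.\<close>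

lemma tree_shp:
  assumes "tree T" "a \<in> verts T"
  shows "\<exists>R. shp (verts T) (edges T) a R"
proof -
  have sg: "finite (verts T)" "\<And>e. e \<in> edges T \<Longrightarrow> e \<subseteq> verts T \<and> card e = 2"
    and co: "\<And>u v. u \<in> verts T \<Longrightarrow> v \<in> verts T \<Longrightarrow> reachable T u v"
    and cy: "\<And>c. \<not> is_cycle T c"
    using assms(1) unfolding tree_def sgraph_def connected_def by blast+
  define P where "P V \<longleftrightarrow> V \<subseteq> verts T \<and> (\<exists>E R. shp V E a R \<and> E \<subseteq> edges T)" for V
  have "shp {a} {} a Lf" by (rule shp.base)
  then have "P {a}" unfolding P_def using assms(2) by blast
  moreover have "\<forall>V. P V \<longrightarrow> card V < Suc (card (verts T))"
    using card_mono[OF sg(1)] unfolding P_def by (simp add: less_Suc_eq_le)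
  ultimately have "\<exists>V. P V \<and> (\<forall>V'. P V' \<longrightarrow> card V' \<le> card V)" by (rule ex_has_greatest_nat)
  then obtain V where V: "P V" "\<And>V'. P V' \<Longrightarrow> card V' \<le> card V" by blast
  have VT: "V \<subseteq> verts T" using V(1) unfolding P_def by blast
  obtain E R where E: "shp V E a R" "E \<subseteq> edges T" using V(1) unfolding P_def by blast
  have VT: "V = verts T"
  proof (rule ccontr)
    assume "V \<noteq> verts T"
    then obtain v where v: "v \<in> verts T" "v \<notin> V" using VT by blast
    have "\<exists>e\<in>edges T. e \<inter> V \<noteq> {} \<and> \<not> e \<subseteq> V"
      using reach_closed[of a v "edges T" V] co[OF assms(2) v(1)] shp_root[OF E(1)] v(2) unfolding reachable_def by blast
    then obtain e x y where e: "e \<in> edges T" "x \<in> e" "y \<in> e" "x \<in> V" "y \<notin> V" by blast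
    then have exy: "e = {x, y}" using sg(2)[OF e(1)] unfolding card_2_iff by blast
    obtain S where S: "shp V E x S" using reroot[OF E(1) e(4)] by blast
    have d: "V \<inter> {y} = {}" using e(5) by blast
    obtain S' where S': "shp (V \<union> {y}) (insert {x, y} (E \<union> {})) a S'"
      using reroot[OF shp_join_root[OF S shp.base d]] shp_root[OF E(1)] by blast
    have "insert {x, y} (E \<union> {}) \<subseteq> edges T" using e(1) exy E(2) by simp
    moreover have "V \<union> {y} \<subseteq> verts T" using VT e(3) sg(2)[OF e(1)] by blast
    ultimately have "P (V \<union> {y})" using S' unfolding P_def by blast
    from V(2)[OF this] show False using e(5) shp_finite[OF E(1)] by simp
  qed
  have "E = edges T"
  proof (rule ccontr)
    assume "E \<noteq> edges T"
    then obtain e where e: "e \<in> edges T" "e \<notin> E" using E(2) by blast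
    then obtain x y where xy: "e = {x, y}" "x \<noteq> y" using sg(2) card_2_iff by metis
    have "x \<in> V" "y \<in> V" using sg(2)[OF e(1)] xy(1) VT by simp_all
    then obtain S where S: "shp V E x S" using reroot[OF E(1)] by blast
    obtain p where p: "p \<noteq> []" "distinct p" "hd p = x" "last p = y" "successively (\<lambda>x y. {x, y} \<in> E) p"
      using shp_path[OF S \<open>y \<in> V\<close>] by blast
    obtain q where q: "p = x # q" using p(1,3) by (cases p) auto
    have "q \<noteq> []" using p(4) xy(2) q by auto
    then obtain z q' where q': "q = z # q'" by (cases q) auto
    have "q' \<noteq> []" using p(4,5) e(2) xy(1) q q' by auto
    then have "3 \<le> length p" using q q' by (cases q') auto
    moreover have "successively (\<lambda>x y. {x, y} \<in> edges T) p" using p(5) by (rule successively_mono) (use E(2) in blast)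
    moreover have "{last p, hd p} \<in> edges T" using p(3,4) e(1) xy(1) by (simp add: insert_commute)
    ultimately have "is_cycle T p" unfolding is_cycle_def using p(2) by blast
    then show False using cy by blast
  qed
  then show ?thesis using E(1) VT by blast
qed

lemma shp_connected:
  assumes "shp V E r R" "u \<in> V" "v \<in> V" "E \<subseteq> E'"
  shows "(u, v) \<in> {(x, y). {x, y} \<in> E'}\<^sup>*"
proof -
  obtain S where "shp V E u S" using reroot[OF assms(1,2)] by blast
  from shp_reach[OF this assms(3)] have "(u, v) \<in> {(x, y). {x, y} \<in> E}\<^sup>*" .
  moreover have "{(x, y). {x, y} \<in> E}\<^sup>* \<subseteq> {(x, y). {x, y} \<in> E'}\<^sup>*" using assms(4) by (intro rtrancl_mono) blast
  ultimately show ?thesis by blast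
qed

lemma component_piece:
  assumes A: "shp V1 E1 a A" and B: "shp V2 E2 b B" and V: "V1 \<inter> V2 = {}"
    and G: "G \<in> components (Graph (V1 \<union> V2) (E1 \<union> E2))" "a \<in> verts G"
  shows "G = Graph V1 E1"
proof -
  let ?g = "Graph (V1 \<union> V2) (E1 \<union> E2)"
  obtain v where v: "v \<in> V1 \<union> V2" "G = induced ?g {u \<in> V1 \<union> V2. reachable ?g v u}"
    using G(1) unfolding components_def by auto
  have va: "reachable ?g v a" using G(2) unfolding v(2) induced_def by simp
  have cl: "e \<subseteq> V1 \<or> e \<subseteq> V2" if "e \<in> E1 \<union> E2" for e using that shp_edge[OF A] shp_edge[OF B] by blast
  have cl1: "e \<subseteq> V1" if "e \<in> E1 \<union> E2" "e \<inter> V1 \<noteq> {}" for e using cl[OF that(1)] that(2) V by blast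
  have cl2: "e \<subseteq> V2" if "e \<in> E1 \<union> E2" "e \<inter> V2 \<noteq> {}" for e using cl[OF that(1)] that(2) V by blast
  have "v \<notin> V2"
  proof
    assume "v \<in> V2"
    from reach_closed[OF va[unfolded reachable_def graph.sel] this cl2] show False using shp_root[OF A] V by blast
  qed
  then have v1: "v \<in> V1" using v(1) by blast
  have "{u \<in> V1 \<union> V2. reachable ?g v u} = V1"
  proof
    show "{u \<in> V1 \<union> V2. reachable ?g v u} \<subseteq> V1"
      using reach_closed[OF _ v1 cl1] unfolding reachable_def graph.sel by blast
    show "V1 \<subseteq> {u \<in> V1 \<union> V2. reachable ?g v u}"
      using shp_connected[OF A v1, of _ "E1 \<union> E2"] unfolding reachable_def graph.sel by blast
  qed
  moreover have "\<not> e \<subseteq> V1" if "e \<in> E2" for e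
  proof
    assume "e \<subseteq> V1"
    then have "e = {}" "card e = 2" using shp_edge[OF B that] V by blast+
    then show False by simp
  qed
  then have "{e \<in> E1 \<union> E2. e \<subseteq> V1} = E1" using shp_edge[OF A] by blast
  ultimately show ?thesis unfolding v(2) induced_def by (simp add: Int_absorb1)
qed

section \<open>Centroids\<close>

lemma verts_del_vert: "verts (del_vert (Graph V E) c) = V - {c}"
  and edges_del_vert: "edges (del_vert (Graph V E) c) = {e \<in> E. e \<subseteq> V - {c}}"
  unfolding del_vert_def induced_def by auto

lemma weight_le:
  assumes s: "shp V E c (Nd M)" and k: "\<And>S. S \<in># M \<Longrightarrow> sz S \<le> k" and ne: "V \<noteq> {c}"
  shows "weight (Graph V E) c \<le> k"
proof -
  let ?D = "del_vert (Graph V E) c"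
  obtain w where w: "w \<in> V - {c}" using ne shp_root[OF s] by blast
  have fin: "finite (components ?D)"
    using shp_finite[OF s] unfolding components_def by (simp add: verts_del_vert setcompr_eq_image)
  have "card (verts C) \<le> k" if C: "C \<in> components ?D" for C
  proof -
    obtain v where v: "v \<in> V - {c}" "C = induced ?D {u \<in> V - {c}. reachable ?D v u}"
      using C unfolding components_def verts_del_vert by blast
    obtain V1 E1 N V2 E2 t S where "splits V E c (Nd M) V1 E1 N V2 E2 t S" and v2: "v \<in> V2"
      using splits_at[OF s, of v] v(1) by blast
    then have d: "shp V1 E1 c (Nd N)" "shp V2 E2 t S" "V1 \<inter> V2 = {}" "V = V1 \<union> V2" "E = insert {c, t} (E1 \<union> E2)"
      "M = add_mset S N" unfolding splits_def by auto
    have cl: "e \<subseteq> V2" if e: "e \<in> {e \<in> E. e \<subseteq> V - {c}}" "e \<inter> V2 \<noteq> {}" for e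
    proof -
      have "e \<in> E1 \<or> e \<in> E2" using e(1) d(5) by blast
      then show ?thesis using shp_edge[OF d(1), of e] shp_edge[OF d(2), of e] e(2) d(3) by blast
    qed
    have "u \<in> V2" if "reachable ?D v u" for u
      using reach_closed[OF that[unfolded reachable_def edges_del_vert] v2 cl] .
    then have "verts C \<subseteq> V2" unfolding v(2) induced_def by auto
    then have "card (verts C) \<le> sz S" using card_mono[OF shp_finite[OF d(2)]] shp_card[OF d(2)] by metis
    also have "\<dots> \<le> k" using k d(6) by simp
    finally show ?thesis .
  qed
  moreover have "components ?D \<noteq> {}" using w unfolding components_def verts_del_vert by blast
  ultimately show ?thesis unfolding weight_def using fin by simp
qed

lemma weight_ge:
  assumes s: "shp U K u R" and "U \<subseteq> V - {c}" "K \<subseteq> E" "finite V"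
  shows "sz R \<le> weight (Graph V E) c"
proof -
  let ?D = "del_vert (Graph V E) c"
  let ?C = "induced ?D {w \<in> verts ?D. reachable ?D u w}"
  have u: "u \<in> U" using shp_root[OF s] .
  have fin: "finite (components ?D)"
    using assms(4) unfolding components_def by (simp add: verts_del_vert setcompr_eq_image)
  have "K \<subseteq> {e \<in> E. e \<subseteq> V - {c}}" using shp_edge[OF s] assms(2,3) by blast
  then have "reachable ?D u w" if "w \<in> U" for w
    using shp_connected[OF s u that] unfolding reachable_def edges_del_vert by blast
  then have "U \<subseteq> verts ?C" using assms(2) unfolding induced_def by (auto simp: verts_del_vert)
  moreover have "finite (verts ?C)" using assms(4) unfolding induced_def by (simp add: verts_del_vert)
  ultimately have "sz R \<le> card (verts ?C)" using card_mono shp_card[OF s] by metis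
  also have "\<dots> \<le> weight (Graph V E) c" unfolding weight_def
  proof (rule Max_ge)
    have "u \<in> verts ?D" using u assms(2) by (auto simp: verts_del_vert)
    then show "card (verts ?C) \<in> (\<lambda>C. card (verts C)) ` components ?D" unfolding components_def by blast
  qed (use fin in simp)
  finally show ?thesis .
qed

text \<open>Seen from any other vertex, the limb containing \<open>c\<close> has more than half of
  the vertices.\<close>

lemma centroid_unique:
  assumes s: "shp V E c (Nd M)" and M: "\<And>S. S \<in># M \<Longrightarrow> 2 * sz S < card V" and u: "u \<in> centroid (Graph V E)"
  shows "u = c"
proof (rule ccontr)
  assume n: "u \<noteq> c"
  have uV: "u \<in> V" and le: "weight (Graph V E) u \<le> weight (Graph V E) c"
    using u shp_root[OF s] unfolding centroid_def by auto
  obtain V1 E1 N V2 E2 t S where "splits V E c (Nd M) V1 E1 N V2 E2 t S" and u2: "u \<in> V2"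
    using splits_at[OF s uV n] by blast
  then have d: "shp V1 E1 c (Nd N)" "shp V2 E2 t S" "V1 \<inter> V2 = {}" "V = V1 \<union> V2" "E = insert {c, t} (E1 \<union> E2)"
    "M = add_mset S N" unfolding splits_def by auto
  have cV: "card V = sz (Nd N) + sz S" using shp_card[OF s] d(6) by simp
  \<comment> \<open>This is the largest integer strictly below half of
    \<open>card V\<close>.\<close>
  have "weight (Graph V E) c \<le> (card V - 1) div 2"
  proof (rule weight_le[OF s])
    show "V \<noteq> {c}" using n uV by blast
    fix S assume "S \<in># M"
    from M[OF this] show "sz S \<le> (card V - 1) div 2" by linarith
  qed
  moreover have "sz (Nd N) \<le> weight (Graph V E) u"
    by (rule weight_ge[OF d(1)]) (use d(3-5) u2 shp_finite[OF s] in blast)+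
  moreover have "2 * sz S < card V" using M d(6) by simp
  ultimately show False using le cV by linarith
qed

text \<open>Once a vertex other than \<open>c\<close> and \<open>d\<close> is removed, one half
  remains connected together with the far end of the middle edge, which is one vertex too
  many.\<close>

lemma centroid_halves:
  assumes A: "shp V1 E1 c A" and B: "shp V2 E2 d B" and V: "V1 \<inter> V2 = {}" and AB: "sz A = sz B"
    and u: "u \<in> centroid (Graph (V1 \<union> V2) (insert {c, d} (E1 \<union> E2)))"
  shows "u = c \<or> u = d"
proof (rule ccontr)
  let ?T = "Graph (V1 \<union> V2) (insert {c, d} (E1 \<union> E2))"
  assume n: "\<not> (u = c \<or> u = d)"
  have uV: "u \<in> V1 \<union> V2" and le: "weight ?T u \<le> weight ?T c"
    using u shp_root[OF A] unfolding centroid_def by auto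
  have cd: "c \<in> V1" "d \<in> V2" using shp_root A B by fast+
  have fin: "finite (V1 \<union> V2)" using shp_finite[OF A] shp_finite[OF B] by simp
  have "shp (V1 \<union> V2) (insert {c, d} (E1 \<union> E2)) c (Nd (add_mset B (ch A)))" by (rule shp_join_root[OF A B V])
  then have "weight ?T c \<le> sz B"
  proof (rule weight_le)
    show "V1 \<union> V2 \<noteq> {c}" using cd V by blast
    fix S assume "S \<in># add_mset B (ch A)"
    then show "sz S \<le> sz B" using sz_mem[of S "ch A"] AB by auto
  qed
  moreover have "Suc (sz B) \<le> weight ?T u"
  proof (cases "u \<in> V1")
    case True
    have "shp (V2 \<union> {c}) (insert {d, c} (E2 \<union> {})) d (Nd (add_mset Lf (ch B)))"
      by (rule shp_join_root[OF B shp.base]) (use cd V in blast)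
    from weight_ge[OF this, of "V1 \<union> V2" u "insert {c, d} (E1 \<union> E2)"]
    have "sz (Nd (add_mset Lf (ch B))) \<le> weight ?T u" using True n V cd fin by (auto simp: insert_commute)
    then show ?thesis by (cases B) simp
  next
    case False
    have "shp (V1 \<union> {d}) (insert {c, d} (E1 \<union> {})) c (Nd (add_mset Lf (ch A)))"
      by (rule shp_join_root[OF A shp.base]) (use cd V in blast)
    from weight_ge[OF this, of "V1 \<union> V2" u "insert {c, d} (E1 \<union> E2)"]
    have "sz (Nd (add_mset Lf (ch A))) \<le> weight ?T u" using False n V cd fin by (auto simp: insert_commute)
    then show ?thesis using AB by (cases A) simp
  qed
  ultimately show False using le by linarith
qed

text \<open>\<open>ctr sz\<close> yields a balanced vertex or edge. A balanced vertex would be the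
  only member of the centroid; so there is a balanced edge, and its ends must be \<open>a\<close>
  and \<open>b\<close>.\<close>

lemma bicentroidal_halves:
  assumes "bicentroidal T" "centroid T = {a, b}"
  obtains V1 E1 A V2 E2 B where "shp V1 E1 a A" "shp V2 E2 b B" "V1 \<inter> V2 = {}" "sz A = sz B"
    "T = Graph (V1 \<union> V2) (insert {a, b} (E1 \<union> E2))"
proof -
  have T: "tree T" "card {a, b} = 2" using assms unfolding bicentroidal_def by auto
  have ab: "a \<noteq> b" using T(2) by auto
  have "a \<in> verts T" using assms(2) unfolding centroid_def by blast
  then obtain R where R: "shp (verts T) (edges T) a R" using tree_shp[OF T(1)] by blast
  have gT: "T = Graph (verts T) (edges T)" by simp
  obtain f M where M: "cen f M R" "ctr sz f M" using sz.cen_ex by blast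
  then obtain \<pi> where p: "ctx f \<pi>" "R = up f \<pi>" "cf \<pi> = M" unfolding cen_def by blast
  obtain S where S: "R \<approx> S" "if f then S = Nd M else \<exists>X N. M = {#X, Nd N#} \<and> S = Nd (add_mset X N)"
    using up_ueq_root[OF p(1)] unfolding p(3) p(2)[symmetric] by blast
  obtain c where c: "shp (verts T) (edges T) c S" using shp_ueq[OF R S(1)] by blast
  show ?thesis
  proof (cases f)
    case True
    then have cM: "shp (verts T) (edges T) c (Nd M)" using c S(2) by simp
    have "2 * sz Z < card (verts T)" if Z: "Z \<in># M" for Z
    proof -
      obtain N where N: "M = add_mset Z N" using Z by (metis multi_member_split)
      have "sz Z < sz (Nd N)" using ctr_D[of sz f Z N] M(2) True N by simp
      then show ?thesis using shp_card[OF cM] N by simp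
    qed
    then have "u = c" if "u \<in> {a, b}" for u using centroid_unique[OF cM] that assms(2) gT by metis
    then show ?thesis using ab by blast
  next
    case False
    then obtain X N where X: "M = {#X, Nd N#}" "S = Nd (add_mset X N)" using S(2) by auto
    have sX: "sz (Nd N) = sz X" using M(2) False X(1) ctr_False_iff by metis
    obtain W1 F1 W2 F2 d where "splits (verts T) (edges T) c (Nd (add_mset X N)) W1 F1 N W2 F2 d X"
      using splits_shape c X(2) by metis
    then have h: "shp W1 F1 c (Nd N)" "shp W2 F2 d X" "W1 \<inter> W2 = {}" "verts T = W1 \<union> W2" "edges T = insert {c, d} (F1 \<union> F2)"
      unfolding splits_def by blast+
    have g: "T = Graph (W1 \<union> W2) (insert {c, d} (F1 \<union> F2))" using gT h(4,5) by simp
    have "u = c \<or> u = d" if "u \<in> {a, b}" for u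
      using centroid_halves[OF h(1-3) sX, of u] that assms(2) g by simp
    then consider "a = c" "b = d" | "a = d" "b = c" using ab by blast
    then show ?thesis
    proof cases
      case 1
      then show ?thesis using that[OF _ _ h(3) sX] h(1,2) g by blast
    next
      case 2
      have "W2 \<inter> W1 = {}" "T = Graph (W2 \<union> W1) (insert {d, c} (F2 \<union> F1))" using h(3) g by (auto simp: insert_commute Un_commute)
      then show ?thesis using that[OF _ _ _ sX[symmetric]] h(1,2) 2 by blast
    qed
  qed
qed

section \<open>One edge-card does not suffice\<close>

lemma nonadjacent_ex: "shp V E r R \<Longrightarrow> 3 \<le> sz R \<Longrightarrow> \<exists>x\<in>V. \<exists>y\<in>V. x \<noteq> y \<and> {x, y} \<notin> E"
proof (induction rule: shp.induct)
  case (join V E r M V' E' s S)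
  note j = join.hyps
  have rs: "r \<in> V" "s \<in> V'" using shp_root[OF j(1)] shp_root[OF j(2)] .
  have sub: "e \<subseteq> V" if "e \<in> E" for e using shp_edge[OF j(1) that] by blast
  have sub': "e \<subseteq> V'" if "e \<in> E'" for e using shp_edge[OF j(2) that] by blast
  have "3 \<le> card (V \<union> V')" using join.prems shp_card[OF shp.join[OF j]] by simp
  moreover have "card {r, s} \<le> 2" by (simp add: card_insert_if)
  ultimately have "V \<union> V' \<noteq> {r, s}" by auto
  then obtain v where v: "v \<in> V \<union> V'" "v \<noteq> r" "v \<noteq> s" using rs by blast
  show ?case
  proof (cases "v \<in> V")
    case True
    have "{v, s} \<noteq> {r, s}" using v by (auto simp: doubleton_eq_iff)
    moreover have "{v, s} \<notin> E" using sub[of "{v, s}"] rs j(3) by blast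
    moreover have "{v, s} \<notin> E'" using sub'[of "{v, s}"] True j(3) by blast
    ultimately show ?thesis using v rs True by blast
  next
    case False
    have "{r, v} \<noteq> {r, s}" using v by (auto simp: doubleton_eq_iff)
    moreover have "{r, v} \<notin> E" using sub[of "{r, v}"] False by blast
    moreover have "{r, v} \<notin> E'" using sub'[of "{r, v}"] rs j(3) by blast
    ultimately have "{r, v} \<notin> insert {r, s} (E \<union> E')" by simp
    moreover have "r \<noteq> v" using v(2) by simp
    ultimately show ?thesis using v(1) UnI1[OF rs(1)] by metis
  qed
qed simp

text \<open>The deleted edge is replaced by one inside a piece with at least three vertices. The new
  graph has the same edge-card but is disconnected.\<close>

lemma not_reconstructs_single_aux:
  assumes T: "shp V E a R" and p: "shp U1 K1 u1 R1" "shp U2 K2 u2 R2" "U1 \<inter> U2 = {}" "V = U1 \<union> U2" "E - {e} = K1 \<union> K2"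
    and big: "3 \<le> sz R1" and rec: "reconstructs (Graph V E) [e]"
  shows False
proof -
  obtain x y where xy: "x \<in> U1" "y \<in> U1" "x \<noteq> y" "{x, y} \<notin> K1" using nonadjacent_ex[OF p(1) big] by blast
  \<comment> \<open>Competitors in \<open>reconstructs\<close> have natural numbers as
    vertices.\<close>
  obtain g :: "'a \<Rightarrow> nat" where g: "inj_on g V" using finite_imp_inj_to_nat_seg[OF shp_finite[OF T]] by blast
  let ?K = "K1 \<union> K2"
  let ?E = "(`) g ` insert {x, y} ?K"
  let ?H = "Graph (g ` V) ?E"
  have K: "d \<subseteq> V \<and> card d = 2 \<and> (d \<subseteq> U1 \<or> d \<subseteq> U2)" if "d \<in> insert {x, y} ?K" for d
    using that shp_edge[OF p(1), of d] shp_edge[OF p(2), of d] xy p(4) by auto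
  have "{x, y} \<notin> K2" using shp_edge[OF p(2), of "{x, y}"] xy p(3) by blast
  then have nK: "{x, y} \<notin> ?K" using xy by blast
  have "g ` {x, y} \<noteq> g ` d" if d: "d \<in> ?K" for d
    using inj_on_image_eq_iff[OF g, of "{x, y}" d] K[of d] d xy p(4) nK by blast
  then have "?E - {g ` {x, y}} = (`) g ` ?K" by blast
  then have del: "del_edge ?H (g ` {x, y}) = Graph (g ` V) ((`) g ` ?K)" unfolding del_edge_def by simp
  have "sgraph ?H" unfolding sgraph_def
  proof (intro conjI ballI)
    show "finite (verts ?H)" using shp_finite[OF T] by simp
    fix e' assume "e' \<in> edges ?H"
    then obtain d where d: "d \<in> insert {x, y} ?K" "e' = g ` d" by auto
    show "e' \<subseteq> verts ?H" using K[OF d(1)] d(2) by auto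
    show "card e' = 2" using K[OF d(1)] d(2) card_image inj_on_subset[OF g] by metis
  qed
  note sH = this
  have "Graph V ?K \<simeq> Graph (g ` V) ((`) g ` ?K)" by (rule iso_imageI[OF g]) (use K in blast)
  then have "del_edge ?H (g ` {x, y}) \<simeq> del_edge (Graph V E) e"
    unfolding del using graph_iso_sym p(5) by (simp add: del_edge_def)
  then have "?H \<simeq> Graph V E"
    using rec[unfolded reconstructs_def, rule_format, of ?H "[g ` {x, y}]"] sH by simp
  then obtain h where h: "inj_on h V" "g ` V = h ` V" "?E = (`) h ` E"
    using iso_imageE[OF graph_iso_sym shp_sgraph[OF T] sH] by auto
  have s: "shp (g ` V) ?E (h a) R" using shp_image[OF T h(1)] h(2,3) by simp
  have dis: "g ` U1 \<inter> g ` U2 = {}" using g p(3,4) unfolding inj_on_def by blast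
  have "g ` V \<subseteq> g ` U1"
  proof (rule shp_closed[OF s subset_refl])
    show "g ` V \<inter> g ` U1 \<noteq> {}" using p(4) xy(1) by blast
    fix e' assume e': "e' \<in> ?E" "e' \<inter> g ` U1 \<noteq> {}"
    then obtain d where d: "d \<in> insert {x, y} ?K" "e' = g ` d" by blast
    show "e' \<subseteq> g ` U1" using K[OF d(1)] d(2) e'(2) dis by blast
  qed
  moreover have "g u2 \<in> g ` V" "g u2 \<in> g ` U2" using shp_root[OF p(2)] p(4) by blast+
  ultimately show False using dis by blast
qed

text \<open>With five vertices, one of the two pieces has at least three.\<close>

lemma not_reconstructs_single:
  assumes T: "shp V E a R" and "5 \<le> card V" "e \<in> E"
  shows "\<not> reconstructs (Graph V E) [e]"
proof
  assume rec: "reconstructs (Graph V E) [e]"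
  obtain V1 E1 R1 V2 E2 s R2 where "cut V E a R e V1 E1 R1 V2 E2 s R2" using cut_ex[OF T assms(3)] by metis
  then have c: "V = V1 \<union> V2" "V1 \<inter> V2 = {}" "E - {e} = E1 \<union> E2" "shp V1 E1 a R1" "shp V2 E2 s R2" unfolding cut_def by blast+
  have "card V = sz R1 + sz R2"
    using c(1,2) card_Un_disjoint shp_finite[OF c(4)] shp_finite[OF c(5)] shp_card[OF c(4)] shp_card[OF c(5)] by metis
  then consider "3 \<le> sz R1" | "3 \<le> sz R2" using assms(2) by linarith
  then show False
  proof cases
    case 1
    show False by (rule not_reconstructs_single_aux[OF T c(4,5,2,1,3) 1 rec])
  next
    case 2
    have "V2 \<inter> V1 = {}" "V = V2 \<union> V1" "E - {e} = E2 \<union> E1" using c(1-3) by blast+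
    then show False by (rule not_reconstructs_single_aux[OF T c(5,4) _ _ _ 2 rec])
  qed
qed

lemma not_reconstructs_Nil:
  assumes "verts T \<noteq> {}"
  shows "\<not> reconstructs T []"
proof
  assume "reconstructs T []"
  then have "(Graph {} {} :: nat graph) \<simeq> T"
    unfolding reconstructs_def by (auto simp: sgraph_def dest: spec[of _ "Graph {} {}"])
  then show False using assms unfolding iso_def bij_betw_def by auto
qed

text \<open>A half with a single edge is the path on two vertices; excluding it makes
  \<open>A1 \<noteq> Lf\<close> available.\<close>

lemma edge_pseudopath:
  assumes "shp V E a (Nd {#Lf#})"
  shows "pseudopath (Graph V E)"
proof -
  have "\<not> is_cycle (Graph V E) c" for c
  proof
    assume c: "is_cycle (Graph V E) c"
    then obtain x y z cs where xyz: "c = x # y # z # cs"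
      unfolding is_cycle_def by (metis Suc_le_length_iff numeral_3_eq_3)
    then have "{x, y} \<in> E" "{y, z} \<in> E" and d: "card {x, y, z} = 3" using c unfolding is_cycle_def by auto
    then have "{x, y, z} \<subseteq> V" using shp_edge[OF assms] by blast
    then have "card {x, y, z} \<le> card V" by (rule card_mono[OF shp_finite[OF assms]])
    moreover have "card V = 2" using shp_card[OF assms] by simp
    ultimately show False using d by linarith
  qed
  moreover have "connected (Graph V E)"
    using shp_connected[OF assms _ _ subset_refl] shp_root[OF assms] unfolding connected_def reachable_def by auto
  ultimately have "tree (Graph V E)" unfolding tree_def using shp_sgraph[OF assms] by blast
  moreover have "shp ({0} \<union> {1}) (insert {0, 1} ({} \<union> {})) (0::nat) (Nd {#Lf#})"
    by (rule shp.join) (simp_all add: shp.base)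
  from shp_isoI[OF assms this rtranclp.rtrancl_refl]
  have "Graph V E \<simeq> Graph ({0} \<union> {1}) (insert {0, 1} ({} \<union> {}) :: nat set set)" .
  moreover have "path_graph 2 = Graph ({0} \<union> {1}) (insert {0, 1} ({} \<union> {}))"
    unfolding path_graph_def by auto
  ultimately show ?thesis unfolding pseudopath_def by metis
qed

text \<open>One of the two edges at \<open>a\<close> leads to \<open>b\<close>, so \<open>a\<close>
  is a leaf of its own half.\<close>

lemma half_shape:
  assumes A: "shp V1 E1 a A" and B: "shp V2 E2 b B" and V: "V1 \<inter> V2 = {}"
    and "degree (Graph (V1 \<union> V2) (insert {a, b} (E1 \<union> E2))) a = 2" and "\<not> pseudopath (Graph V1 E1)"
  obtains A1 where "A = Nd {#A1#}" "A1 \<noteq> Lf"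
proof -
  have "size (ch (Nd (add_mset B (ch A)))) = 2"
    using shp_degree[OF shp_join_root[OF A B V]] assms(4) unfolding degree_def by simp
  then have "size (ch A) = 1" by simp
  then obtain A1 where A1: "ch A = {#A1#}" using size_1_singleton_mset by blast
  then have AA: "A = Nd {#A1#}" by (metis rt.collapse)
  moreover have "A1 \<noteq> Lf"
  proof
    assume "A1 = Lf"
    then show False using edge_pseudopath[of V1 E1 a] A assms(5) unfolding AA by simp
  qed
  ultimately show ?thesis using that by blast
qed

theorem theorem3p2:
  fixes T G H :: "'a graph" and a b :: 'a
  assumes "bicentroidal T"
    and "centroid T = {a, b}"
    and "G \<in> components (del_edge T {a, b})" and "a \<in> verts G"
    and "H \<in> components (del_edge T {a, b})" and "b \<in> verts H"
    and "degree T a = 2" and "degree T b = 2"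
    and "\<not> pseudopath G" and "\<not> pseudopath H"
  shows "ern T = 2"
proof -
  obtain V1 E1 A V2 E2 B where A: "shp V1 E1 a A" and B: "shp V2 E2 b B" and V: "V1 \<inter> V2 = {}" and AB: "sz A = sz B"
    and T: "T = Graph (V1 \<union> V2) (insert {a, b} (E1 \<union> E2))"
    using bicentroidal_halves[OF assms(1,2)] by metis
  have V': "V2 \<inter> V1 = {}" using V by blast
  have T': "T = Graph (V2 \<union> V1) (insert {b, a} (E2 \<union> E1))" unfolding T by (auto simp: insert_commute)
  have "{a, b} \<notin> E1 \<union> E2"
    using shp_edge[OF A, of "{a, b}"] shp_edge[OF B, of "{a, b}"] shp_root[OF A] shp_root[OF B] V by blast
  then have del: "del_edge T {a, b} = Graph (V1 \<union> V2) (E1 \<union> E2)" unfolding T del_edge_def by simp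
  then have del': "del_edge T {a, b} = Graph (V2 \<union> V1) (E2 \<union> E1)" by (simp add: Un_commute)
  have G: "G = Graph V1 E1" by (rule component_piece[OF A B V assms(3)[unfolded del] assms(4)])
  have H: "H = Graph V2 E2" by (rule component_piece[OF B A V' assms(5)[unfolded del'] assms(6)])
  obtain A1 where A1: "A = Nd {#A1#}" "A1 \<noteq> Lf" using half_shape[OF A B V] assms(7,9) unfolding T G by blast
  obtain B1 where B1: "B = Nd {#B1#}" "B1 \<noteq> Lf" using half_shape[OF B A V'] assms(8,10) unfolding T' H by blast
  have "(\<exists>e\<in>E1. reconstructs T [{a, b}, e]) \<or> (\<exists>e\<in>E2. reconstructs T [{b, a}, e])"
    using separating_edge[OF A1(1) B1(1) AB A1(2) B1(2)]
  proof (elim disjE exE)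
    assume "edge_sep A1 B"
    then show ?thesis using edge_sep_reconstructs[OF A[unfolded A1(1)] B V _ T] AB A1(1) by simp
  next
    assume "edge_sep B1 A"
    then show ?thesis using edge_sep_reconstructs[OF B[unfolded B1(1)] A V' _ T'] AB B1(1) by simp
  next
    fix P assume "leaf_sep A B P"
    then show ?thesis using leaf_sep_reconstructs[OF A B V AB T] by blast
  next
    fix P assume "leaf_sep B A P"
    then show ?thesis using leaf_sep_reconstructs[OF B A V' AB[symmetric] T'] by blast
  qed
  moreover have "{b, a} = {a, b}" by blast
  ultimately obtain e where e: "e \<in> E1 \<union> E2" "reconstructs T [{a, b}, e]" by auto
  have "e \<noteq> {a, b}" using e(1) \<open>{a, b} \<notin> E1 \<union> E2\<close> by blast
  then have two: "\<exists>es. distinct es \<and> set es \<subseteq> edges T \<and> length es = 2 \<and> reconstructs T es"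
    using e unfolding T by (intro exI[of _ "[{a, b}, e]"]) auto
  have S: "shp (V1 \<union> V2) (insert {a, b} (E1 \<union> E2)) a (Nd (add_mset B (ch A)))" by (rule shp_join_root[OF A B V])
  have "2 \<le> sz A1" using A1(2) sz_eq_1[of A1] sz_pos(1)[of A1] by linarith
  then have big: "5 \<le> card (V1 \<union> V2)" using shp_card[OF S] AB A1(1) by simp
  have lower: "2 \<le> length es" if es: "set es \<subseteq> edges T" "reconstructs T es" for es
  proof (rule ccontr)
    assume "\<not> 2 \<le> length es"
    then consider "es = []" | e where "es = [e]" by (cases es; cases "tl es") auto
    then show False
    proof cases
      case 1
      have "verts T \<noteq> {}" unfolding T using shp_root[OF A] by auto
      from not_reconstructs_Nil[OF this] show False using es(2) unfolding 1 by contradiction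
    next
      case 2
      then have "e \<in> insert {a, b} (E1 \<union> E2)" using es(1) unfolding T by simp
      from not_reconstructs_single[OF S big this] show False using es(2) 2 unfolding T by simp
    qed
  qed
  show ?thesis unfolding ern_def
  proof (rule antisym)
    have "enat 2 \<in> {enat k |k. \<exists>es. distinct es \<and> set es \<subseteq> edges T \<and> length es = k \<and> reconstructs T es}"
      using two by blast
    then have "Inf {enat k |k. \<exists>es. distinct es \<and> set es \<subseteq> edges T \<and> length es = k \<and> reconstructs T es} \<le> enat 2"
      by (rule Inf_lower)
    then show "Inf {enat k |k. \<exists>es. distinct es \<and> set es \<subseteq> edges T \<and> length es = k \<and> reconstructs T es} \<le> 2"
      by (simp add: numeral_eq_enat)
    show "2 \<le> Inf {enat k |k. \<exists>es. distinct es \<and> set es \<subseteq> edges T \<and> length es = k \<and> reconstructs T es}"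
      by (rule Inf_greatest) (use lower in \<open>auto simp: numeral_eq_enat\<close>)
  qed
qed

end
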